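(* Let $d\ge2$ and $\alpha\in[-1/2,\infty)^d$. There is a constant $c>0$ depending only on $d$ and $\alpha$ such that the following holds. Let $2d/(d-1)<p\le\infty$ and let $\lambda(p):=\max\{d(\tfrac12-\tfrac1p)-\tfrac12,0\}$. If $0\le\lambda<\lambda(p)/2$, then there exists a measurable function $f\in L^p(\mathbb{R}_+^d)$ such that $$\Big|\Big\{x\in\mathbb{R}_+^d:\ \sup_{R>0}|S_R^\lambda(\mathcal{L}^\alpha)f(x)|=\infty\Big\}\Big|\ge c .$$
   Context: $\mathbb{R}_+^d=(0,\infty)^d$ with Lebesgue measure, $|E|$ denotes the Lebesgue measure of a set $E$, $\mathbb{N}=\{0,1,2,\dots\}$, $|\alpha|_1=\alpha_1+\cdots+\alpha_d$, $|\mu|_1=\mu_1+\cdots+\mu_d$. For $a>-1$ the Laguerre polynomials $L_n^a$ are defined by $\sum_{n\ge0}L_n^a(x)t^n=(1-t)^{-a-1}e^{-xt/(1-t)}$, $|t|<1$. The one-dimensional Laguerre functions are $$\varphi_n^{a}(x)=\Big(\frac{2\,n!}{\Gamma(n+a+1)}\Big)^{1/2}x^{a+1/2}L_n^{a}(x^2)e^{-x^2/2},\quad x>0,$$ and for $\mu\in\mathbb{N}^d$, $\varphi_\mu^\alpha(x)=\prod_{j=1}^d\varphi_{\mu_j}^{\alpha_j}(x_j)$; these form an orthonormal basis of $L^2(\mathbb{R}_+^d)$. $\mathcal{L}^\alpha$ is the self-adjoint operator on $L^2(\mathbb{R}_+^d)$ with $\mathcal{L}^\alpha\varphi_\mu^\alpha=(4|\mu|_1+2|\alpha|_1+2d)\varphi_\mu^\alpha$.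 The spectral projections are $\mathcal{P}_n^\alpha f=\sum_{|\mu|_1=n}\langle f,\varphi_\mu^\alpha\rangle\varphi_\mu^\alpha$, with $\langle f,g\rangle=\int_{\mathbb{R}_+^d}f\overline{g}\,dx$; they make sense for $f\in L^p(\mathbb{R}_+^d)$. With $e_n=4n+2|\alpha|_1+2d$ and $t_+=\max\{0,t\}$, the Bochner–Riesz means of order $\lambda\ge 0$ are the finite sums $$S_R^\lambda(\mathcal{L}^\alpha)f(x)=\sum_{n=0}^\infty\Big(1-\frac{e_n}{R^2}\Big)_+^\lambda\mathcal{P}_n^\alpha f(x),\quad R>0.$$ *)

theory Defs
  imports "HOL-Analysis.Analysis" "HOL-Complex_Analysis.Cauchy_Integral_Formula"
begin

text \<open>
  The dimension \<open>d\<close> is \<open>CARD('n)\<close>; a multi-index \<open>\<mu> \<in> \<nat>\<^sup>d\<close> is an element of \<open>nat ^ 'n\<close>.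
\<close>

definition pos_orthant :: "(real ^ 'n) set" where
  "pos_orthant = {x. \<forall>j. 0 < x $ j}"

definition l1 :: "('a :: comm_monoid_add) ^ 'n \<Rightarrow> 'a" where
  "l1 v = (\<Sum>j\<in>UNIV. v $ j)"

text \<open>
  The sequence of coefficients of the generating function; \<open>laguerre_generating_function\<close>
  and \<open>laguerre_unique\<close> below show that it exists and is unique.
\<close>

definition laguerre :: "real \<Rightarrow> nat \<Rightarrow> real \<Rightarrow> real" where
  "laguerre a n x =
     (THE L. \<forall>t. \<bar>t\<bar> < 1 \<longrightarrow>
        (\<lambda>k. L k * t ^ k) sums ((1 - t) powr (- a - 1) * exp (- x * t / (1 - t)))) n"

definition laguerre_fun1 :: "real \<Rightarrow> nat \<Rightarrow> real \<Rightarrow> real" where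
  "laguerre_fun1 a n x =
     sqrt (2 * fact n / Gamma (real n + a + 1)) * x powr (a + 1/2) *
       laguerre a n (x\<^sup>2) * exp (- x\<^sup>2 / 2)"

definition laguerre_fun :: "real ^ 'n \<Rightarrow> nat ^ 'n \<Rightarrow> real ^ 'n \<Rightarrow> real" where
  "laguerre_fun \<alpha> \<mu> x = (\<Prod>j\<in>UNIV. laguerre_fun1 (\<alpha> $ j) (\<mu> $ j) (x $ j))"

text \<open>The essential bound for \<open>p = \<infinity>\<close> is a real number, so \<open>f\<close> is essentially bounded.\<close>

definition in_Lp :: "'a measure \<Rightarrow> ennreal \<Rightarrow> ('a \<Rightarrow> complex) \<Rightarrow> bool" where
  "in_Lp M p f \<longleftrightarrow> f \<in> borel_measurable M \<and>
     (if p = \<infinity> then \<exists>C::real. AE x in M. norm (f x) \<le> C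
      else (\<integral>\<^sup>+ x. ennreal (norm (f x) powr enn2real p) \<partial>M) < \<infinity>)"

definition orthant_inner :: "(real ^ 'n \<Rightarrow> complex) \<Rightarrow> (real ^ 'n \<Rightarrow> complex) \<Rightarrow> complex" where
  "orthant_inner f g = (LINT x|lebesgue_on pos_orthant. f x * cnj (g x))"

definition spectral_proj ::
  "real ^ 'n \<Rightarrow> nat \<Rightarrow> (real ^ 'n \<Rightarrow> complex) \<Rightarrow> real ^ 'n \<Rightarrow> complex" where
  "spectral_proj \<alpha> n f x =
     (\<Sum>\<mu> | l1 \<mu> = n.
        orthant_inner f (\<lambda>y. of_real (laguerre_fun \<alpha> \<mu> y)) * of_real (laguerre_fun \<alpha> \<mu> x))"

definition laguerre_eigenvalue :: "real ^ 'n \<Rightarrow> nat \<Rightarrow> real" where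
  "laguerre_eigenvalue \<alpha> n = 4 * real n + 2 * l1 \<alpha> + 2 * real CARD('n)"

text \<open>
  Since \<open>0 powr 0 = 0\<close>, the multiplier for \<open>\<lambda> = 0\<close> is the indicator of \<open>e\<^sub>n < R\<^sup>2\<close>, and
  only finitely many terms are nonzero for every \<open>\<lambda>\<close>.
\<close>

definition bochner_riesz ::
  "real ^ 'n \<Rightarrow> real \<Rightarrow> real \<Rightarrow> (real ^ 'n \<Rightarrow> complex) \<Rightarrow> real ^ 'n \<Rightarrow> complex" where
  "bochner_riesz \<alpha> lam R f x =
     (\<Sum>n. of_real (max 0 (1 - laguerre_eigenvalue \<alpha> n / R\<^sup>2) powr lam) *
           spectral_proj \<alpha> n f x)"

text \<open>For \<open>p = \<infinity>\<close> the term \<open>1 / p\<close> is \<open>0\<close>.\<close>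

definition critical_index :: "nat \<Rightarrow> ennreal \<Rightarrow> real" where
  "critical_index d p = max (real d * (1/2 - enn2real (1 / p)) - 1/2) 0"

lemma laguerre_ex:
  fixes a x :: real
  shows "\<exists>L. \<forall>t. \<bar>t\<bar> < 1 \<longrightarrow>
    (\<lambda>k. L k * t ^ k) sums ((1 - t) powr (- a - 1) * exp (- x * t / (1 - t)))"
proof -
  define f :: "complex \<Rightarrow> complex" where
    "f = (\<lambda>z. (1 - z) powr (of_real (- a - 1)) * exp (- of_real x * z / (1 - z)))"
  have notneg: "1 - z \<notin> \<real>\<^sub>\<le>\<^sub>0" if "z \<in> ball 0 1" for z :: complex
  proof
    assume "1 - z \<in> \<real>\<^sub>\<le>\<^sub>0"
    then have "Re z \<ge> 1" by (auto simp: complex_nonpos_Reals_iff)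
    with that complex_Re_le_cmod[of z] show False by simp
  qed
  then have nz: "1 - z \<noteq> 0" if "z \<in> ball 0 1" for z :: complex
    using that by force
  have hol: "f holomorphic_on ball 0 1"
    unfolding f_def by (intro holomorphic_intros) (use notneg nz in auto)
  define L where "L = (\<lambda>k. Re ((deriv ^^ k) f 0 / fact k))"
  have "(\<lambda>k. L k * t ^ k) sums ((1 - t) powr (- a - 1) * exp (- x * t / (1 - t)))"
    if t: "\<bar>t\<bar> < 1" for t
  proof -
    have "(\<lambda>k. (deriv ^^ k) f 0 / fact k * (of_real t - 0) ^ k) sums f (of_real t)"
      by (rule holomorphic_power_series[OF hol]) (use t in simp)
    then have "(\<lambda>k. Re ((deriv ^^ k) f 0 / fact k * of_real (t ^ k))) sums Re (f (of_real t))"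
      by (intro sums_Re) simp
    moreover have "Re ((deriv ^^ k) f 0 / fact k * of_real (t ^ k)) = L k * t ^ k" for k
      unfolding L_def times_complex.sel by (simp only: Re_complex_of_real Im_complex_of_real mult_zero_right diff_zero)
    moreover have "f (of_real t) =
        of_real ((1 - t) powr (- a - 1) * exp (- x * t / (1 - t)))"
      using t powr_of_real[of "1 - t" "- a - 1"] by (simp add: f_def flip: exp_of_real)
    ultimately show ?thesis
      by (simp only: Re_complex_of_real)
  qed
  then show ?thesis by blast
qed

lemma laguerre_unique:
  fixes L L' :: "nat \<Rightarrow> real"
  assumes "\<forall>t. \<bar>t\<bar> < 1 \<longrightarrow> (\<lambda>k. L k * t ^ k) sums g t"
    and "\<forall>t. \<bar>t\<bar> < 1 \<longrightarrow> (\<lambda>k. L' k * t ^ k) sums g t"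
  shows "L = L'"
proof (rule ccontr)
  assume "L \<noteq> L'"
  define m where "m = (LEAST k. L k \<noteq> L' k)"
  have m: "L m \<noteq> L' m" and below: "\<And>k. k < m \<Longrightarrow> L k = L' k"
  proof -
    have "\<exists>k. L k \<noteq> L' k" using \<open>L \<noteq> L'\<close> by blast
    then show "L m \<noteq> L' m" unfolding m_def by (rule LeastI_ex)
    show "L k = L' k" if "k < m" for k
      using not_less_Least[of k "\<lambda>k. L k \<noteq> L' k"] that unfolding m_def by blast
  qed
  define D where "D = (\<lambda>k. L (k + m) - L' (k + m))"
  have zero: "(\<lambda>k. D k * t ^ k) sums 0" if "t \<noteq> 0" "\<bar>t\<bar> < 1" for t
  proof -
    have "(\<lambda>k. (L k - L' k) * t ^ k) sums 0"
      using sums_diff[OF assms(1)[rule_format, OF that(2)] assms(2)[rule_format, OF that(2)]]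
      by (simp add: algebra_simps)
    moreover have "(\<Sum>k<m. (L k - L' k) * t ^ k) = 0" using below by simp
    ultimately have "(\<lambda>k. (L (k + m) - L' (k + m)) * t ^ (k + m)) sums 0"
      by (subst sums_iff_shift) simp
    then have "(\<lambda>k. (D k * t ^ k) * t ^ m) sums (0 * t ^ m)"
      by (simp add: D_def power_add mult.assoc)
    then show ?thesis using that(1) by (subst (asm) sums_mult2_iff) auto
  qed
  have "((\<lambda>_. 0) \<longlongrightarrow> D 0) (at (0::real))"
    by (rule powser_limit_0_strong[of 1]) (use zero in auto)
  then show False using m LIM_unique[OF _ tendsto_const] by (fastforce simp: D_def)
qed

lemma laguerre_generating_function:
  assumes "\<bar>t\<bar> < 1"
  shows "(\<lambda>n. laguerre a n x * t ^ n) sums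
           ((1 - t) powr (- a - 1) * exp (- x * t / (1 - t)))"
proof -
  let ?P = "\<lambda>L. \<forall>t. \<bar>t\<bar> < 1 \<longrightarrow>
    (\<lambda>k. L k * t ^ k) sums ((1 - t) powr (- a - 1) * exp (- x * t / (1 - t)))"
  have "\<exists>!L. ?P L"
    using laguerre_ex[of a x] laguerre_unique by (intro ex_ex1I) blast+
  from theI'[OF this] show ?thesis
    unfolding laguerre_def using assms by blast
qed

lemma finite_multi_indices: "finite {\<mu> :: nat ^ 'n. l1 \<mu> = n}"
proof (rule finite_subset)
  show "{\<mu> :: nat ^ 'n. l1 \<mu> = n} \<subseteq> vec_lambda ` (UNIV \<rightarrow>\<^sub>E {..n})"
  proof
    fix \<mu> :: "nat ^ 'n"
    assume "\<mu> \<in> {\<mu>. l1 \<mu> = n}"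
    then have "\<mu> $ j \<le> n" for j
      unfolding l1_def using member_le_sum[of j UNIV "\<lambda>j. \<mu> $ j"] by auto
    then show "\<mu> \<in> vec_lambda ` (UNIV \<rightarrow>\<^sub>E {..n})"
      by (intro image_eqI[of _ _ "\<lambda>j. \<mu> $ j"]) auto
  qed
qed (intro finite_imageI finite_PiE; simp)

lemma finite_bochner_riesz_terms:
  fixes \<alpha> :: "real ^ 'n"
  assumes "R > 0"
  shows "finite {n. max 0 (1 - laguerre_eigenvalue \<alpha> n / R\<^sup>2) powr lam \<noteq> 0}"
proof (rule finite_subset)
  let ?B = "nat \<lceil>R\<^sup>2 - 2 * l1 \<alpha> - 2 * real CARD('n)\<rceil>"
  show "{n. max 0 (1 - laguerre_eigenvalue \<alpha> n / R\<^sup>2) powr lam \<noteq> 0} \<subseteq> {..?B}"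
  proof
    fix n
    assume "n \<in> {n. max 0 (1 - laguerre_eigenvalue \<alpha> n / R\<^sup>2) powr lam \<noteq> 0}"
    then have "1 - laguerre_eigenvalue \<alpha> n / R\<^sup>2 > 0"
      by (cases "1 - laguerre_eigenvalue \<alpha> n / R\<^sup>2 > 0") (simp_all add: max_absorb1)
    then have "laguerre_eigenvalue \<alpha> n < R\<^sup>2" using assms by (simp add: field_simps)
    then have "real n \<le> R\<^sup>2 - 2 * l1 \<alpha> - 2 * real CARD('n)"
      unfolding laguerre_eigenvalue_def by linarith
    then show "n \<in> {..?B}" unfolding atMost_iff by linarith
  qed
qed simp

end

theory Submission
  imports Defs "HOL-Real_Asymp.Real_Asymp"
begin

text \<open>
  For \<open>f(x) = x\<^bsup>\<alpha> + 1/2\<^esup> g(|x|\<^sup>2)\<close> the addition formula for Laguerre polynomials gives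
  \<open>P\<^sub>n f = a\<^sub>n(g) \<Phi>\<^sub>n\<close>, where \<open>\<Phi>\<^sub>n(x) = x\<^bsup>\<alpha> + 1/2\<^esup> L\<^sub>n\<^bsup>A\<^esup>(|x|\<^sup>2) exp (- |x|\<^sup>2 / 2)\<close>,
  \<open>A = |\<alpha>|\<^sub>1 + d - 1\<close>, and \<open>a\<^sub>n\<close> is an explicit radial integral. The function
  \<open>u(r) = r\<^bsup>A + 1/2\<^esup> L\<^sub>n\<^bsup>A\<^esup>(r\<^sup>2) exp (- r\<^sup>2 / 2)\<close> solves \<open>u'' + q u = 0\<close> with
  \<open>q(r) = E - r\<^sup>2 - (A\<^sup>2 - 1/4) / r\<^sup>2\<close> and \<open>E = 4 n + 2 A + 2\<close>. The energy \<open>u'\<^sup>2 + q u\<^sup>2\<close> is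
  comparable to a constant \<open>\<Gamma>\<close> on \<open>[1, sqrt E / 2]\<close>. Near \<open>|x| \<approx> 1\<close> this makes
  \<open>\<Phi>\<^sub>n\<close> of size \<open>sqrt (\<Gamma> / E)\<close> on a set of measure bounded below, and near
  \<open>|x| \<approx> sqrt E\<close> it bounds the norm of \<open>a\<^sub>n\<close> on a weighted space of bounded functions from below.
  Together \<open>|a\<^sub>n \<Phi>\<^sub>n| / n\<^bsup>\<lambda>\<^esup>\<close> can be made unbounded for \<open>\<lambda> < \<lambda>(p) / 2\<close>, so the uniform boundedness
  principle yields one \<open>f\<close> with \<open>|P\<^sub>n f(x)| / n\<^bsup>\<lambda>\<^esup>\<close> unbounded on the upper limit of these sets.
  On the other hand, bounded Riesz means of order \<open>\<lambda>\<close> at \<open>x\<close> force \<open>P\<^sub>n f(x) = O(n\<^bsup>\<lambda>\<^esup>)\<close>.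
\<close>

section \<open>Laguerre polynomials\<close>

text \<open>The product in the overview is at least of order E^(A/2 + 1/4 - \<gamma>), where
  \<open>(1 + s) powr (- \<gamma>)\<close> is the decay of g and \<gamma> = (|\<alpha>|_1 + d/2)/2 +
  \<beta>. The first summand only compensates the growth of x^(\<alpha> + 1/2), and f is in L^p as
  soon as \<beta> > d/(2p). The exponent then equals d/4 - 1/4 - \<beta>, which tends to
  \<lambda>(p)/2 as \<beta> decreases to d/(2p): this is the origin of the threshold. The obstacle
  is oscillation: the zeros of the eigenfunctions move with n, so lower bounds hold in mean square
  only, and the set of large values changes with n. Divergence is therefore obtained on an upper
  limit of sets inside one ball. Since each projection of f is a scalar multiple of one fixed
  eigenfunction, these sets depend on \<alpha> and n but not on f, p or \<lambda>, which makes c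
  uniform. The same \<Gamma> governs the local size and the coefficient, each through its square
  root, so what has to be known about \<Gamma> is a lower bound relative to the norm of the
  profile.\<close>

definition laguerre_coeff :: "real \<Rightarrow> nat \<Rightarrow> nat \<Rightarrow> real" where
  "laguerre_coeff a n k =
     (if k \<le> n then (-1) ^ k / fact k * pochhammer (a + 1 + real k) (n - k) / fact (n - k) else 0)"

lemma negative_binomial_sums:
  assumes "\<bar>t\<bar> < (1::real)"
  shows "(\<lambda>m. pochhammer b m / fact m * t ^ m) sums ((1 - t) powr (- b))"
proof -
  have "(\<lambda>m. ((- b) gchoose m) * (- t) ^ m) sums (1 + - t) powr (- b)"
    by (rule gen_binomial_real) (use assms in simp)
  moreover have "((- b) gchoose m) * (- t) ^ m = pochhammer b m / fact m * t ^ m" for m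
    by (simp add: gbinomial_pochhammer power_minus[of t])
  ultimately show ?thesis by simp
qed

text \<open>Expanding the exponential in powers of x leaves
  \<open>(1 - t) powr (- a - 1 - k)\<close> for each k, whose binomial series has the coefficients
  \<open>B k m\<close>. Collecting the double series along n = k + m gives the claim by uniqueness
  of power series. The condition a > -1 makes every \<open>B k m\<close> nonnegative.\<close>

lemma laguerre_explicit:
  assumes "a > -1"
  shows "laguerre a n x = (\<Sum>k\<le>n. laguerre_coeff a n k * x ^ k)"
proof -
  define B where "B = (\<lambda>k m. pochhammer (a + 1 + real k) m / fact m)"
  have B0: "B k m \<ge> 0" for k m
    unfolding B_def using assms by (intro divide_nonneg_nonneg pochhammer_nonneg) auto
  have "(\<lambda>n. (\<Sum>k\<le>n. laguerre_coeff a n k * x ^ k) * t ^ n) sums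
      ((1 - t) powr (- a - 1) * exp (- x * t / (1 - t)))" if t: "\<bar>t\<bar> < 1" for t
  proof -
    define h where "h = (\<lambda>x t (k, m). (- x) ^ k / fact k * t ^ (k + m) * B k m :: real)"
    have inner: "((\<lambda>m. h x t (k, m)) has_sum
        ((1 - t) powr (- a - 1) * ((- x * t / (1 - t)) ^ k / fact k))) UNIV"
      if t: "\<bar>t\<bar> < 1" for x t :: real and k
    proof -
      have s: "(\<lambda>m. B k m * t ^ m) sums ((1 - t) powr (- (a + 1 + k)))" if "\<bar>t\<bar> < 1" for t
        unfolding B_def by (rule negative_binomial_sums[OF that])
      have "(\<lambda>m. h x t (k, m)) = (\<lambda>m. ((- x) ^ k / fact k * t ^ k) * (B k m * t ^ m))"
        by (auto simp: h_def power_add)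
      moreover have "((\<lambda>m. B k m * t ^ m) has_sum ((1 - t) powr (- (a + 1 + k)))) UNIV"
      proof (rule norm_summable_imp_has_sum[OF _ s[OF t]])
        show "summable (\<lambda>m. norm (B k m * t ^ m))"
          using s[of "\<bar>t\<bar>"] t B0 by (simp add: abs_mult power_abs sums_iff)
      qed
      moreover have "(1 - t) powr (- (a + 1 + k)) = (1 - t) powr (- a - 1) / (1 - t) ^ k"
        using t by (simp add: powr_realpow powr_minus powr_add field_simps powr_diff)
      ultimately have "((\<lambda>m. h x t (k, m)) has_sum
         (((- x) ^ k / fact k * t ^ k) * ((1 - t) powr (- a - 1) / (1 - t) ^ k))) UNIV"
        by (metis has_sum_cmult_right)
      moreover have "(- x) ^ k / fact k * t ^ k * ((1 - t) powr (- a - 1) / (1 - t) ^ k) =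
          (1 - t) powr (- a - 1) * ((- x * t / (1 - t)) ^ k / fact k)"
        unfolding power_divide power_mult_distrib by (simp add: field_simps)
      ultimately show ?thesis by (simp only:)
    qed
    have outer: "((\<lambda>k. (1 - t) powr (- a - 1) * ((- x * t / (1 - t)) ^ k / fact k)) has_sum
        ((1 - t) powr (- a - 1) * exp (- x * t / (1 - t)))) UNIV" for x t :: real
    proof (rule has_sum_cmult_right, rule norm_summable_imp_has_sum)
      show "summable (\<lambda>k. norm ((- x * t / (1 - t)) ^ k / fact k))"
        using summable_exp[of "\<bar>- x * t / (1 - t)\<bar>"] by (simp add: power_abs field_simps)
      show "(\<lambda>k. (- x * t / (1 - t)) ^ k / fact k) sums exp (- x * t / (1 - t))"
        using exp_converges[of "- x * t / (1 - t)"] by (simp add: field_simps)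
    qed
    \<comment> \<open>At -|x| and |t| all terms are nonnegative, so iterated summability suffices;
      they dominate the terms at x and t and justify the regrouping.\<close>
    have "h (- \<bar>x\<bar>) \<bar>t\<bar> summable_on (UNIV \<times> UNIV)"
    proof (rule summable_on_SigmaI)
      show "((\<lambda>m. h (- \<bar>x\<bar>) \<bar>t\<bar> (k, m)) has_sum
        ((1 - \<bar>t\<bar>) powr (- a - 1) * ((- (- \<bar>x\<bar>) * \<bar>t\<bar> / (1 - \<bar>t\<bar>)) ^ k / fact k))) UNIV" for k
        by (rule inner) (use t in simp)
      show "(\<lambda>k. (1 - \<bar>t\<bar>) powr (- a - 1) * ((- (- \<bar>x\<bar>) * \<bar>t\<bar> / (1 - \<bar>t\<bar>)) ^ k / fact k)) summable_on UNIV"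
        using outer[of "\<bar>t\<bar>" "- \<bar>x\<bar>"] has_sum_imp_summable by blast
      show "0 \<le> h (- \<bar>x\<bar>) \<bar>t\<bar> (k, m)" for k m
        using B0 by (simp add: h_def)
    qed
    then have "(\<lambda>p. norm (h x t p)) summable_on (UNIV \<times> UNIV)"
      by (rule summable_on_cong[THEN iffD1, rotated])
         (use B0 in \<open>auto simp: h_def abs_mult power_abs abs_divide\<close>)
    then have sm: "h x t summable_on (UNIV \<times> UNIV)" by (rule abs_summable_summable)
    have "(h x t has_sum ((1 - t) powr (- a - 1) * exp (- x * t / (1 - t)))) (UNIV \<times> UNIV)"
      by (rule has_sum_SigmaI[OF inner[OF t] outer sm])
    moreover have bij: "bij_betw (\<lambda>(n, k). (k, n - k)) (SIGMA n:UNIV. {..n}) (UNIV \<times> (UNIV::nat set))"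
      by (rule bij_betwI[of _ _ _ "\<lambda>(k, m). (k + m, k)"]) auto
    ultimately have "((\<lambda>p. h x t ((\<lambda>(n, k). (k, n - k)) p)) has_sum
        ((1 - t) powr (- a - 1) * exp (- x * t / (1 - t)))) (SIGMA n:UNIV. {..n})"
      by (subst has_sum_reindex_bij_betw[OF bij])
    then have "((\<lambda>n. \<Sum>k\<le>n. h x t (k, n - k)) has_sum
        ((1 - t) powr (- a - 1) * exp (- x * t / (1 - t)))) UNIV"
      by (rule has_sum_SigmaD) (simp add: has_sum_finite)
    then have "(\<lambda>n. \<Sum>k\<le>n. h x t (k, n - k)) sums
        ((1 - t) powr (- a - 1) * exp (- x * t / (1 - t)))"
      by (rule has_sum_imp_sums)
    moreover have "(\<Sum>k\<le>n. h x t (k, n - k)) = (\<Sum>k\<le>n. laguerre_coeff a n k * x ^ k) * t ^ n" for n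
      unfolding sum_distrib_right
      by (rule sum.cong) (auto simp: h_def laguerre_coeff_def B_def power_minus[of x])
    ultimately show ?thesis by simp
  qed
  then have "(\<lambda>n. laguerre a n x) = (\<lambda>n. \<Sum>k\<le>n. laguerre_coeff a n k * x ^ k)"
    by (intro laguerre_unique[of _ "\<lambda>t. (1 - t) powr (- a - 1) * exp (- x * t / (1 - t))"])
       (use laguerre_generating_function[of _ a x] in auto)
  then show ?thesis by metis
qed

lemma continuous_on_laguerre:
  assumes "a > -1"
  shows "continuous_on S (laguerre a n)"
  unfolding laguerre_explicit[OF assms, abs_def] by (intro continuous_intros)

lemma laguerre_at_0: "laguerre a n 0 = pochhammer (a + 1) n / fact n"
proof -
  have "(\<lambda>n. laguerre a n 0) = (\<lambda>n. pochhammer (a + 1) n / fact n)"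
    by (rule laguerre_unique[of _ "\<lambda>t. (1 - t) powr (- a - 1) * exp (- 0 * t / (1 - t))"])
       (use negative_binomial_sums[of _ "a + 1"] laguerre_generating_function[of _ a 0] in auto)
  then show ?thesis by metis
qed

text \<open>This is the differential equation read off at \<open>x ^ k\<close>. At k = n both sides
  vanish because the next coefficient is 0.\<close>

lemma laguerre_coeff_rec:
  assumes "a > -1"
  shows "real (Suc k) * (real (Suc k) + a) * laguerre_coeff a n (Suc k) = (real k - real n) * laguerre_coeff a n k"
proof (cases "k < n")
  case True
  then obtain m where m: "n = k + Suc m" using less_imp_Suc_add by auto
  have pk: "pochhammer (a + 1 + real k) (Suc m) = (a + 1 + real k) * pochhammer (a + 1 + real (Suc k)) m"
    by (simp add: pochhammer_rec add_ac)
  define p where "p = pochhammer (a + 1 + real (Suc k)) m"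
  have c1: "laguerre_coeff a n (Suc k) = - ((-1) ^ k * p / (real (Suc k) * fact k * fact m))"
    unfolding m laguerre_coeff_def p_def by (simp add: field_simps)
  have c2: "laguerre_coeff a n k = (-1) ^ k * ((a + 1 + real k) * p) / (fact k * (real (Suc m) * fact m))"
    using pk unfolding m laguerre_coeff_def p_def by (simp add: field_simps)
  have n: "real k - real n = - real (Suc m)" by (simp add: m)
  show ?thesis unfolding c1 c2 n by (simp add: divide_simps) (simp add: algebra_simps)
next
  case False
  then show ?thesis by (cases "k = n") (auto simp: laguerre_coeff_def)
qed

lemma laguerre_ODE:
  assumes a: "a > -1"
  obtains L' L'' where
    "\<And>x. (laguerre a n has_real_derivative L' x) (at x)"
    "\<And>x. (L' has_real_derivative L'' x) (at x)"
    "\<And>x. x * L'' x + (a + 1 - x) * L' x + real n * laguerre a n x = 0"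
proof
  define c where "c = laguerre_coeff a n"
  define L' where "L' = (\<lambda>x. \<Sum>k\<le>n. c k * (real k * x ^ (k - 1)))"
  define L'' where "L'' = (\<lambda>x. \<Sum>k\<le>n. c k * (real k * (real (k - 1) * x ^ (k - 2))))"
  have expl: "laguerre a n = (\<lambda>x. \<Sum>k\<le>n. c k * x ^ k)"
    unfolding c_def using laguerre_explicit[OF a] by auto
  show "(laguerre a n has_real_derivative L' x) (at x)" for x
    unfolding expl L'_def by (auto intro!: derivative_eq_intros sum.cong)
  show "(L' has_real_derivative L'' x) (at x)" for x
    unfolding L'_def L''_def
    by (auto intro!: derivative_eq_intros sum.cong simp: numeral_2_eq_2)
  show "x * L'' x + (a + 1 - x) * L' x + real n * laguerre a n x = 0" for x
  proof -
    have "x * L'' x + (a + 1) * L' x = (\<Sum>k\<le>n. real k * (real k + a) * c k * x ^ (k - 1))"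
      unfolding L'_def L''_def sum_distrib_left sum.distrib[symmetric]
    proof (rule sum.cong)
      fix k show "x * (c k * (real k * (real (k - 1) * x ^ (k - 2)))) + (a + 1) * (c k * (real k * x ^ (k - 1)))
        = real k * (real k + a) * c k * x ^ (k - 1)"
        by (cases k; cases "k - 1") (auto simp: algebra_simps)
    qed simp
    \<comment> \<open>The added term vanishes because \<open>laguerre_coeff\<close> is 0 above n; in
      the shift that follows, the term k = 0 drops out through the factor
      \<open>real k\<close>.\<close>
    also have "\<dots> = (\<Sum>k\<le>Suc n. real k * (real k + a) * c k * x ^ (k - 1))"
      by (simp add: c_def laguerre_coeff_def)
    also have "\<dots> = (\<Sum>k\<le>n. real (Suc k) * (real (Suc k) + a) * c (Suc k) * x ^ k)"
      by (subst sum.atMost_Suc_shift) simp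
    also have "\<dots> = (\<Sum>k\<le>n. (real k - real n) * c k * x ^ k)"
      using laguerre_coeff_rec[OF a, of _ n] by (simp add: c_def)
    also have "\<dots> = x * L' x - real n * laguerre a n x"
      unfolding expl L'_def sum_distrib_left sum_subtractf[symmetric]
    proof (rule sum.cong)
      fix k show "(real k - real n) * c k * x ^ k = x * (c k * (real k * x ^ (k - 1))) - real n * (c k * x ^ k)"
        by (cases k) (auto simp: algebra_simps)
    qed simp
    finally show ?thesis by (simp add: algebra_simps)
  qed
qed

text \<open>The generating functions multiply: the exponents - \<alpha>_j - 1 and the arguments y_j
  add up to those of a single Laguerre polynomial. The product is formed among formal power series,
  whose n-th coefficient is the sum over multi-indices.\<close>

lemma laguerre_addition:
  fixes \<alpha> y :: "real ^ 'n"
  shows "(\<Sum>\<mu> | l1 \<mu> = n. \<Prod>j\<in>UNIV. laguerre (\<alpha> $ j) (\<mu> $ j) (y $ j)) =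
    laguerre (l1 \<alpha> + real CARD('n) - 1) n (l1 y)"
proof -
  define F where "F = (\<lambda>j. Abs_fps (\<lambda>n. laguerre (\<alpha> $ j) n (y $ j)))"
  define G where "G = (\<lambda>j t. (1 - t) powr (- (\<alpha> $ j) - 1) * exp (- (y $ j) * t / (1 - t)))"
  have sF: "(\<lambda>n. fps_nth (\<Prod>j\<in>J. F j) n * t ^ n) sums (\<Prod>j\<in>J. G j t)"
    if "finite J" "\<bar>t\<bar> < 1" for J t
    using that
  proof (induction J arbitrary: t rule: finite_induct)
    case empty
    have "(\<lambda>n. fps_nth 1 n * t ^ n) = (\<lambda>n. if n = 0 then 1 else 0)" by auto
    then show ?case using sums_If_finite_set[of "{0::nat}" "\<lambda>_. 1::real"] by simp
  next
    case (insert j J)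
    define P where "P = (\<Prod>j\<in>J. F j)"
    \<comment> \<open>Convergence at the larger point t' gives absolute convergence at t, as the
      Cauchy product requires.\<close>
    obtain t' where t': "\<bar>t\<bar> < t'" "t' < 1" using insert.prems dense by blast
    have s1: "(\<lambda>n. fps_nth (F j) n * t ^ n) sums G j t" if "\<bar>t\<bar> < 1" for t
      using laguerre_generating_function[OF that] by (simp add: F_def G_def)
    have s2: "(\<lambda>n. fps_nth P n * t ^ n) sums (\<Prod>j\<in>J. G j t)" if "\<bar>t\<bar> < 1" for t
      unfolding P_def using insert.IH that by blast
    have a1: "summable (\<lambda>n. norm (fps_nth (F j) n * t ^ n))"
      by (rule powser_insidea[OF sums_summable[OF s1[of t']]]) (use t' in auto)
    have a2: "summable (\<lambda>n. norm (fps_nth P n * t ^ n))"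
      by (rule powser_insidea[OF sums_summable[OF s2[of t']]]) (use t' in auto)
    have "(\<lambda>n. \<Sum>i\<le>n. fps_nth (F j) i * t ^ i * (fps_nth P (n - i) * t ^ (n - i))) sums
        (G j t * (\<Prod>j\<in>J. G j t))"
      using Cauchy_product_sums[OF a1 a2] s1[OF insert.prems] s2[OF insert.prems]
      by (simp add: sums_iff)
    moreover have "(\<Sum>i\<le>n. fps_nth (F j) i * t ^ i * (fps_nth P (n - i) * t ^ (n - i))) =
      fps_nth (F j * P) n * t ^ n" for n
      unfolding fps_mult_nth sum_distrib_right atLeast0AtMost[symmetric]
      by (rule sum.cong) (auto simp: algebra_simps simp flip: power_add)
    ultimately show ?case using insert.hyps by (simp add: P_def)
  qed
  have "(\<lambda>n. fps_nth (\<Prod>j\<in>UNIV. F j) n) = (\<lambda>n. laguerre (l1 \<alpha> + real CARD('n) - 1) n (l1 y))"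
  proof (rule laguerre_unique)
    show "\<forall>t. \<bar>t\<bar> < 1 \<longrightarrow> (\<lambda>n. fps_nth (\<Prod>j\<in>UNIV. F j) n * t ^ n) sums (\<Prod>j\<in>UNIV. G j t)"
      using sF by simp
    show "\<forall>t. \<bar>t\<bar> < 1 \<longrightarrow> (\<lambda>n. laguerre (l1 \<alpha> + real CARD('n) - 1) n (l1 y) * t ^ n) sums (\<Prod>j\<in>UNIV. G j t)"
    proof (intro allI impI)
      fix t :: real assume t: "\<bar>t\<bar> < 1"
      have "(\<Prod>j\<in>UNIV. G j t) = (1 - t) powr (\<Sum>j\<in>UNIV. - (\<alpha> $ j) - 1) * exp (\<Sum>j\<in>UNIV. - (y $ j) * t / (1 - t))"
        unfolding G_def prod.distrib using t by (simp add: exp_sum powr_sum)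
      also have "(\<Sum>j\<in>UNIV. - (\<alpha> $ j) - 1) = - (l1 \<alpha> + real CARD('n) - 1) - 1"
        by (simp add: l1_def sum_subtractf sum_negf)
      also have "(\<Sum>j\<in>UNIV. - (y $ j) * t / (1 - t)) = - l1 y * t / (1 - t)"
        by (simp add: l1_def sum_negf sum_divide_distrib sum_distrib_right)
      finally show "(\<lambda>n. laguerre (l1 \<alpha> + real CARD('n) - 1) n (l1 y) * t ^ n) sums (\<Prod>j\<in>UNIV. G j t)"
        using laguerre_generating_function[OF t] by (simp only:)
    qed
  qed
  then have "laguerre (l1 \<alpha> + real CARD('n) - 1) n (l1 y) = fps_nth (\<Prod>j\<in>UNIV. F j) n" by metis
  \<comment> \<open>A multi-index of weight n is the multiplicity function of a multiset of size n
    over the coordinates.\<close>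
  also have "\<dots> = (\<Sum>X\<in>multisets_of_size UNIV n. \<Prod>j\<in>UNIV. fps_nth (F j) (count X j))"
    by (rule fps_prod_nth') simp
  also have "\<dots> = (\<Sum>\<mu> | l1 \<mu> = n. \<Prod>j\<in>UNIV. fps_nth (F j) (\<mu> $ j))"
  proof -
    have c: "count (Abs_multiset (\<lambda>j. \<mu> $ j)) = (\<lambda>j. \<mu> $ j)" for \<mu> :: "nat ^ 'n"
      by (rule count_Abs_multiset) simp
    have size: "size X = (\<Sum>j\<in>UNIV. count X j)" for X :: "'n multiset"
      unfolding size_multiset_overloaded_eq
      by (rule sum.mono_neutral_left) (auto simp: not_in_iff)
    show ?thesis
      by (rule sum.reindex_bij_witness[of _ "\<lambda>\<mu>. Abs_multiset (\<lambda>j. \<mu> $ j)" "\<lambda>X. \<chi> j. count X j"])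
         (auto simp: multisets_of_size_def l1_def size c vec_eq_iff intro: multiset_eqI)
  qed
  finally show ?thesis by (simp add: F_def)
qed

section \<open>Energy estimates for the Laguerre equation\<close>

text \<open>Collects the losses in \<open>energy_lower\<close>: the first quotient is the loss of
  \<open>H\<close> up to \<open>r1\<close>, with base \<open>r0 / r1\<close>;
  \<open>2 * (A + 1)\<close> is \<open>r1 * \<sigma>\<close>; the 3 compares \<open>H\<close> with
  \<open>G\<close> at \<open>r1\<close>, and the last \<open>exp 1\<close> carries \<open>G\<close>
  from \<open>r1\<close> to 1.\<close>

definition energy_const :: "real \<Rightarrow> real" where
  "energy_const A = (1 / (4 * (A + 1))) powr (4 * A + 2) / (8 * exp 1) *
     (2 * (A + 1)) powr (2 * A + 1) / (3 * exp 1)"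

lemma energy_const_pos: "A \<ge> 0 \<Longrightarrow> energy_const A > 0"
  unfolding energy_const_def by simp

text \<open>
  The energy \<open>G\<close> controls \<open>u\<close> only where \<open>q\<close> is positive, which fails near \<open>0\<close>. There
  \<open>H\<close> takes over: it is decreasing, so \<open>w\<close> stays above \<open>w 0 / 2\<close> up to \<open>r0\<close>, and between
  \<open>r0\<close> and \<open>r1\<close>, which differ by a factor depending only on \<open>A\<close>, it loses only a constant.
\<close>

locale laguerre_ode =
  fixes A E :: real and w w1 :: "real \<Rightarrow> real"
  assumes A: "A \<ge> 0" and E1: "4 * (A + 1)\<^sup>2 \<le> E" and E2: "2000 \<le> E"
    and w: "\<And>r. (w has_real_derivative w1 r) (at r)"
    and w1: "\<And>r. r > 0 \<Longrightarrow>
      (w1 has_real_derivative (- (2 * A + 1) / r * w1 r - (E - r\<^sup>2) * w r)) (at r)"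
    and w1_cont: "continuous_on UNIV w1"
    and w1_0: "w1 0 = 0"
begin

definition \<sigma> where "\<sigma> = sqrt E"
text \<open>Over this length \<open>w\<close> moves by at most half of \<open>w 0\<close>, since its
  slope is at most \<open>\<sigma> * \<bar>w 0\<bar>\<close>.\<close>

definition r0 where "r0 = 1 / (2 * \<sigma>)"
text \<open>From this radius on, \<open>cc / r\<^sup>2\<close> is at most E / 4 in absolute value,
  which keeps \<open>q\<close> positive up to \<sigma> / 2.\<close>

definition r1 where "r1 = 2 * (A + 1) / \<sigma>"
text \<open>The energy of the equation for \<open>w\<close> itself, w'' + (2 A + 1) w' / r + (E -
  r^2) w = 0, in which the first-order term acts as damping.\<close>

definition H where "H r = (w1 r)\<^sup>2 + (E - r\<^sup>2) * (w r)\<^sup>2"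
definition cc where "cc = A\<^sup>2 - 1/4"
definition q where "q r = E - r\<^sup>2 - cc / r\<^sup>2"
definition u where "u r = r powr (A + 1/2) * w r"
definition u1 where "u1 r = r powr (A + 1/2) * (w1 r + (A + 1/2) * w r / r)"
definition G where "G r = (u1 r)\<^sup>2 + q r * (u r)\<^sup>2"
text \<open>The Gronwall exponent for \<open>G\<close>: its derivative (2 / E) (2 r + 2 |cc| / r^3)
  bounds |q'| u^2 / G wherever \<open>q r \<ge> E / 2\<close>.\<close>

definition V where "V r = 2 / E * (r\<^sup>2 - \<bar>cc\<bar> / r\<^sup>2)"

lemma sigma: "\<sigma> > 0" "\<sigma>\<^sup>2 = E" "\<sigma> \<ge> 40" "2 * (A + 1) \<le> \<sigma>"
proof -
  show "\<sigma> > 0" "\<sigma>\<^sup>2 = E" using E2 by (simp_all add: \<sigma>_def)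
  show "\<sigma> \<ge> 40" unfolding \<sigma>_def using E2 by (intro real_le_rsqrt) auto
  show "2 * (A + 1) \<le> \<sigma>" unfolding \<sigma>_def using E1 by (intro real_le_rsqrt) (auto simp: power2_eq_square algebra_simps)
qed

lemma r0r1: "0 < r0" "r0 < r1" "0 < r1" "r1 \<le> 1" "r0\<^sup>2 \<le> E / 2" "r1\<^sup>2 \<le> 1" "r0 / r1 = 1 / (4 * (A + 1))"
proof -
  show 1: "0 < r0" "0 < r1" using sigma A by (simp_all add: r0_def r1_def)
  show 2: "r0 / r1 = 1 / (4 * (A + 1))" using sigma A by (simp add: r0_def r1_def)
  then have "r0 = r1 * (1 / (4 * (A + 1)))" using 1 by (simp add: field_simps)
  also have "\<dots> < r1 * 1" using 1 A by (intro mult_strict_left_mono) auto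
  finally show 3: "r0 < r1" by simp
  show 4: "r1 \<le> 1" using sigma by (simp add: r1_def)
  show "r1\<^sup>2 \<le> 1" using 1 4 by (simp add: power_le_one_iff)
  have "r0 \<le> 1" using 3 4 by linarith
  then have "r0\<^sup>2 \<le> 1" using 1 by (simp add: power_le_one_iff)
  then show "r0\<^sup>2 \<le> E / 2" using E2 by linarith
qed

lemma cont_w: "continuous_on S w"
  using w by (meson DERIV_isCont continuous_at_imp_continuous_on)

lemma cont_w1: "continuous_on S w1"
  using w1_cont continuous_on_subset by blast

lemma H_deriv:
  assumes "r > 0"
  shows "(H has_real_derivative (- 2 * (2 * A + 1) / r * (w1 r)\<^sup>2 - 2 * r * (w r)\<^sup>2)) (at r)"
  unfolding H_def[abs_def] using assms
  by (auto intro!: derivative_eq_intros w w1) (simp add: field_simps power2_eq_square)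

lemma H_le: "r \<ge> 0 \<Longrightarrow> H r \<le> E * (w 0)\<^sup>2"
proof -
  assume r: "r \<ge> 0"
  have "H r \<le> H 0"
  proof (rule DERIV_nonpos_imp_decreasing_open[OF r])
    show "\<exists>y. (H has_real_derivative y) (at x) \<and> y \<le> 0" if "0 < x" for x
    proof (intro exI conjI, rule H_deriv[OF that])
      have "2 * (2 * A + 1) / x * (w1 x)\<^sup>2 \<ge> 0" "2 * x * (w x)\<^sup>2 \<ge> 0" using that A by simp_all
      then show "- 2 * (2 * A + 1) / x * (w1 x)\<^sup>2 - 2 * x * (w x)\<^sup>2 \<le> 0"
        using that by (simp only: minus_mult_left[symmetric] minus_divide_left[symmetric])
    qed
    show "continuous_on {0..r} H"
      unfolding H_def[abs_def] by (intro continuous_intros cont_w cont_w1)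
  qed
  then show ?thesis by (simp add: H_def w1_0)
qed

text \<open>\<open>H\<close> never exceeds its value \<open>E * (w 0)\<^sup>2\<close> at 0, so |w1|
  stays below \<open>\<sigma> * \<bar>w 0\<bar>\<close> as long as r^2 \<le> E, and the mean value
  theorem up to \<open>r0\<close> loses at most half.\<close>

lemma w_r0: "\<bar>w r0\<bar> \<ge> \<bar>w 0\<bar> / 2"
proof -
  have "\<exists>z>0. z < r0 \<and> w r0 - w 0 = (r0 - 0) * w1 z"
    by (rule MVT2) (use r0r1 w in auto)
  then obtain z where z: "0 < z" "z < r0" "w r0 - w 0 = r0 * w1 z" by auto
  have "z\<^sup>2 \<le> r0\<^sup>2" using z by (intro power_mono) auto
  then have "0 \<le> (E - z\<^sup>2) * (w z)\<^sup>2" using r0r1(5) E2 by (intro mult_nonneg_nonneg) auto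
  then have "(w1 z)\<^sup>2 \<le> E * (w 0)\<^sup>2"
    using H_le[of z] z by (simp add: H_def)
  also have "\<dots> = (\<sigma> * \<bar>w 0\<bar>)\<^sup>2" by (simp add: power_mult_distrib sigma)
  finally have "\<bar>w1 z\<bar> \<le> \<sigma> * \<bar>w 0\<bar>"
    using sigma(1) by (simp add: abs_le_square_iff[symmetric] abs_mult)
  then have "r0 * \<bar>w1 z\<bar> \<le> r0 * (\<sigma> * \<bar>w 0\<bar>)" using r0r1 by (intro mult_left_mono) auto
  also have "\<dots> = \<bar>w 0\<bar> / 2" using sigma by (simp add: r0_def)
  finally have "\<bar>w r0 - w 0\<bar> \<le> \<bar>w 0\<bar> / 2" using z r0r1 by (simp add: abs_mult)
  then show ?thesis by linarith
qed

text \<open>The derivative of \<open>H\<close> is at least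
  \<open>- ((4 * A + 2) / r + 4 * r / E) * H r\<close>, so \<open>H\<close> times the integrating
  factor \<open>r powr (4 * A + 2) * exp (2 * r\<^sup>2 / E)\<close> is nondecreasing from
  \<open>r0\<close> to \<open>r1\<close>. The power costs a fixed power of \<open>r0 / r1\<close>
  and the exponential at most \<open>exp 1\<close>; the 8 comes from \<open>w_r0\<close> squared and
  \<open>E - r0\<^sup>2 \<ge> E / 2\<close>.\<close>

lemma H_r1: "H r1 \<ge> (1 / (4 * (A + 1))) powr (4 * A + 2) / (8 * exp 1) * (E * (w 0)\<^sup>2)"
proof -
  define K where "K = (\<lambda>r. H r * r powr (4 * A + 2) * exp (2 * r\<^sup>2 / E))"
  have "K r0 \<le> K r1"
  proof (rule DERIV_nonneg_imp_nondecreasing[where f = K and a = r0 and b = r1])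
    show "r0 \<le> r1" using r0r1 by simp
    fix r assume r: "r0 \<le> r" "r \<le> r1"
    then have rp: "r > 0" using r0r1 by linarith
    have "r \<le> 1" using r r0r1 by linarith
    then have r2: "r\<^sup>2 \<le> 1" using rp by (simp add: power_le_one_iff)
    define y where "y = r powr (4 * A + 2) * exp (2 * r\<^sup>2 / E) *
       ((- 2 * (2 * A + 1) / r * (w1 r)\<^sup>2 - 2 * r * (w r)\<^sup>2) + (4 * A + 2) / r * H r + 4 * r / E * H r)"
    have "(K has_real_derivative y) (at r)"
    proof -
      define m where "m = 4 * A + 2"
      have "((\<lambda>r. r powr m) has_real_derivative m * r powr (m - 1)) (at r)"
        using rp by (rule has_real_derivative_powr)
      moreover have "r powr (m - 1) = r powr m / r" using powr_diff[of r m 1] rp by simp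
      ultimately have D: "((\<lambda>r. r powr m) has_real_derivative r powr m * (m / r)) (at r)"
        by (simp add: mult_ac)
      have "((\<lambda>r. exp (2 * r\<^sup>2 / E)) has_real_derivative exp (2 * r\<^sup>2 / E) * (4 * r / E)) (at r)"
        using E2 by (auto intro!: derivative_eq_intros)
      from DERIV_mult[OF DERIV_mult[OF H_deriv[OF rp] D] this] show ?thesis
        unfolding K_def y_def m_def[symmetric] by (rule DERIV_cong) (simp add: algebra_simps)
    qed
    moreover have "y \<ge> 0"
    proof -
      have H0: "H r \<ge> (E / 2) * (w r)\<^sup>2" unfolding H_def using r2 E2
        by (intro add_increasing mult_right_mono) auto
      have "(- 2 * (2 * A + 1) / r * (w1 r)\<^sup>2 - 2 * r * (w r)\<^sup>2) + (4 * A + 2) / r * H r + 4 * r / E * H r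
        = (4 * A + 2) / r * ((E - r\<^sup>2) * (w r)\<^sup>2) + 4 * r / E * (H r - (E / 2) * (w r)\<^sup>2)"
        using rp E2 unfolding H_def by (simp add: field_simps)
      also have "\<dots> \<ge> 0" using rp E2 r2 A H0
        by (intro add_nonneg_nonneg mult_nonneg_nonneg) auto
      finally show ?thesis unfolding y_def by (intro mult_nonneg_nonneg) auto
    qed
    ultimately show "\<exists>y. (K has_real_derivative y) (at r) \<and> y \<ge> 0" by blast
  qed
  moreover have H0: "H r0 \<ge> E * (w 0)\<^sup>2 / 8"
  proof -
    have "(\<bar>w 0\<bar> / 2)\<^sup>2 \<le> \<bar>w r0\<bar>\<^sup>2" by (intro power_mono w_r0) auto
    then have "(w 0)\<^sup>2 / 4 \<le> (w r0)\<^sup>2" by (simp add: power_divide)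
    then have "E / 2 * ((w 0)\<^sup>2 / 4) \<le> (E - r0\<^sup>2) * (w r0)\<^sup>2"
      using r0r1(5) E2 by (intro mult_mono) auto
    then show ?thesis by (simp add: H_def add_increasing)
  qed
  have "H r0 * r0 powr (4 * A + 2) \<le> K r0"
  proof -
    have "0 \<le> E * (w 0)\<^sup>2 / 8" using E2 by simp
    then have "H r0 \<ge> 0" using H0 by linarith
    then show ?thesis unfolding K_def using E2
      by (intro mult_left_mono[of 1 _ "H r0 * r0 powr (4 * A + 2)", simplified]) auto
  qed
  moreover have "K r1 \<le> H r1 * r1 powr (4 * A + 2) * exp 1"
  proof -
    have "H r1 \<ge> 0" unfolding H_def using r0r1 E2 by (intro add_nonneg_nonneg mult_nonneg_nonneg) auto
    moreover have "2 * r1\<^sup>2 / E \<le> 1" using r0r1(6) E2 by simp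
    ultimately show ?thesis unfolding K_def by (intro mult_left_mono) auto
  qed
  ultimately have "H r0 * r0 powr (4 * A + 2) \<le> H r1 * r1 powr (4 * A + 2) * exp 1" by linarith
  then have "H r0 * (r0 powr (4 * A + 2) / r1 powr (4 * A + 2)) / exp 1 \<le> H r1"
    using r0r1(1-3) by (simp add: field_simps)
  moreover have "r0 powr (4 * A + 2) / r1 powr (4 * A + 2) = (1 / (4 * (A + 1))) powr (4 * A + 2)"
    using r0r1 by (simp add: powr_divide[symmetric])
  ultimately have "H r0 * (1 / (4 * (A + 1))) powr (4 * A + 2) / exp 1 \<le> H r1" by simp
  moreover have "E * (w 0)\<^sup>2 / 8 * (1 / (4 * (A + 1))) powr (4 * A + 2) / exp 1 \<le>
      H r0 * (1 / (4 * (A + 1))) powr (4 * A + 2) / exp 1"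
    by (intro divide_right_mono mult_right_mono H0) auto
  ultimately show ?thesis by (simp add: field_simps)
qed

lemma abs_c: "\<bar>cc\<bar> \<le> (A + 1)\<^sup>2"
  using A by (auto simp: cc_def abs_le_iff power2_eq_square algebra_simps intro: order_trans[of _ 0])

text \<open>The left end keeps away from the singularity at 0 and the right end from the turning
  point near \<sigma>: each of \<open>r\<^sup>2\<close> and
  \<open>\<bar>cc\<bar> / r\<^sup>2\<close> uses up at most a quarter of E.\<close>

lemma bulk:
  assumes "r1 \<le> r" "r \<le> \<sigma> / 2"
  shows "r > 0" "r\<^sup>2 \<le> E / 4" "\<bar>cc\<bar> / r\<^sup>2 \<le> E / 4" "q r \<ge> E / 2" "q r \<le> 2 * E" "\<bar>V r\<bar> \<le> 1/2"
proof -
  show rp: "r > 0" using assms r0r1 by linarith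
  have "r\<^sup>2 \<le> (\<sigma> / 2)\<^sup>2" using rp assms by (intro power_mono) auto
  then show 1: "r\<^sup>2 \<le> E / 4" by (simp add: power_divide sigma)
  have "A + 1 = \<sigma> / 2 * r1" using sigma by (simp add: r1_def)
  then have "(A + 1)\<^sup>2 = E / 4 * r1\<^sup>2" by (simp only: power_mult_distrib power_divide sigma) simp
  also have "\<dots> \<le> E / 4 * r\<^sup>2" using assms r0r1 E2 by (intro mult_left_mono power_mono) auto
  finally show 2: "\<bar>cc\<bar> / r\<^sup>2 \<le> E / 4"
    using abs_c rp by (simp add: divide_le_eq)
  have 3: "cc / r\<^sup>2 \<le> E / 4" "- (cc / r\<^sup>2) \<le> E / 4"
  proof -
    have "\<bar>cc / r\<^sup>2\<bar> \<le> E / 4" using 2 by simp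
    then show "cc / r\<^sup>2 \<le> E / 4" "- (cc / r\<^sup>2) \<le> E / 4" by (rule abs_le_D1, rule abs_le_D2)
  qed
  show "q r \<ge> E / 2" "q r \<le> 2 * E" using 1 3 E2 zero_le_power2[of r] unfolding q_def by linarith+
  have "\<bar>r\<^sup>2 - \<bar>cc\<bar> / r\<^sup>2\<bar> \<le> E / 4"
    using 1 2 by (smt (verit) zero_le_power2 zero_le_divide_iff abs_ge_zero)
  then show "\<bar>V r\<bar> \<le> 1/2" unfolding V_def abs_mult using E2 by (simp add: field_simps)
qed

lemma u_deriv: "r > 0 \<Longrightarrow> (u has_real_derivative u1 r) (at r)"
proof -
  assume r: "r > 0"
  then have e: "r powr (A + 1/2 - 1) = r powr (A + 1/2) / r" using powr_diff[of r "A + 1/2" 1] by simp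
  have "(u has_real_derivative (r powr (A + 1/2) * w1 r + (A + 1/2) * r powr (A + 1/2 - 1) * w r)) (at r)"
    unfolding u_def[abs_def] using r by (auto intro!: derivative_eq_intros w)
  then show ?thesis unfolding e u1_def using r by (simp add: algebra_simps)
qed

lemma u1_deriv:
  assumes "r > 0"
  shows "(u1 has_real_derivative (- q r * u r)) (at r)"
proof -
  have "(u1 has_real_derivative
      ((A + 1/2) * r powr (A + 1/2 - 1) * (w1 r + (A + 1/2) * w r / r) +
       r powr (A + 1/2) * ((- (2 * A + 1) / r * w1 r - (E - r\<^sup>2) * w r) +
         ((A + 1/2) * w1 r * r - (A + 1/2) * w r) / (r * r)))) (at r)"
    unfolding u1_def[abs_def] using assms
    by (auto intro!: derivative_eq_intros w w1)
  also have "((A + 1/2) * r powr (A + 1/2 - 1) * (w1 r + (A + 1/2) * w r / r) +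
       r powr (A + 1/2) * ((- (2 * A + 1) / r * w1 r - (E - r\<^sup>2) * w r) +
         ((A + 1/2) * w1 r * r - (A + 1/2) * w r) / (r * r))) =
      r powr (A + 1/2) * ((A + 1/2) / r * (w1 r + (A + 1/2) * w r / r) +
       ((- (2 * A + 1) / r * w1 r - (E - r\<^sup>2) * w r) +
         ((A + 1/2) * w1 r * r - (A + 1/2) * w r) / (r * r)))"
  proof -
    have e: "r powr (A + 1/2 - 1) = r powr (A + 1/2) / r" using assms powr_diff[of r "A + 1/2" 1] by simp
    show ?thesis unfolding e using assms by (simp add: field_simps)
  qed
  also have "(A + 1/2) / r * (w1 r + (A + 1/2) * w r / r) +
       ((- (2 * A + 1) / r * w1 r - (E - r\<^sup>2) * w r) +
         ((A + 1/2) * w1 r * r - (A + 1/2) * w r) / (r * r)) = - q r * w r"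
    unfolding q_def cc_def using assms by (simp add: divide_simps) (simp add: algebra_simps power2_eq_square)
  finally show ?thesis by (simp add: u_def mult_ac)
qed

lemma G_deriv:
  assumes "r > 0"
  shows "(G has_real_derivative ((- 2 * r + 2 * cc / r ^ 3) * (u r)\<^sup>2)) (at r)"
proof -
  have "(q has_real_derivative (- 2 * r + 2 * cc / r ^ 3)) (at r)"
    unfolding q_def[abs_def] using assms
    by (auto intro!: derivative_eq_intros) (simp add: divide_simps power2_eq_square power3_eq_cube power4_eq_xxxx)
  then show ?thesis unfolding G_def[abs_def] using assms
    by (auto intro!: derivative_eq_intros u_deriv u1_deriv)
qed

lemma V_deriv:
  assumes "r > 0"
  shows "(V has_real_derivative (2 / E * (2 * r + 2 * \<bar>cc\<bar> / r ^ 3))) (at r)"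
  unfolding V_def[abs_def] using assms E2
  by (auto intro!: derivative_eq_intros) (simp add: divide_simps power2_eq_square power3_eq_cube power4_eq_xxxx)

lemma G_deriv_le:
  assumes "r1 \<le> r" "r \<le> \<sigma> / 2"
  shows "\<bar>(- 2 * r + 2 * cc / r ^ 3) * (u r)\<^sup>2\<bar> \<le> 2 / E * (2 * r + 2 * \<bar>cc\<bar> / r ^ 3) * G r"
proof -
  note b = bulk[OF assms]
  have "E / 2 * (u r)\<^sup>2 \<le> q r * (u r)\<^sup>2" using b by (intro mult_right_mono) auto
  also have "\<dots> \<le> G r" by (simp add: G_def)
  finally have 1: "(u r)\<^sup>2 \<le> 2 / E * G r" using E2 by (simp add: field_simps)
  have "\<bar>- 2 * r + 2 * cc / r ^ 3\<bar> \<le> 2 * r + 2 * \<bar>cc\<bar> / r ^ 3"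
    using abs_triangle_ineq[of "- 2 * r" "2 * cc / r ^ 3"] b(1) by (simp add: abs_mult)
  then have "\<bar>- 2 * r + 2 * cc / r ^ 3\<bar> * (u r)\<^sup>2 \<le> (2 * r + 2 * \<bar>cc\<bar> / r ^ 3) * (2 / E * G r)"
    using 1 b(1) by (intro mult_mono) auto
  then show ?thesis unfolding abs_mult by (simp only: abs_power2 mult_ac)
qed

lemma G_nonneg: "r1 \<le> r \<Longrightarrow> r \<le> \<sigma> / 2 \<Longrightarrow> G r \<ge> 0"
  using bulk(4)[of r] E2 by (simp add: G_def)

text \<open>Gronwall in both directions: since |G'| \<le> V' G, the product of \<open>G\<close> with
  exp V is nondecreasing and that with exp (- V) is nonincreasing, while \<open>V\<close> varies by
  at most 1.\<close>

lemma G_comparable_aux: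
  assumes "r1 \<le> r" "r \<le> s" "s \<le> \<sigma> / 2"
  shows "G r \<le> exp 1 * G s" "G s \<le> exp 1 * G r"
proof -
  have V: "\<bar>V s - V r\<bar> \<le> 1" using bulk(6)[of r] bulk(6)[of s] assms by (auto simp: abs_le_iff)
  let ?V' = "\<lambda>x. 2 / E * (2 * x + 2 * \<bar>cc\<bar> / x ^ 3)"
  let ?G' = "\<lambda>x. (- 2 * x + 2 * cc / x ^ 3) * (u x)\<^sup>2"
  have "G r * exp (V r) \<le> G s * exp (V s)"
  proof (rule DERIV_nonneg_imp_nondecreasing[OF assms(2)])
    fix x assume x: "r \<le> x" "x \<le> s"
    then have x': "r1 \<le> x" "x \<le> \<sigma> / 2" using assms by linarith+
    have "((\<lambda>x. G x * exp (V x)) has_real_derivative (?G' x + ?V' x * G x) * exp (V x)) (at x)"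
      using bulk(1)[OF x'] by (auto intro!: derivative_eq_intros G_deriv V_deriv simp: algebra_simps)
    moreover have "(?G' x + ?V' x * G x) * exp (V x) \<ge> 0"
      using G_deriv_le[OF x'] by (intro mult_nonneg_nonneg exp_ge_zero) linarith
    ultimately show "\<exists>y. ((\<lambda>x. G x * exp (V x)) has_real_derivative y) (at x) \<and> 0 \<le> y" by blast
  qed
  then have "G r \<le> G s * exp (V s - V r)"
    by (simp add: exp_diff field_simps)
  also have "\<dots> \<le> G s * exp 1" using V G_nonneg[of s] assms by (intro mult_left_mono) auto
  finally show "G r \<le> exp 1 * G s" by (simp add: mult_ac)
  have "G r * exp (- V r) \<ge> G s * exp (- V s)"
  proof (rule DERIV_nonpos_imp_nonincreasing[OF assms(2)])
    fix x assume x: "r \<le> x" "x \<le> s"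
    then have x': "r1 \<le> x" "x \<le> \<sigma> / 2" using assms by linarith+
    have "((\<lambda>x. G x * exp (- V x)) has_real_derivative (?G' x - ?V' x * G x) * exp (- V x)) (at x)"
      using bulk(1)[OF x'] by (auto intro!: derivative_eq_intros G_deriv V_deriv simp: algebra_simps)
    moreover have "(?G' x - ?V' x * G x) * exp (- V x) \<le> 0"
      using G_deriv_le[OF x'] by (intro mult_nonpos_nonneg exp_ge_zero) linarith
    ultimately show "\<exists>y. ((\<lambda>x. G x * exp (- V x)) has_real_derivative y) (at x) \<and> y \<le> 0" by blast
  qed
  then have "G s \<le> G r * exp (V s - V r)"
    by (simp add: exp_diff exp_minus field_simps)
  also have "\<dots> \<le> G r * exp 1" using V G_nonneg[of r] assms by (intro mult_left_mono) auto
  finally show "G s \<le> exp 1 * G r" by (simp add: mult_ac)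
qed

lemma one_bulk: "r1 \<le> 1" "1 \<le> \<sigma> / 2"
  using r0r1 sigma by auto

lemma G_comparable:
  assumes "r1 \<le> r" "r \<le> \<sigma> / 2"
  shows "G r \<le> exp 1 * G 1" "G 1 \<le> exp 1 * G r"
  using G_comparable_aux[of r 1] G_comparable_aux[of 1 r] assms one_bulk by (cases "r \<le> 1"; auto)+

text \<open>At \<open>r1\<close> the energy passes from \<open>w\<close> to \<open>u\<close>: there
  u1 = r1^(A + 1/2) y, and y differs from \<open>w1\<close> by a term that \<open>q\<close> absorbs.
  The factor \<open>r1 powr (2 * A + 1)\<close>, of order E^(- A - 1/2), turns
  \<open>E * (w 0)\<^sup>2\<close> into the stated power of E.\<close>

lemma energy_lower: "energy_const A * E powr (1/2 - A) * (w 0)\<^sup>2 \<le> G 1"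
proof -
  define y where "y = w1 r1 + (A + 1/2) * w r1 / r1"
  have r1s: "r1 \<le> \<sigma> / 2" using one_bulk by linarith
  note b = bulk[OF order_refl r1s]
  \<comment> \<open>\<open>r1\<close> is large enough for (A + 1/2) / r1 \<le> \<sigma> / 2.\<close>
  have z: "((A + 1/2) * w r1 / r1)\<^sup>2 \<le> E / 4 * (w r1)\<^sup>2"
  proof -
    have "(A + 1/2) / r1 \<le> \<sigma> / 2" using A sigma by (simp add: r1_def field_simps)
    then have "((A + 1/2) / r1)\<^sup>2 \<le> (\<sigma> / 2)\<^sup>2" using A r0r1 by (intro power_mono) auto
    then have "((A + 1/2) / r1)\<^sup>2 * (w r1)\<^sup>2 \<le> (\<sigma> / 2)\<^sup>2 * (w r1)\<^sup>2" by (intro mult_right_mono) auto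
    then show ?thesis by (simp add: power_divide power_mult_distrib sigma)
  qed
  have square_diff_le: "(a - b)\<^sup>2 \<le> 2 * a\<^sup>2 + 2 * b\<^sup>2" for a b :: real
    using zero_le_power2[of "a + b"] by (simp add: power2_eq_square algebra_simps)
  have "(w1 r1)\<^sup>2 = (y - (A + 1/2) * w r1 / r1)\<^sup>2" by (simp add: y_def)
  also have "\<dots> \<le> 2 * y\<^sup>2 + 2 * ((A + 1/2) * w r1 / r1)\<^sup>2"
    using square_diff_le .
  finally have "H r1 \<le> 2 * y\<^sup>2 + 2 * (E / 4 * (w r1)\<^sup>2) + E * (w r1)\<^sup>2"
    using z mult_right_mono[of "E - r1\<^sup>2" E "(w r1)\<^sup>2"] unfolding H_def by simp
  also have "\<dots> \<le> 3 * (y\<^sup>2 + E / 2 * (w r1)\<^sup>2)" by simp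
  also have "\<dots> \<le> 3 * (y\<^sup>2 + q r1 * (w r1)\<^sup>2)"
    using b by (intro mult_left_mono add_left_mono mult_right_mono) auto
  finally have "r1 powr (2 * A + 1) * (H r1 / 3) \<le> r1 powr (2 * A + 1) * (y\<^sup>2 + q r1 * (w r1)\<^sup>2)"
    by (intro mult_left_mono) auto
  also have "\<dots> = G r1"
  proof -
    have "(r1 powr (A + 1/2))\<^sup>2 = r1 powr (2 * A + 1)"
      using r0r1 by (simp add: power2_eq_square powr_add[symmetric])
    moreover have "u1 r1 = r1 powr (A + 1/2) * y" by (simp add: u1_def y_def)
    ultimately show ?thesis by (simp add: G_def u_def power_mult_distrib algebra_simps)
  qed
  also have "\<dots> \<le> exp 1 * G 1" by (rule G_comparable) (use r1s in auto)
  finally have fin: "r1 powr (2 * A + 1) * (H r1 / 3) \<le> exp 1 * G 1" .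
  have "r1 powr (2 * A + 1) = (2 * (A + 1)) powr (2 * A + 1) * E powr (- A - 1/2)"
  proof -
    have "\<sigma> powr (2 * A + 1) = E powr (A + 1/2)"
      unfolding \<sigma>_def using E2 by (simp add: powr_half_sqrt[symmetric] powr_powr algebra_simps)
    moreover have "E powr (- A - 1/2) = inverse (E powr (A + 1/2))"
      using powr_minus[of E "A + 1/2"] by simp
    moreover have "r1 powr (2 * A + 1) = (2 * (A + 1)) powr (2 * A + 1) / \<sigma> powr (2 * A + 1)"
      unfolding r1_def by (rule powr_divide)
    ultimately show ?thesis by (simp only: divide_inverse)
  qed
  note X = this
  have Z: "E powr (1/2 - A) = E powr (- A - 1/2) * E"
  proof -
    have "1/2 - A = (- A - 1/2) + 1" by simp
    moreover have "E powr 1 = E" using E2 by simp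
    ultimately show ?thesis by (metis powr_add)
  qed
  have "energy_const A * E powr (1/2 - A) * (w 0)\<^sup>2 =
      r1 powr (2 * A + 1) * (((1 / (4 * (A + 1))) powr (4 * A + 2) / (8 * exp 1) * (E * (w 0)\<^sup>2)) / 3) / exp 1"
    unfolding energy_const_def X Z by (simp only: times_divide_eq_right times_divide_eq_left divide_divide_eq_left mult_ac)
  also have "\<dots> \<le> r1 powr (2 * A + 1) * (H r1 / 3) / exp 1"
    by (rule divide_right_mono, rule mult_left_mono, rule divide_right_mono, rule H_r1) auto
  also have "\<dots> \<le> exp 1 * G 1 / exp 1"
    by (rule divide_right_mono, rule fin) simp
  finally show ?thesis by simp
qed

lemma u_upper:
  assumes "r1 \<le> r" "r \<le> \<sigma> / 2"
  shows "E * (u r)\<^sup>2 \<le> 2 * exp 1 * G 1"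
proof -
  have "E / 2 * (u r)\<^sup>2 \<le> q r * (u r)\<^sup>2" using bulk[OF assms] by (intro mult_right_mono) auto
  also have "\<dots> \<le> G r" by (simp add: G_def)
  also have "\<dots> \<le> exp 1 * G 1" by (rule G_comparable[OF assms])
  finally show ?thesis by simp
qed

text \<open>Controls the boundary terms in \<open>u_mass\<close>: the product is smaller than the
  energy by a factor \<sigma>, by the arithmetic-geometric mean inequality and
  \<open>q r \<ge> E / 2\<close>.\<close>

lemma uu1:
  assumes "r1 \<le> r" "r \<le> \<sigma> / 2"
  shows "\<sigma> * \<bar>u r * u1 r\<bar> \<le> exp 1 * G 1"
proof -
  have "E / 2 * (u r)\<^sup>2 \<le> q r * (u r)\<^sup>2" using bulk[OF assms] by (intro mult_right_mono) auto
  then have "(u1 r)\<^sup>2 + E / 2 * (u r)\<^sup>2 \<le> G r" by (simp add: G_def)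
  also have "\<dots> \<le> exp 1 * G 1" by (rule G_comparable[OF assms])
  finally have 1: "(u1 r)\<^sup>2 + E / 2 * (u r)\<^sup>2 \<le> exp 1 * G 1" .
  have "0 \<le> (\<bar>u1 r\<bar> - \<sigma> / 2 * \<bar>u r\<bar>)\<^sup>2" by simp
  also have "\<dots> = (u1 r)\<^sup>2 + E / 4 * (u r)\<^sup>2 - \<sigma> * \<bar>u r * u1 r\<bar>"
    by (simp add: power2_diff power_mult_distrib power_divide sigma abs_mult)
  also have "\<dots> \<le> (u1 r)\<^sup>2 + E / 2 * (u r)\<^sup>2 - \<sigma> * \<bar>u r * u1 r\<bar>"
    using E2 by (simp add: mult_right_mono)
  finally show ?thesis using 1 by linarith
qed

lemma cont_u: "a > 0 \<Longrightarrow> continuous_on {a..b} u"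
  unfolding u_def[abs_def] by (intro continuous_intros cont_w) auto

text \<open>Equipartition: the derivative of u u1 is u1^2 - q u^2 = G - 2 q u^2, so up to boundary
  terms half of the integral of \<open>G\<close> is carried by q u^2. The boundary terms are of
  order G / \<sigma>, small against an interval of length at least 1.\<close>

lemma u_mass:
  assumes "r1 \<le> a" "b \<le> \<sigma> / 2" "a + 1 \<le> b"
  shows "(b - a) * G 1 / (8 * exp 1 * E) \<le> integral {a..b} (\<lambda>r. (u r)\<^sup>2)"
proof -
  have a0: "a > 0" using assms r0r1 by linarith
  have in_bulk: "r1 \<le> r" "r \<le> \<sigma> / 2" "r > 0" if "r \<in> {a..b}" for r using that assms a0 by auto
  have "((\<lambda>r. G r - 2 * (q r * (u r)\<^sup>2)) has_integral (u b * u1 b - u a * u1 a)) {a..b}"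
  proof (rule fundamental_theorem_of_calculus)
    show "a \<le> b" using assms by simp
    fix r assume r: "r \<in> {a..b}"
    have "((\<lambda>r. u r * u1 r) has_real_derivative (G r - 2 * (q r * (u r)\<^sup>2))) (at r)"
      using in_bulk[OF r] by (auto intro!: derivative_eq_intros u_deriv u1_deriv simp: G_def power2_eq_square algebra_simps)
    then show "((\<lambda>r. u r * u1 r) has_vector_derivative (G r - 2 * (q r * (u r)\<^sup>2))) (at r within {a..b})"
      by (simp add: has_real_derivative_iff_has_vector_derivative has_vector_derivative_at_within)
  qed
  moreover have cont_q: "continuous_on {a..b} q"
    unfolding q_def[abs_def] using a0 by (intro continuous_intros) auto
  have qu: "(\<lambda>r. q r * (u r)\<^sup>2) integrable_on {a..b}"
    by (intro integrable_continuous_interval continuous_intros cont_q cont_u a0)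
  have G_int: "G integrable_on {a..b}"
    by (rule integrable_continuous_interval, rule continuous_at_imp_continuous_on)
       (use in_bulk G_deriv DERIV_isCont in blast)
  ultimately have I: "integral {a..b} G - 2 * integral {a..b} (\<lambda>r. q r * (u r)\<^sup>2) = u b * u1 b - u a * u1 a"
    using qu by (subst (asm) has_integral_integrable_integral)
       (simp add: integral_diff integrable_on_cmult_left)
  have "(b - a) * (G 1 / exp 1) = integral {a..b} (\<lambda>_. G 1 / exp 1)" using assms by simp
  also have "\<dots> \<le> integral {a..b} G"
    using in_bulk G_comparable(2) G_int by (intro integral_le) (auto simp: field_simps)
  finally have 1: "(b - a) * (G 1 / exp 1) \<le> integral {a..b} G" .
  have "integral {a..b} (\<lambda>r. q r * (u r)\<^sup>2) \<le> integral {a..b} (\<lambda>r. 2 * E * (u r)\<^sup>2)"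
    using in_bulk bulk(5) qu
    by (intro integral_le mult_right_mono integrable_continuous_interval continuous_intros cont_q cont_u a0) auto
  then have 2: "integral {a..b} (\<lambda>r. q r * (u r)\<^sup>2) \<le> 2 * E * integral {a..b} (\<lambda>r. (u r)\<^sup>2)" by simp
  have e3: "exp 1 \<le> (3::real)" by (rule exp_le)
  have G0: "G 1 \<ge> 0" using G_nonneg one_bulk by blast
  define T where "T = (b - a) * (G 1 / exp 1)"
  have small: "\<bar>u r * u1 r\<bar> \<le> T / 4" if "r \<in> {a..b}" for r
  proof -
    have "\<sigma> * \<bar>u r * u1 r\<bar> \<le> exp 1 * G 1" using uu1 in_bulk that by blast
    also have "\<dots> \<le> \<sigma> * (G 1 / exp 1 / 4 * 1)"
    proof -
      \<comment> \<open>Here \<open>\<sigma> \<ge> 40\<close> enters, through 4 e^2 \<le>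
        36.\<close>
      have "exp 1 * exp 1 \<le> (3 * 3 :: real)" using e3 by (intro mult_mono) auto
      then have "(4 * exp 1 * exp 1) \<le> \<sigma>" using sigma(3) by simp
      then have "(4 * exp 1 * exp 1) * G 1 \<le> \<sigma> * G 1" using G0 by (rule mult_right_mono)
      then show ?thesis by (simp add: field_simps)
    qed
    also have "\<dots> \<le> \<sigma> * (G 1 / exp 1 / 4 * (b - a))"
      using sigma G0 assms by (intro mult_left_mono) auto
    also have "\<dots> = \<sigma> * (T / 4)" by (simp add: T_def)
    finally show ?thesis using sigma(1) by (rule mult_left_le_imp_le)
  qed
  have "a \<in> {a..b}" "b \<in> {a..b}" using assms by auto
  from small[OF this(1)] small[OF this(2)] have "\<bar>u b * u1 b - u a * u1 a\<bar> \<le> T / 2" by linarith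
  with I 1 2 have "T / 2 \<le> 4 * E * integral {a..b} (\<lambda>r. (u r)\<^sup>2)"
    unfolding T_def[symmetric] by linarith
  then have "T / (8 * E) \<le> integral {a..b} (\<lambda>r. (u r)\<^sup>2)" using E2 by (simp add: field_simps)
  moreover have "(b - a) * G 1 / (8 * exp 1 * E) = T / (8 * E)" by (simp add: T_def)
  ultimately show ?thesis by simp
qed

end

section \<open>Energy bounds uniform in the degree\<close>

definition laguerre_profile :: "real \<Rightarrow> nat \<Rightarrow> real \<Rightarrow> real" where
  "laguerre_profile A n r = r powr (A + 1/2) * (laguerre A n (r\<^sup>2) * exp (- r\<^sup>2 / 2))"

text \<open>For \<open>A = radial_order \<alpha>\<close> this is
  \<open>laguerre_eigenvalue \<alpha> n\<close>.\<close>

definition laguerre_freq :: "real \<Rightarrow> nat \<Rightarrow> real" where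
  "laguerre_freq A n = 4 * real n + 2 * A + 2"

text \<open>\<open>\<Gamma>\<close> is the energy at r = 1. It bounds the profile pointwise from
  above and in mean square from below with the same order, so its own size is recorded from below
  only.\<close>

lemma laguerre_bulk:
  fixes A :: real and n :: nat
  defines "E \<equiv> laguerre_freq A n"
  assumes A: "A \<ge> 0" and E: "4 * (A + 1)\<^sup>2 \<le> E" "2000 \<le> E"
  shows "\<exists>\<Gamma>. energy_const A * E powr (1/2 - A) * (laguerre A n 0)\<^sup>2 \<le> \<Gamma> \<and>
    (\<forall>r. 1 \<le> r \<and> r \<le> sqrt E / 2 \<longrightarrow> E * (laguerre_profile A n r)\<^sup>2 \<le> 2 * exp 1 * \<Gamma>) \<and>
    (\<forall>a b. 1 \<le> a \<and> a + 1 \<le> b \<and> b \<le> sqrt E / 2 \<longrightarrow>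
      (b - a) * \<Gamma> / (8 * exp 1 * E) \<le> integral {a..b} (\<lambda>r. (laguerre_profile A n r)\<^sup>2)) \<and>
    (\<forall>a b. 0 < a \<longrightarrow> continuous_on {a..b} (laguerre_profile A n))"
proof -
  have A1: "A > -1" using A by simp
  obtain L' L'' where L: "\<And>x. (laguerre A n has_real_derivative L' x) (at x)"
    "\<And>x. (L' has_real_derivative L'' x) (at x)"
    "\<And>x. x * L'' x + (A + 1 - x) * L' x + real n * laguerre A n x = 0"
    using laguerre_ODE[OF A1, of n] by blast
  define w where "w = (\<lambda>r::real. laguerre A n (r\<^sup>2) * exp (- r\<^sup>2 / 2))"
  define w1 where "w1 = (\<lambda>r::real. (2 * r * L' (r\<^sup>2) - r * laguerre A n (r\<^sup>2)) * exp (- r\<^sup>2 / 2))"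
  have c1: "((\<lambda>r. laguerre A n (r\<^sup>2)) has_real_derivative (L' (r\<^sup>2) * (2 * r))) (at r)" for r
    by (rule DERIV_chain2[OF L(1)]) (auto intro!: derivative_eq_intros)
  have c2: "((\<lambda>r. L' (r\<^sup>2)) has_real_derivative (L'' (r\<^sup>2) * (2 * r))) (at r)" for r
    by (rule DERIV_chain2[OF L(2)]) (auto intro!: derivative_eq_intros)
  have w1_deriv: "(w1 has_real_derivative ((2 * L' (r\<^sup>2) + 4 * r\<^sup>2 * L'' (r\<^sup>2) - laguerre A n (r\<^sup>2) - 4 * r\<^sup>2 * L' (r\<^sup>2) + r\<^sup>2 * laguerre A n (r\<^sup>2)) * exp (- r\<^sup>2 / 2))) (at r)" for r
    unfolding w1_def
    by (auto intro!: derivative_eq_intros c1 c2) (simp add: algebra_simps power2_eq_square)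
  interpret laguerre_ode A E w w1
  proof
    show "(w has_real_derivative w1 r) (at r)" for r
      unfolding w_def w1_def by (auto intro!: derivative_eq_intros c1) (simp add: algebra_simps)
    show "(w1 has_real_derivative (- (2 * A + 1) / r * w1 r - (E - r\<^sup>2) * w r)) (at r)" if r: "r > 0" for r
    proof -
      have "r\<^sup>2 * L'' (r\<^sup>2) = - (A + 1 - r\<^sup>2) * L' (r\<^sup>2) - real n * laguerre A n (r\<^sup>2)"
        using L(3)[of "r\<^sup>2"] by (simp add: algebra_simps)
      then have e: "2 * L' (r\<^sup>2) + 4 * r\<^sup>2 * L'' (r\<^sup>2) - laguerre A n (r\<^sup>2) - 4 * r\<^sup>2 * L' (r\<^sup>2) + r\<^sup>2 * laguerre A n (r\<^sup>2)
        = 2 * L' (r\<^sup>2) + 4 * (- (A + 1 - r\<^sup>2) * L' (r\<^sup>2) - real n * laguerre A n (r\<^sup>2)) - laguerre A n (r\<^sup>2) - 4 * r\<^sup>2 * L' (r\<^sup>2) + r\<^sup>2 * laguerre A n (r\<^sup>2)"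
        by simp
      have e': "- (2 * A + 1) / r * w1 r = - (2 * A + 1) * (2 * L' (r\<^sup>2) - laguerre A n (r\<^sup>2)) * exp (- r\<^sup>2 / 2)"
        using r unfolding w1_def by (simp add: field_simps)
      show ?thesis
        by (rule DERIV_cong[OF w1_deriv])
           (unfold e e', simp add: w_def E_def laguerre_freq_def algebra_simps)
    qed
    show "continuous_on UNIV w1"
      using w1_deriv by (meson DERIV_isCont continuous_at_imp_continuous_on)
    show "w1 0 = 0" by (simp add: w1_def)
  qed (use A E in auto)
  have u: "u = laguerre_profile A n"
  proof
    show "u r = laguerre_profile A n r" for r
      unfolding u_def laguerre_profile_def by (simp add: w_def)
  qed
  have w0: "w 0 = laguerre A n 0" by (simp add: w_def)
  show ?thesis
  proof (intro exI[of _ "G 1"] conjI allI impI)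
    show "energy_const A * E powr (1/2 - A) * (laguerre A n 0)\<^sup>2 \<le> G 1"
      using energy_lower by (simp add: w0)
    show "E * (laguerre_profile A n r)\<^sup>2 \<le> 2 * exp 1 * G 1" if "1 \<le> r \<and> r \<le> sqrt E / 2" for r
      using u_upper[of r] that one_bulk by (simp add: u \<sigma>_def)
    show "(b - a) * G 1 / (8 * exp 1 * E) \<le> integral {a..b} (\<lambda>r. (laguerre_profile A n r)\<^sup>2)"
      if "1 \<le> a \<and> a + 1 \<le> b \<and> b \<le> sqrt E / 2" for a b
      using u_mass[of a b] that one_bulk by (simp add: u \<sigma>_def)
    show "continuous_on {a..b} (laguerre_profile A n)" if "0 < a" for a b
      using cont_u[OF that] by (simp add: u)
  qed
qed

text \<open>The value at 0 is the binomial coefficient of n + A over n, asymptotic to n^A / Gamma (A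
  + 1); the factor 2 leaves room below the limit.\<close>

lemma laguerre_at_0_lower:
  fixes A :: real
  assumes A: "A \<ge> 0"
  shows "\<forall>\<^sub>F n in sequentially. laguerre A n 0 \<ge> real n powr A / (2 * Gamma (A + 1))"
proof -
  have g: "Gamma (A + 1) > 0" using A by (intro Gamma_real_pos) simp
  have "(\<lambda>n. ((- A - 1) gchoose n) / ((-1) ^ n / exp ((- A - 1 + 1) * of_real (ln (real n)))))
      \<longlonglongrightarrow> inverse (Gamma (- (- A - 1)))"
    by (rule gbinomial_asymptotic)
  moreover have "((- A - 1) gchoose n) / ((-1) ^ n / exp ((- A - 1 + 1) * of_real (ln (real n)))) =
      laguerre A n 0 * exp (- (A * ln (real n)))" for n
    by (simp add: laguerre_at_0 gbinomial_pochhammer power_mult_distrib[symmetric] add.commute)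
  ultimately have "(\<lambda>n. laguerre A n 0 * exp (- (A * ln (real n)))) \<longlonglongrightarrow> 1 / Gamma (A + 1)"
    by (simp add: inverse_eq_divide add.commute)
  moreover have "1 / Gamma (A + 1) > 1 / (2 * Gamma (A + 1))" using g by (simp add: field_simps)
  ultimately have "\<forall>\<^sub>F n in sequentially. laguerre A n 0 * exp (- (A * ln (real n))) > 1 / (2 * Gamma (A + 1))"
    by (rule order_tendstoD(1))
  then show ?thesis
    using eventually_gt_at_top[of 0]
  proof eventually_elim
    case (elim n)
    have "laguerre A n 0 = laguerre A n 0 * exp (- (A * ln (real n))) * real n powr A"
      using elim by (simp add: powr_def exp_minus)
    also have "\<dots> \<ge> 1 / (2 * Gamma (A + 1)) * real n powr A"
      using elim by (intro mult_right_mono) auto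
    finally show ?case by simp
  qed
qed

definition laguerre_energy_bounds :: "real \<Rightarrow> nat \<Rightarrow> real \<Rightarrow> bool" where
  "laguerre_energy_bounds A n \<Gamma> \<longleftrightarrow> laguerre_freq A n \<ge> 2000 \<and> \<Gamma> > 0 \<and>
    (\<forall>r. 1 \<le> r \<and> r \<le> sqrt (laguerre_freq A n) / 2 \<longrightarrow>
       laguerre_freq A n * (laguerre_profile A n r)\<^sup>2 \<le> 2 * exp 1 * \<Gamma>) \<and>
    (\<forall>a b. 1 \<le> a \<and> a + 1 \<le> b \<and> b \<le> sqrt (laguerre_freq A n) / 2 \<longrightarrow>
       (b - a) * \<Gamma> / (8 * exp 1 * laguerre_freq A n) \<le> integral {a..b} (\<lambda>r. (laguerre_profile A n r)\<^sup>2)) \<and>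
    (\<forall>a b. 0 < a \<longrightarrow> continuous_on {a..b} (laguerre_profile A n))"

lemma laguerre_energy_boundsD:
  assumes "laguerre_energy_bounds A n \<Gamma>"
  shows "laguerre_freq A n \<ge> 2000" "\<Gamma> > 0"
    "\<And>r. 1 \<le> r \<Longrightarrow> r \<le> sqrt (laguerre_freq A n) / 2 \<Longrightarrow>
       laguerre_freq A n * (laguerre_profile A n r)\<^sup>2 \<le> 2 * exp 1 * \<Gamma>"
    "\<And>a b. 1 \<le> a \<Longrightarrow> a + 1 \<le> b \<Longrightarrow> b \<le> sqrt (laguerre_freq A n) / 2 \<Longrightarrow>
       (b - a) * \<Gamma> / (8 * exp 1 * laguerre_freq A n) \<le> integral {a..b} (\<lambda>r. (laguerre_profile A n r)\<^sup>2)"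
    "\<And>a b. 0 < a \<Longrightarrow> continuous_on {a..b} (laguerre_profile A n)"
  using assms unfolding laguerre_energy_bounds_def by simp_all

text \<open>Relates \<Gamma> to m = Gamma (A + n + 1) / (2 n!), the squared L^2 norm of the profile
  on the half-line. The value at 0 is an exact multiple of m and also at least of order E^A; using
  each form once in its square turns E^(1/2 - A) into m E^(1/2).\<close>

lemma laguerre_energy_estimates:
  fixes A :: real
  assumes A: "A \<ge> 0"
  shows "\<exists>c>0. \<exists>N \<Gamma>. \<forall>n\<ge>N. laguerre_energy_bounds A n (\<Gamma> n) \<and>
    c * (Gamma (A + real n + 1) / (2 * fact n)) * sqrt (laguerre_freq A n) \<le> \<Gamma> n"
proof -
  define E where "E = laguerre_freq A"
  have g: "Gamma (A + 1) > 0" using A by (intro Gamma_real_pos) simp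
  have "filterlim E at_top sequentially"
    unfolding E_def laguerre_freq_def by real_asymp
  then have "\<forall>\<^sub>F n in sequentially. E n \<ge> max (4 * (A + 1)\<^sup>2) 2000"
    unfolding filterlim_at_top by blast
  moreover note laguerre_at_0_lower[OF A] eventually_gt_at_top[of "0::nat"]
  ultimately have "\<forall>\<^sub>F n in sequentially. E n \<ge> max (4 * (A + 1)\<^sup>2) 2000 \<and>
      laguerre A n 0 \<ge> real n powr A / (2 * Gamma (A + 1)) \<and> n > 0"
    by eventually_elim simp
  then obtain N where N: "\<And>n. n \<ge> N \<Longrightarrow> E n \<ge> 4 * (A + 1)\<^sup>2" "\<And>n. n \<ge> N \<Longrightarrow> E n \<ge> 2000"
    "\<And>n. n \<ge> N \<Longrightarrow> laguerre A n 0 \<ge> real n powr A / (2 * Gamma (A + 1))" "\<And>n. n \<ge> N \<Longrightarrow> n > 0"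
    unfolding eventually_sequentially by auto
  have "\<exists>\<Gamma>. energy_const A * E n powr (1/2 - A) * (laguerre A n 0)\<^sup>2 \<le> \<Gamma> \<and>
    (\<forall>r. 1 \<le> r \<and> r \<le> sqrt (E n) / 2 \<longrightarrow> E n * (laguerre_profile A n r)\<^sup>2 \<le> 2 * exp 1 * \<Gamma>) \<and>
    (\<forall>a b. 1 \<le> a \<and> a + 1 \<le> b \<and> b \<le> sqrt (E n) / 2 \<longrightarrow>
      (b - a) * \<Gamma> / (8 * exp 1 * E n) \<le> integral {a..b} (\<lambda>r. (laguerre_profile A n r)\<^sup>2)) \<and>
    (\<forall>a b. 0 < a \<longrightarrow> continuous_on {a..b} (laguerre_profile A n))" if "n \<ge> N" for n
    unfolding E_def using N(1,2)[OF that] by (intro laguerre_bulk A) (simp_all add: E_def)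
  then obtain \<Gamma> where \<Gamma>: "\<And>n. n \<ge> N \<Longrightarrow> energy_const A * E n powr (1/2 - A) * (laguerre A n 0)\<^sup>2 \<le> \<Gamma> n \<and>
    (\<forall>r. 1 \<le> r \<and> r \<le> sqrt (E n) / 2 \<longrightarrow> E n * (laguerre_profile A n r)\<^sup>2 \<le> 2 * exp 1 * \<Gamma> n) \<and>
    (\<forall>a b. 1 \<le> a \<and> a + 1 \<le> b \<and> b \<le> sqrt (E n) / 2 \<longrightarrow>
      (b - a) * \<Gamma> n / (8 * exp 1 * E n) \<le> integral {a..b} (\<lambda>r. (laguerre_profile A n r)\<^sup>2)) \<and>
    (\<forall>a b. 0 < a \<longrightarrow> continuous_on {a..b} (laguerre_profile A n))"
    by metis
  \<comment> \<open>The base \<open>1 / (6 + 2 * A)\<close> comes from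
    \<open>E n \<le> (6 + 2 * A) * real n\<close>, valid for n > 0.\<close>
  define c where "c = energy_const A * (1 / (6 + 2 * A)) powr A / (Gamma (A + 1))\<^sup>2"
  have c0: "c > 0" unfolding c_def using g A
    by (intro divide_pos_pos mult_pos_pos zero_less_power energy_const_pos) auto
  have low: "c * (Gamma (A + real n + 1) / (2 * fact n)) * sqrt (E n) \<le> \<Gamma> n" if n: "n \<ge> N" for n
  proof -
    define m where "m = Gamma (A + real n + 1) / (2 * fact n)"
    have gn: "Gamma (A + real n + 1) > 0" using A by (intro Gamma_real_pos) simp
    then have m0: "m > 0" by (simp add: m_def)
    have n0: "n > 0" and E0: "E n > 0" using N[OF n] by auto
    have L: "laguerre A n 0 = 2 * m / Gamma (A + 1)"
    proof -
      have "pochhammer (A + 1) n = Gamma (A + 1 + of_nat n) / Gamma (A + 1)"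
        by (rule pochhammer_Gamma) (use A in \<open>auto elim!: nonpos_Ints_cases\<close>)
      then show ?thesis by (simp add: laguerre_at_0 m_def add_ac)
    qed
    have "E n \<le> (6 + 2 * A) * real n"
    proof -
      have "2 * A \<le> 2 * A * real n" using A n0 mult_left_mono[of 1 "real n" "2 * A"] by simp
      then show ?thesis using n0 unfolding E_def laguerre_freq_def by (simp add: algebra_simps)
    qed
    then have "1 / (6 + 2 * A) * E n \<le> real n" using A by (simp add: field_simps)
    then have "(1 / (6 + 2 * A) * E n) powr A \<le> real n powr A" using A E0 by (intro powr_mono2) auto
    then have pw: "(1 / (6 + 2 * A)) powr A * E n powr A \<le> real n powr A"
      by (simp only: powr_mult)
    have "(1 / (6 + 2 * A)) powr A * E n powr A / (2 * Gamma (A + 1)) \<le> laguerre A n 0"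
      by (rule order_trans[OF divide_right_mono[OF pw] N(3)[OF n]]) (use g in simp)
    then have "(1 / (6 + 2 * A)) powr A * E n powr A / (2 * Gamma (A + 1)) * (2 * m / Gamma (A + 1)) \<le> laguerre A n 0 * laguerre A n 0"
      unfolding L using m0 g by (intro mult_right_mono) auto
    then have "energy_const A * E n powr (1/2 - A) * ((1 / (6 + 2 * A)) powr A * E n powr A / (2 * Gamma (A + 1)) * (2 * m / Gamma (A + 1)))
      \<le> energy_const A * E n powr (1/2 - A) * (laguerre A n 0)\<^sup>2"
      using energy_const_pos[OF A] unfolding power2_eq_square by (intro mult_left_mono) auto
    also have "\<dots> \<le> \<Gamma> n" using \<Gamma>[OF n] by simp
    finally have "energy_const A * E n powr (1/2 - A) * ((1 / (6 + 2 * A)) powr A * E n powr A / (2 * Gamma (A + 1)) * (2 * m / Gamma (A + 1))) \<le> \<Gamma> n" .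
    moreover have "E n powr (1/2 - A) * E n powr A = sqrt (E n)"
      using E0 by (simp add: powr_add[symmetric] powr_half_sqrt)
    then have "energy_const A * E n powr (1/2 - A) * ((1 / (6 + 2 * A)) powr A * E n powr A / (2 * Gamma (A + 1)) * (2 * m / Gamma (A + 1)))
      = c * m * sqrt (E n)"
      by (simp add: c_def power2_eq_square mult_ac)
    ultimately show ?thesis by (simp add: m_def)
  qed
  have pos: "\<Gamma> n > 0" if n: "n \<ge> N" for n
  proof -
    have gn: "Gamma (A + real n + 1) > 0" using A by (intro Gamma_real_pos) simp
    have "0 < c * (Gamma (A + real n + 1) / (2 * fact n)) * sqrt (E n)"
      using gn c0 N(2)[OF n] by simp
    then show ?thesis using low[OF n] by linarith
  qed
  have "laguerre_energy_bounds A n (\<Gamma> n)" if n: "n \<ge> N" for n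
    unfolding laguerre_energy_bounds_def E_def[symmetric] using N(2)[OF n] pos[OF n] \<Gamma>[OF n] by blast
  with c0 low show ?thesis unfolding E_def by blast
qed

section \<open>Radial reduction of the spectral projections\<close>

lemma has_bochner_integral_Gaussian_moment:
  fixes a \<sigma> :: real
  assumes a: "a > -1" and s: "\<sigma> > 0"
  shows "has_bochner_integral lborel (\<lambda>x. indicator {0<..} x * (x powr (2 * a + 1) * exp (- \<sigma> * x\<^sup>2)))
    (Gamma (a + 1) / (2 * \<sigma> powr (a + 1)))"
proof -
  define f where "f = (\<lambda>t::real. t powr (a + 1 - 1) / exp t)"
  have "(f has_integral Gamma (a + 1)) {0..}"
    unfolding f_def by (rule Gamma_integral_real) (use a in simp)
  then have "(f has_integral Gamma (a + 1)) {0<..}"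
    by (rule has_integral_spike_set_eq[THEN iffD1, rotated 2])
       (auto intro: negligible_subset[of "{0}"])
  then have "f absolutely_integrable_on {0<..} \<and> integral {0<..} f = Gamma (a + 1)"
    by (auto simp: f_def intro!: nonnegative_absolutely_integrable_1)
  moreover have "(\<lambda>x. \<sigma> * x\<^sup>2) ` {0<..} = {0<..}"
  proof (intro equalityI subsetI)
    fix y :: real assume "y \<in> {0<..}"
    then show "y \<in> (\<lambda>x. \<sigma> * x\<^sup>2) ` {0<..}" using s by (intro image_eqI[of _ _ "sqrt (y / \<sigma>)"]) auto
  qed (use s in auto)
  moreover have inj: "inj_on (\<lambda>x. \<sigma> * x\<^sup>2) {0<..}"
    using s by (auto simp: inj_on_def)
  have der: "((\<lambda>x. \<sigma> * x\<^sup>2) has_field_derivative (2 * \<sigma> * x)) (at x within {0<..})" for x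
    by (auto intro!: derivative_eq_intros)
  ultimately have "(\<lambda>x. \<bar>2 * \<sigma> * x\<bar> * f (\<sigma> * x\<^sup>2)) absolutely_integrable_on {0<..} \<and>
      integral {0<..} (\<lambda>x. \<bar>2 * \<sigma> * x\<bar> * f (\<sigma> * x\<^sup>2)) = Gamma (a + 1)"
    using has_absolute_integral_change_of_variables_1'[OF _ der inj, of f "Gamma (a + 1)"] by simp
  moreover define g where "g = (\<lambda>x. indicator {0<..} x * (x powr (2 * a + 1) * exp (- \<sigma> * x\<^sup>2)))"
  have eq: "indicator {0<..} x *\<^sub>R (\<bar>2 * \<sigma> * x\<bar> * f (\<sigma> * x\<^sup>2)) = 2 * \<sigma> powr (a + 1) * g x" for x
  proof (cases "x > 0")
    case True
    have "f (\<sigma> * x\<^sup>2) = \<sigma> powr a * (x powr 2) powr a * exp (- \<sigma> * x\<^sup>2)"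
      using True s by (simp add: f_def powr_mult exp_minus field_simps)
    also have "(x powr 2) powr a = x powr (2 * a)" by (simp only: powr_powr)
    finally show ?thesis using True s by (simp add: g_def powr_add mult_ac)
  qed (simp add: g_def)
  ultimately have "integrable lebesgue (\<lambda>x. 2 * \<sigma> powr (a + 1) * g x) \<and>
     integral\<^sup>L lebesgue (\<lambda>x. 2 * \<sigma> powr (a + 1) * g x) = Gamma (a + 1)"
    using set_lebesgue_integral_eq_integral(2)[of "{0<..}" "\<lambda>x. \<bar>2 * \<sigma> * x\<bar> * f (\<sigma> * x\<^sup>2)"]
    unfolding set_integrable_def set_lebesgue_integral_def eq by simp
  moreover have "g \<in> borel_measurable lborel" unfolding g_def by measurable
  ultimately have "integrable lborel (\<lambda>x. 2 * \<sigma> powr (a + 1) * g x) \<and>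
     integral\<^sup>L lborel (\<lambda>x. 2 * \<sigma> powr (a + 1) * g x) = Gamma (a + 1)"
    by (simp add: integrable_completion integral_completion del: integral_mult_right_zero integral_mult_right)
  then have "integrable lborel g \<and> integral\<^sup>L lborel g = Gamma (a + 1) / (2 * \<sigma> powr (a + 1))"
    using s by (auto simp: field_simps)
  then show ?thesis unfolding g_def[symmetric] by (simp add: has_bochner_integral_iff)
qed

text \<open>The Pochhammer symbol in each coefficient cancels against the Gamma factor of its
  moment, leaving the binomial expansion of (1 - 1/\<sigma>)^m. Since \<sigma> enters only through
  powers with exponents m and a + 1, a product over coordinates depends on \<sigma> only through
  |\<mu>|_1 and |\<alpha>|_1.\<close>

lemma has_bochner_integral_laguerre_Gaussian:
  fixes a \<sigma> :: real
  assumes a: "a > -1" and s: "\<sigma> > 0"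
  shows "has_bochner_integral lborel
    (\<lambda>x. indicator {0<..} x * (x powr (2 * a + 1) * laguerre a m (x\<^sup>2) * exp (- \<sigma> * x\<^sup>2)))
    (Gamma (a + real m + 1) / (2 * fact m) * ((1 - 1 / \<sigma>) ^ m / \<sigma> powr (a + 1)))"
proof -
  have "has_bochner_integral lborel
    (\<lambda>x. \<Sum>k\<le>m. laguerre_coeff a m k * (indicator {0<..} x * (x powr (2 * (a + real k) + 1) * exp (- \<sigma> * x\<^sup>2))))
    (\<Sum>k\<le>m. laguerre_coeff a m k * (Gamma (a + real k + 1) / (2 * \<sigma> powr (a + real k + 1))))"
    using a s by (intro has_bochner_integral_sum has_bochner_integral_mult_right has_bochner_integral_Gaussian_moment) auto
  moreover have "(\<Sum>k\<le>m. laguerre_coeff a m k * (indicator {0<..} x * (x powr (2 * (a + real k) + 1) * exp (- \<sigma> * x\<^sup>2))))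
     = indicator {0<..} x * (x powr (2 * a + 1) * laguerre a m (x\<^sup>2) * exp (- \<sigma> * x\<^sup>2))" for x
  proof (cases "x > 0")
    case True
    have "x powr (2 * (a + real k) + 1) = x powr (2 * a + 1) * (x\<^sup>2) ^ k" for k
    proof -
      have "x powr (2 * (a + real k) + 1) = x powr (2 * a + 1) * x powr (real (2 * k))"
        by (simp add: powr_add[symmetric] algebra_simps)
      then show ?thesis using True by (simp only: powr_realpow power_mult)
    qed
    then show ?thesis using True a
      by (simp add: laguerre_explicit sum_distrib_left sum_distrib_right mult_ac)
  qed simp
  moreover have "(\<Sum>k\<le>m. laguerre_coeff a m k * (Gamma (a + real k + 1) / (2 * \<sigma> powr (a + real k + 1))))
     = Gamma (a + real m + 1) / (2 * fact m) * ((1 - 1 / \<sigma>) ^ m / \<sigma> powr (a + 1))"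
  proof -
    have "laguerre_coeff a m k * (Gamma (a + real k + 1) / (2 * \<sigma> powr (a + real k + 1))) =
      Gamma (a + real m + 1) / (2 * fact m) / \<sigma> powr (a + 1) * (of_nat (m choose k) * (- 1 / \<sigma>) ^ k * 1 ^ (m - k))"
      if k: "k \<le> m" for k
    proof -
      have "pochhammer (a + 1 + real k) (m - k) = Gamma (a + 1 + real k + of_nat (m - k)) / Gamma (a + 1 + real k)"
        by (rule pochhammer_Gamma) (use a in \<open>auto elim!: nonpos_Ints_cases\<close>)
      moreover have "a + 1 + real k + of_nat (m - k) = a + real m + 1" using k by (simp add: of_nat_diff)
      moreover have g: "Gamma (a + 1 + real k) \<noteq> 0"
        using Gamma_real_pos[of "a + 1 + real k"] a by linarith
      ultimately have p: "pochhammer (a + 1 + real k) (m - k) * Gamma (a + real k + 1) = Gamma (a + real m + 1)"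
        using g by (simp add: add_ac)
      have q: "\<sigma> powr (a + real k + 1) = \<sigma> powr (a + 1) * \<sigma> ^ k"
        using s by (simp add: powr_add powr_realpow)
      have "laguerre_coeff a m k * (Gamma (a + real k + 1) / (2 * \<sigma> powr (a + real k + 1))) =
         (-1) ^ k / fact k / fact (m - k) * (pochhammer (a + 1 + real k) (m - k) * Gamma (a + real k + 1)) / (2 * (\<sigma> powr (a + 1) * \<sigma> ^ k))"
        unfolding q laguerre_coeff_def using k by simp
      also have "\<dots> = Gamma (a + real m + 1) / (2 * fact m) / \<sigma> powr (a + 1) * (of_nat (m choose k) * (- 1 / \<sigma>) ^ k * 1 ^ (m - k))"
        unfolding p binomial_fact[OF k] power_divide using s by (simp add: field_simps)
      finally show ?thesis .
    qed
    then have "(\<Sum>k\<le>m. laguerre_coeff a m k * (Gamma (a + real k + 1) / (2 * \<sigma> powr (a + real k + 1)))) =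
      (\<Sum>k\<le>m. Gamma (a + real m + 1) / (2 * fact m) / \<sigma> powr (a + 1) * (of_nat (m choose k) * (- 1 / \<sigma>) ^ k * 1 ^ (m - k)))"
      by (intro sum.cong) auto
    also have "\<dots> = Gamma (a + real m + 1) / (2 * fact m) / \<sigma> powr (a + 1) * (- 1 / \<sigma> + 1) ^ m"
      unfolding sum_distrib_left[symmetric] binomial_ring[symmetric] ..
    finally show ?thesis by (simp add: field_simps)
  qed
  ultimately show ?thesis by simp
qed

text \<open>Fubini along coordinates: \<open>lborel\<close> is the image of the product measure
  indexed by \<open>Basis\<close>, and \<open>axis j 1\<close> translates between coordinates and
  basis vectors.\<close>

lemma has_bochner_integral_lborel_vec_prod:
  fixes h :: "'n::finite \<Rightarrow> real \<Rightarrow> real" and I :: "'n \<Rightarrow> real"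
  assumes h: "\<And>j. has_bochner_integral lborel (h j) (I j)"
  shows "has_bochner_integral lborel (\<lambda>x :: real ^ 'n. \<Prod>j\<in>UNIV. h j (x $ j)) (\<Prod>j\<in>UNIV. I j)"
proof -
  interpret P: product_sigma_finite "\<lambda>_ :: real ^ 'n. lborel :: real measure" ..
  define ax where "ax = (\<lambda>j :: 'n. axis j (1::real))"
  have bij: "bij_betw ax UNIV Basis"
    by (auto simp: bij_betw_def inj_on_def axis_eq_axis Basis_vec_def ax_def)
  define H where "H = (\<lambda>b. h (the_inv_into UNIV ax b))"
  have H: "H (ax j) = h j" for j
    using the_inv_into_f_f[of ax UNIV j] bij by (simp add: H_def bij_betw_def)
  have Hi: "integrable lborel (H b)" for b
    unfolding H_def using h by (simp add: has_bochner_integral_iff)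
  let ?S = "\<lambda>f :: real ^ 'n \<Rightarrow> real. \<Sum>b\<in>Basis. f b *\<^sub>R b"
  have S: "?S f $ j = f (ax j)" for f j
  proof -
    have "?S f $ j = ?S f \<bullet> ax j" by (simp add: ax_def inner_axis)
    also have "\<dots> = f (ax j)"
      by (rule inner_sum_left_Basis) (use bij in \<open>auto simp: bij_betw_def\<close>)
    finally show ?thesis .
  qed
  have pe: "(\<Prod>j\<in>UNIV. h j (?S f $ j)) = (\<Prod>b\<in>Basis. H b (f b))" for f
    unfolding S using prod.reindex_bij_betw[OF bij, of "\<lambda>b. H b (f b)"] by (simp add: H)
  have meas: "(\<lambda>x :: real ^ 'n. \<Prod>j\<in>UNIV. h j (x $ j)) \<in> borel_measurable borel"
  proof -
    have "h j \<in> borel_measurable borel" for j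
      using h[of j] by (auto simp: has_bochner_integral_iff dest: borel_measurable_integrable)
    moreover have "(\<lambda>x :: real ^ 'n. x $ j) \<in> borel_measurable borel" for j
      by (intro borel_measurable_continuous_onI continuous_intros)
    ultimately show ?thesis
      by (intro borel_measurable_prod) (auto intro: measurable_compose)
  qed
  have int: "integrable (\<Pi>\<^sub>M b\<in>Basis. lborel) (\<lambda>f. \<Prod>b\<in>(Basis :: (real ^ 'n) set). H b (f b))"
    by (rule P.product_integrable_prod) (auto simp: Hi)
  have "integral\<^sup>L (\<Pi>\<^sub>M b\<in>Basis. lborel) (\<lambda>f. \<Prod>b\<in>(Basis :: (real ^ 'n) set). H b (f b)) = (\<Prod>b\<in>Basis. integral\<^sup>L lborel (H b))"
    by (rule P.product_integral_prod) (auto simp: Hi)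
  also have "\<dots> = (\<Prod>j\<in>UNIV. integral\<^sup>L lborel (h j))"
    using prod.reindex_bij_betw[OF bij, of "\<lambda>b. integral\<^sup>L lborel (H b)"] by (simp add: H)
  also have "\<dots> = (\<Prod>j\<in>UNIV. I j)" using h by (simp add: has_bochner_integral_iff)
  finally have val: "integral\<^sup>L (\<Pi>\<^sub>M b\<in>Basis. lborel) (\<lambda>f. \<Prod>b\<in>(Basis :: (real ^ 'n) set). H b (f b)) = (\<Prod>j\<in>UNIV. I j)" .
  have mS: "?S \<in> measurable (\<Pi>\<^sub>M b\<in>Basis. lborel) borel" by measurable
  have "integrable lborel (\<lambda>x :: real ^ 'n. \<Prod>j\<in>UNIV. h j (x $ j))"
    using int by (subst lborel_eq, subst integrable_distr_eq[OF mS]) (use meas in \<open>simp_all only: pe\<close>)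
  moreover have "integral\<^sup>L lborel (\<lambda>x :: real ^ 'n. \<Prod>j\<in>UNIV. h j (x $ j)) = (\<Prod>j\<in>UNIV. I j)"
    using val by (subst lborel_eq, subst integral_distr[OF mS]) (use meas in \<open>simp_all only: pe\<close>)
  ultimately show ?thesis by (simp add: has_bochner_integral_iff)
qed

text \<open>By Weierstrass' theorem the moments determine the image of a finite signed measure on \<open>[0, 1]\<close>.\<close>

lemma moments_determine_integral:
  fixes k :: "'a \<Rightarrow> real" and l :: "'b \<Rightarrow> real" and G :: "real \<Rightarrow> real"
  assumes k: "integrable M k" and l: "integrable N l"
    and \<rho>: "\<rho> \<in> borel_measurable M" "\<And>x. \<rho> x \<in> {0..1}"
    and \<tau>: "\<tau> \<in> borel_measurable N" "\<And>x. \<tau> x \<in> {0..1}"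
    and mom: "\<And>i. (LINT x|M. k x * \<rho> x ^ i) = (LINT y|N. l y * \<tau> y ^ i)"
    and G: "continuous_on {0..1} G"
  shows "integrable M (\<lambda>x. k x * G (\<rho> x))" "integrable N (\<lambda>y. l y * G (\<tau> y))"
    "(LINT x|M. k x * G (\<rho> x)) = (LINT y|N. l y * G (\<tau> y))"
proof -
  obtain B where B: "\<And>y. y \<in> {0..1} \<Longrightarrow> \<bar>G y\<bar> \<le> B"
    using compact_imp_bounded[OF compact_continuous_image[OF G compact_Icc]]
    unfolding bounded_iff by (metis imageI real_norm_def)
  \<comment> \<open>Continuity of G is known on [0, 1] alone; truncation gives a Borel function on
    the line that agrees with G on the ranges of \<rho> and \<tau>.\<close>
  define G' where "G' = (\<lambda>y. indicator {0..1} y * G y)"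
  have G'm: "G' \<in> borel_measurable borel"
    using borel_measurable_continuous_on_indicator[OF _ G] by (simp add: G'_def)
  have G': "G' y = G y" if "y \<in> {0..1}" for y using that by (simp add: G'_def)
  have int: "integrable M' (\<lambda>x. k' x * F (\<rho>' x))"
    if "integrable M' k'" "\<rho>' \<in> borel_measurable M'" "F \<in> borel_measurable borel"
      "\<And>x. \<bar>F (\<rho>' x)\<bar> \<le> C" for M' :: "'c measure" and k' \<rho>' and F :: "real \<Rightarrow> real" and C
  proof (rule Bochner_Integration.integrable_bound[of _ "\<lambda>x. C * k' x"])
    show "AE x in M'. norm (k' x * F (\<rho>' x)) \<le> norm (C * k' x)"
      using that(4) by (intro always_eventually allI) (auto simp: abs_mult intro!: mult_right_mono order_trans[OF that(4)] simp: mult.commute[of "\<bar>k' _\<bar>"])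
  qed (use that in \<open>auto intro: borel_measurable_integrable\<close>)
  have GB: "\<bar>G' (\<rho> x)\<bar> \<le> B" "\<bar>G' (\<tau> y)\<bar> \<le> B" for x y using B G' \<rho> \<tau> by simp_all
  show i1: "integrable M (\<lambda>x. k x * G (\<rho> x))"
    using int[OF k \<rho>(1) G'm GB(1)] by (simp only: G'[OF \<rho>(2)])
  show i2: "integrable N (\<lambda>y. l y * G (\<tau> y))"
    using int[OF l \<tau>(1) G'm GB(2)] by (simp only: G'[OF \<tau>(2)])
  have pw: "integrable M (\<lambda>x. k x * \<rho> x ^ i)" "integrable N (\<lambda>y. l y * \<tau> y ^ i)" for i
    using \<rho>(2) \<tau>(2)
    by (auto intro!: int[OF k \<rho>(1), of "\<lambda>y. y ^ i" 1] int[OF l \<tau>(1), of "\<lambda>y. y ^ i" 1] simp: power_le_one)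
  define D where "D = (LINT x|M. \<bar>k x\<bar>) + (LINT y|N. \<bar>l y\<bar>)"
  have D0: "D \<ge> 0" unfolding D_def by (intro add_nonneg_nonneg integral_nonneg) auto
  have "\<bar>(LINT x|M. k x * G (\<rho> x)) - (LINT y|N. l y * G (\<tau> y))\<bar> \<le> e * D" if e: "e > 0" for e
  proof -
    obtain p where p: "real_polynomial_function p" "\<And>x. x \<in> {0..1} \<Longrightarrow> \<bar>G x - p x\<bar> < e"
      using Stone_Weierstrass_real_polynomial_function[OF compact_Icc G e] by blast
    then obtain a n where pa: "p = (\<lambda>x. \<Sum>i\<le>n. a i * x ^ i)"
      using real_polynomial_function_iff_sum by blast
    have P: "integrable M (\<lambda>x. k x * p (\<rho> x))" "integrable N (\<lambda>y. l y * p (\<tau> y))"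
        "(LINT x|M. k x * p (\<rho> x)) = (LINT y|N. l y * p (\<tau> y))"
    proof -
      have e1: "k x * p (\<rho> x) = (\<Sum>i\<le>n. a i * (k x * \<rho> x ^ i))" for x
        by (simp add: pa sum_distrib_left mult_ac)
      have e2: "l x * p (\<tau> x) = (\<Sum>i\<le>n. a i * (l x * \<tau> x ^ i))" for x
        by (simp add: pa sum_distrib_left mult_ac)
      show "integrable M (\<lambda>x. k x * p (\<rho> x))" "integrable N (\<lambda>y. l y * p (\<tau> y))"
        unfolding e1 e2 by (intro Bochner_Integration.integrable_sum integrable_mult_right pw)+
      show "(LINT x|M. k x * p (\<rho> x)) = (LINT y|N. l y * p (\<tau> y))"
        unfolding e1 e2 by (simp add: pw mom)
    qed
    have b1: "\<bar>(LINT x|M. k x * G (\<rho> x)) - (LINT x|M. k x * p (\<rho> x))\<bar> \<le> e * (LINT x|M. \<bar>k x\<bar>)"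
    proof -
      have "\<bar>LINT x|M. k x * G (\<rho> x) - k x * p (\<rho> x)\<bar> \<le> (LINT x|M. e * \<bar>k x\<bar>)"
      proof (rule order_trans[OF integral_abs_bound], rule integral_mono)
        fix x
        have "\<bar>k x\<bar> * \<bar>G (\<rho> x) - p (\<rho> x)\<bar> \<le> \<bar>k x\<bar> * e"
          using p(2)[OF \<rho>(2)[of x]] by (intro mult_left_mono) auto
        then show "\<bar>k x * G (\<rho> x) - k x * p (\<rho> x)\<bar> \<le> e * \<bar>k x\<bar>"
          by (simp add: abs_mult[symmetric] right_diff_distrib mult.commute)
      qed (use i1 P k in auto)
      then show ?thesis using i1 P by simp
    qed
    have b2: "\<bar>(LINT x|N. l x * G (\<tau> x)) - (LINT x|N. l x * p (\<tau> x))\<bar> \<le> e * (LINT x|N. \<bar>l x\<bar>)"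
    proof -
      have "\<bar>LINT x|N. l x * G (\<tau> x) - l x * p (\<tau> x)\<bar> \<le> (LINT x|N. e * \<bar>l x\<bar>)"
      proof (rule order_trans[OF integral_abs_bound], rule integral_mono)
        fix x
        have "\<bar>l x\<bar> * \<bar>G (\<tau> x) - p (\<tau> x)\<bar> \<le> \<bar>l x\<bar> * e"
          using p(2)[OF \<tau>(2)[of x]] by (intro mult_left_mono) auto
        then show "\<bar>l x * G (\<tau> x) - l x * p (\<tau> x)\<bar> \<le> e * \<bar>l x\<bar>"
          by (simp add: abs_mult[symmetric] right_diff_distrib mult.commute)
      qed (use i2 P l in auto)
      then show ?thesis using i2 P by simp
    qed
    show ?thesis using b1 b2 P(3) by (simp add: D_def algebra_simps)
  qed
  then have "\<bar>(LINT x|M. k x * G (\<rho> x)) - (LINT y|N. l y * G (\<tau> y))\<bar> \<le> 0 + e" if "e > 0" for e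
    using that D0 by (cases "D = 0") (force dest: spec[of _ "e / D"], smt (verit) divide_pos_pos nonzero_eq_divide_eq)
  then have "\<bar>(LINT x|M. k x * G (\<rho> x)) - (LINT y|N. l y * G (\<tau> y))\<bar> \<le> 0"
    by (rule field_le_epsilon)
  then show "(LINT x|M. k x * G (\<rho> x)) = (LINT y|N. l y * G (\<tau> y))" by simp
qed

section \<open>Integrals of radial functions against Laguerre products\<close>

definition radial_order :: "real ^ 'n \<Rightarrow> real" where
  "radial_order \<alpha> = l1 \<alpha> + real CARD('n) - 1"

definition radial_eigenfun :: "real ^ 'n \<Rightarrow> nat \<Rightarrow> real ^ 'n \<Rightarrow> real" where
  "radial_eigenfun \<alpha> n x = (\<Prod>j\<in>UNIV. x $ j powr (\<alpha> $ j + 1/2)) *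
     laguerre (radial_order \<alpha>) n ((norm x)\<^sup>2) * exp (- (norm x)\<^sup>2 / 2)"

text \<open>The unnormalized Laguerre function times the monomial x^(\<alpha> + 1/2) that every test
  function carries; the indicators restrict to the orthant.\<close>

definition laguerre_weight :: "real ^ 'n \<Rightarrow> nat ^ 'n \<Rightarrow> real ^ 'n \<Rightarrow> real" where
  "laguerre_weight \<alpha> \<mu> x = (\<Prod>j\<in>UNIV. indicator {0<..} (x $ j) *
     (x $ j powr (2 * \<alpha> $ j + 1) * laguerre (\<alpha> $ j) (\<mu> $ j) ((x $ j)\<^sup>2) * exp (- (x $ j)\<^sup>2 / 2)))"

definition radial_weight :: "real \<Rightarrow> nat \<Rightarrow> real \<Rightarrow> real" where
  "radial_weight A n r = indicator {0<..} r * (r powr (2 * A + 1) * laguerre A n (r\<^sup>2) * exp (- r\<^sup>2 / 2))"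

definition radial_mass :: "real ^ 'n \<Rightarrow> nat \<Rightarrow> real" where
  "radial_mass \<alpha> n = Gamma (radial_order \<alpha> + real n + 1) / (2 * fact n)"

lemma norm_vec_sq: "(norm (x :: real ^ 'n))\<^sup>2 = (\<Sum>j\<in>UNIV. (x $ j)\<^sup>2)"
  unfolding power2_norm_eq_inner inner_vec_def by (simp add: power2_eq_square)

lemma norm_sq_l1: "(norm (x :: real ^ 'n))\<^sup>2 = l1 (\<chi> j. (x $ j)\<^sup>2)"
  by (simp add: norm_vec_sq l1_def)

lemma radial_order_gt:
  assumes "\<forall>j. \<alpha> $ j > -1"
  shows "radial_order \<alpha> > -1"
proof -
  have "0 < \<alpha> $ j + 1" for j using assms[rule_format, of j] by linarith
  then have "0 < (\<Sum>j\<in>UNIV. \<alpha> $ j + 1)" by (intro sum_pos) auto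
  then show ?thesis by (simp add: radial_order_def l1_def sum.distrib)
qed

lemma radial_mass_pos:
  assumes "\<forall>j. \<alpha> $ j > -1"
  shows "radial_mass \<alpha> n > 0"
  using radial_order_gt[OF assms] by (auto simp: radial_mass_def intro!: divide_pos_pos Gamma_real_pos)

text \<open>Moments take the place of polar coordinates. For G(y) = y^i both integrals are Gaussian
  with parameter i + 1/2, and by \<open>has_bochner_integral_laguerre_Gaussian\<close> they agree up
  to a constant independent of i. The variable exp (- |x|^2) takes values in [0, 1], so
  \<open>moments_determine_integral\<close> extends this to continuous G.\<close>

lemma radial_integral:
  fixes \<alpha> :: "real ^ 'n" and \<mu> :: "nat ^ 'n" and G :: "real \<Rightarrow> real"
  assumes \<alpha>: "\<forall>j. \<alpha> $ j > -1" and G: "continuous_on {0..1} G"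
  shows "integrable lborel (\<lambda>x. laguerre_weight \<alpha> \<mu> x * G (exp (- (norm x)\<^sup>2)))"
    "integrable lborel (\<lambda>r. radial_weight (radial_order \<alpha>) (l1 \<mu>) r * G (exp (- r\<^sup>2)))"
    "(LINT x|lborel. laguerre_weight \<alpha> \<mu> x * G (exp (- (norm x)\<^sup>2))) =
      (\<Prod>j\<in>UNIV. Gamma (\<alpha> $ j + real (\<mu> $ j) + 1) / (2 * fact (\<mu> $ j))) / radial_mass \<alpha> (l1 \<mu>) *
      (LINT r|lborel. radial_weight (radial_order \<alpha>) (l1 \<mu>) r * G (exp (- r\<^sup>2)))"
proof -
  define A where "A = radial_order \<alpha>"
  have A: "A > -1" unfolding A_def by (rule radial_order_gt[OF \<alpha>])
  define n where "n = l1 \<mu>"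
  define \<kappa> where "\<kappa> = (\<Prod>j\<in>UNIV. Gamma (\<alpha> $ j + real (\<mu> $ j) + 1) / (2 * fact (\<mu> $ j))) / radial_mass \<alpha> n"
  have m0: "radial_mass \<alpha> n > 0" by (rule radial_mass_pos[OF \<alpha>])
  have g: "\<And>j. Gamma (\<alpha> $ j + real (\<mu> $ j) + 1) > 0" using \<alpha> by (intro Gamma_real_pos) (smt (verit) of_nat_0_le_iff)
  have \<kappa>0: "\<kappa> > 0" unfolding \<kappa>_def using m0 g by (intro divide_pos_pos prod_pos) auto
  have L: "has_bochner_integral lborel (\<lambda>x. laguerre_weight \<alpha> \<mu> x * exp (- (norm x)\<^sup>2) ^ i)
      (\<kappa> * (radial_mass \<alpha> n * ((1 - 1 / (real i + 1/2)) ^ n / (real i + 1/2) powr (A + 1))))" for i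
  proof -
    define \<sigma> where "\<sigma> = real i + 1/2"
    have \<sigma>: "\<sigma> > 0" by (simp add: \<sigma>_def add_pos_nonneg)
    have "has_bochner_integral lborel (\<lambda>x :: real ^ 'n. \<Prod>j\<in>UNIV. indicator {0<..} (x $ j) * (x $ j powr (2 * \<alpha> $ j + 1) * laguerre (\<alpha> $ j) (\<mu> $ j) ((x $ j)\<^sup>2) * exp (- \<sigma> * (x $ j)\<^sup>2)))
      (\<Prod>j\<in>UNIV. Gamma (\<alpha> $ j + real (\<mu> $ j) + 1) / (2 * fact (\<mu> $ j)) * ((1 - 1 / \<sigma>) ^ (\<mu> $ j) / \<sigma> powr (\<alpha> $ j + 1)))"
      using \<alpha> \<sigma> by (intro has_bochner_integral_lborel_vec_prod has_bochner_integral_laguerre_Gaussian) auto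
    moreover have "(\<Prod>j\<in>UNIV. indicator {0<..} (x $ j) * (x $ j powr (2 * \<alpha> $ j + 1) * laguerre (\<alpha> $ j) (\<mu> $ j) ((x $ j)\<^sup>2) * exp (- \<sigma> * (x $ j)\<^sup>2)))
      = laguerre_weight \<alpha> \<mu> x * exp (- (norm x)\<^sup>2) ^ i" for x :: "real ^ 'n"
    proof -
      have "exp (- (norm x)\<^sup>2) ^ i = (\<Prod>j\<in>UNIV. exp (- real i * (x $ j)\<^sup>2))"
        unfolding norm_vec_sq exp_of_nat_mult[symmetric] exp_sum[OF finite, symmetric]
        by (simp add: sum_distrib_left sum_negf)
      moreover have "exp (- \<sigma> * y\<^sup>2) = exp (- y\<^sup>2 / 2) * exp (- real i * y\<^sup>2)" for y :: real
        by (simp add: \<sigma>_def exp_add[symmetric] algebra_simps)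
      ultimately show ?thesis unfolding laguerre_weight_def by (simp add: prod.distrib[symmetric] mult_ac)
    qed
    moreover have "(\<Prod>j\<in>UNIV. Gamma (\<alpha> $ j + real (\<mu> $ j) + 1) / (2 * fact (\<mu> $ j)) * ((1 - 1 / \<sigma>) ^ (\<mu> $ j) / \<sigma> powr (\<alpha> $ j + 1)))
      = \<kappa> * (radial_mass \<alpha> n * ((1 - 1 / \<sigma>) ^ n / \<sigma> powr (A + 1)))"
    proof -
      have "(\<Prod>j\<in>UNIV. (1 - 1 / \<sigma>) ^ (\<mu> $ j)) = (1 - 1 / \<sigma>) ^ n"
        by (simp add: n_def l1_def power_sum)
      moreover have "(\<Prod>j\<in>UNIV. \<sigma> powr (\<alpha> $ j + 1)) = \<sigma> powr (\<Sum>j\<in>UNIV. \<alpha> $ j + 1)"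
        using \<sigma> by (subst powr_sum) auto
      moreover have "(\<Sum>j\<in>UNIV. \<alpha> $ j + 1) = A + 1"
        by (simp add: A_def radial_order_def l1_def sum.distrib)
      ultimately show ?thesis
        unfolding \<kappa>_def prod.distrib prod_dividef using m0 by simp
    qed
    ultimately show ?thesis by (simp add: \<sigma>_def)
  qed
  have R: "has_bochner_integral lborel (\<lambda>r. \<kappa> * radial_weight A n r * exp (- r\<^sup>2) ^ i)
      (\<kappa> * (radial_mass \<alpha> n * ((1 - 1 / (real i + 1/2)) ^ n / (real i + 1/2) powr (A + 1))))" for i
  proof -
    have "has_bochner_integral lborel
      (\<lambda>x. \<kappa> * (indicator {0<..} x * (x powr (2 * A + 1) * laguerre A n (x\<^sup>2) * exp (- (real i + 1/2) * x\<^sup>2))))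
      (\<kappa> * (radial_mass \<alpha> n * ((1 - 1 / (real i + 1/2)) ^ n / (real i + 1/2) powr (A + 1))))"
      unfolding radial_mass_def A_def[symmetric]
      using A by (intro has_bochner_integral_mult_right has_bochner_integral_laguerre_Gaussian) (auto intro: add_nonneg_pos)
    moreover have "exp (- (real i + 1/2) * x\<^sup>2) = exp (- x\<^sup>2 / 2) * exp (- x\<^sup>2) ^ i" for x :: real
      unfolding exp_of_nat_mult[symmetric] exp_add[symmetric] by (simp add: algebra_simps)
    ultimately show ?thesis unfolding radial_weight_def by (simp add: mult_ac)
  qed
  have mr: "(\<lambda>r::real. exp (- r\<^sup>2)) \<in> borel_measurable lborel" by measurable
  have mx: "(\<lambda>x :: real ^ 'n. exp (- (norm x)\<^sup>2)) \<in> borel_measurable lborel" by measurable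
  note D = moments_determine_integral[where M = "lborel :: (real ^ 'n) measure" and N = "lborel :: real measure"
      and k = "laguerre_weight \<alpha> \<mu>" and l = "\<lambda>r. \<kappa> * radial_weight A n r" and \<rho> = "\<lambda>x. exp (- (norm x)\<^sup>2)"
      and \<tau> = "\<lambda>r. exp (- r\<^sup>2)" and G = G, OF _ _ mx _ mr _ _ G]
  have D1: "integrable lborel (laguerre_weight \<alpha> \<mu>)" "integrable lborel (\<lambda>r. \<kappa> * radial_weight A n r)"
    using L[of 0] R[of 0] by (simp_all add: has_bochner_integral_iff)
  have D2: "(LINT x|lborel. laguerre_weight \<alpha> \<mu> x * exp (- (norm x)\<^sup>2) ^ i) =
      (LINT r|lborel. \<kappa> * radial_weight A n r * exp (- r\<^sup>2) ^ i)" for i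
    using L[of i] R[of i] by (simp add: has_bochner_integral_iff)
  note D = D[OF D1 _ _ D2]
  show "integrable lborel (\<lambda>x. laguerre_weight \<alpha> \<mu> x * G (exp (- (norm x)\<^sup>2)))"
    by (rule D) auto
  have "integrable lborel (\<lambda>r. \<kappa> * radial_weight A n r * G (exp (- r\<^sup>2)))"
    by (rule D) auto
  then have "integrable lborel (\<lambda>r. \<kappa> * (radial_weight A n r * G (exp (- r\<^sup>2))))" by (simp add: mult.assoc)
  then show "integrable lborel (\<lambda>r. radial_weight (radial_order \<alpha>) (l1 \<mu>) r * G (exp (- r\<^sup>2)))"
    using \<kappa>0 unfolding A_def[symmetric] n_def[symmetric] by (simp del: integrable_mult_left integrable_mult_right)
  have "(LINT x|lborel. laguerre_weight \<alpha> \<mu> x * G (exp (- (norm x)\<^sup>2))) =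
      (LINT r|lborel. \<kappa> * radial_weight A n r * G (exp (- r\<^sup>2)))"
    by (rule D) auto
  then show "(LINT x|lborel. laguerre_weight \<alpha> \<mu> x * G (exp (- (norm x)\<^sup>2))) =
      (\<Prod>j\<in>UNIV. Gamma (\<alpha> $ j + real (\<mu> $ j) + 1) / (2 * fact (\<mu> $ j))) / radial_mass \<alpha> (l1 \<mu>) *
      (LINT r|lborel. radial_weight (radial_order \<alpha>) (l1 \<mu>) r * G (exp (- r\<^sup>2)))"
    unfolding A_def[symmetric] n_def[symmetric] \<kappa>_def[symmetric] by (simp add: mult.assoc)
qed

text \<open>The substitution y = exp (- t) compactifies the half-line, and the limit 0 at infinity
  supplies continuity at y = 0. This brings radial profiles into the form required by
  \<open>radial_integral\<close>.\<close>

lemma continuous_on_exp_profile: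
  fixes g :: "real \<Rightarrow> real"
  assumes g: "continuous_on {0..} g" and lim: "(g \<longlongrightarrow> 0) at_top"
  shows "continuous_on {0..1} (\<lambda>y. if y = 0 then 0 else g (- ln y))" (is "continuous_on _ ?G")
  unfolding continuous_on_eq_continuous_within
proof
  fix y :: real assume y: "y \<in> {0..1}"
  show "continuous (at y within {0..1}) ?G"
  proof (cases "y = 0")
    case True
    have "filterlim (\<lambda>y::real. - ln y) at_top (at_right 0)"
      using ln_at_0 by (simp add: filterlim_uminus_at_bot)
    then have "((\<lambda>y. g (- ln y)) \<longlongrightarrow> 0) (at_right 0)"
      by (rule filterlim_compose[OF lim])
    then have "(?G \<longlongrightarrow> 0) (at_right 0)"
      by (rule Lim_transform_eventually) (auto simp: eventually_at_filter)
    moreover have "at 0 within {0..1} \<le> at_right (0::real)"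
      by (simp add: at_within_Icc_at_right)
    ultimately show ?thesis using True by (simp add: continuous_within tendsto_mono)
  next
    case False
    have "continuous_on {0<..1} (\<lambda>y. g (- ln y))"
      by (rule continuous_on_compose2[OF g]) (auto intro!: continuous_intros)
    then have "continuous_on {0<..1} ?G" by (rule continuous_on_eq) auto
    then have "continuous (at y within {0<..1}) ?G"
      using False y by (auto simp: continuous_on_eq_continuous_within)
    moreover have "at y within {0<..1} = at y within {0..1}"
      by (rule at_within_nhd[of _ "{0<..}"]) (use False y in auto)
    ultimately show ?thesis by simp
  qed
qed

lemma open_pos_orthant: "open (pos_orthant :: (real ^ 'n) set)"
proof -
  have "(pos_orthant :: (real ^ 'n) set) = (\<Inter>j. {x. 0 < x $ j})" by (auto simp: pos_orthant_def)
  also have "open \<dots>" by (intro open_INT) (auto intro!: open_Collect_less continuous_intros)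
  finally show ?thesis .
qed

lemma pos_orthant_sets: "(pos_orthant :: (real ^ 'n) set) \<in> sets borel"
  using open_pos_orthant by (rule borel_open)

lemma pos_orthant_lebesgue: "(pos_orthant :: (real ^ 'n) set) \<in> sets lebesgue"
  using pos_orthant_sets by (intro sets_completionI_sets) simp

lemma laguerre_weight_outside:
  assumes "x \<notin> pos_orthant"
  shows "laguerre_weight \<alpha> \<mu> x = 0"
proof -
  obtain j where "\<not> 0 < x $ j" using assms by (auto simp: pos_orthant_def)
  then show ?thesis unfolding laguerre_weight_def by (intro prod_zero bexI[of _ j]) simp_all
qed

text \<open>Against a radial profile the coefficient of \<mu> is, up to normalization, a Gamma
  product times a radial integral that depends on \<mu> only through |\<mu>|_1. The squared
  normalization of the Laguerre function cancels that product, so the sum over \<mu> reduces to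
  \<open>laguerre_addition\<close>.\<close>

lemma spectral_proj_radial:
  fixes \<alpha> :: "real ^ 'n" and g :: "real \<Rightarrow> real"
  assumes \<alpha>: "\<forall>j. \<alpha> $ j > -1"
    and g: "continuous_on {0..} g" and lim: "(g \<longlongrightarrow> 0) at_top"
    and x: "x \<in> pos_orthant"
  shows "spectral_proj \<alpha> n (\<lambda>y. of_real ((\<Prod>j\<in>UNIV. y $ j powr (\<alpha> $ j + 1/2)) * g ((norm y)\<^sup>2))) x =
    of_real ((LINT r|lborel. radial_weight (radial_order \<alpha>) n r * g (r\<^sup>2)) / radial_mass \<alpha> n *
      radial_eigenfun \<alpha> n x)"
proof -
  define G where "G = (\<lambda>y. if y = 0 then 0 else g (- ln y))"
  have G: "continuous_on {0..1} G" unfolding G_def by (rule continuous_on_exp_profile[OF g lim])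
  have Gg: "G (exp (- t)) = g t" for t by (simp add: G_def)
  define I where "I = (LINT r|lborel. radial_weight (radial_order \<alpha>) n r * g (r\<^sup>2))"
  define f where "f = (\<lambda>y :: real ^ 'n. (\<Prod>j\<in>UNIV. y $ j powr (\<alpha> $ j + 1/2)) * g ((norm y)\<^sup>2))"
  have summand: "orthant_inner (\<lambda>y. of_real (f y)) (\<lambda>y. of_real (laguerre_fun \<alpha> \<mu> y)) * of_real (laguerre_fun \<alpha> \<mu> x) =
     of_real (I / radial_mass \<alpha> n * (\<Prod>j\<in>UNIV. x $ j powr (\<alpha> $ j + 1/2)) * exp (- (norm x)\<^sup>2 / 2) *
       (\<Prod>j\<in>UNIV. laguerre (\<alpha> $ j) (\<mu> $ j) ((x $ j)\<^sup>2)))" if \<mu>: "l1 \<mu> = n" for \<mu>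
  proof -
    define s where "s = (\<lambda>j. sqrt (2 * fact (\<mu> $ j) / Gamma (real (\<mu> $ j) + \<alpha> $ j + 1)))"
    have gp: "Gamma (\<alpha> $ j + real (\<mu> $ j) + 1) > 0" for j
      using \<alpha> by (intro Gamma_real_pos) (smt (verit) of_nat_0_le_iff)
    have s2: "s j * s j = 1 / (Gamma (\<alpha> $ j + real (\<mu> $ j) + 1) / (2 * fact (\<mu> $ j)))" for j
      unfolding s_def using gp[of j] by (simp add: add_ac)
    have fun1: "laguerre_fun \<alpha> \<mu> y = (\<Prod>j\<in>UNIV. s j) * (\<Prod>j\<in>UNIV. y $ j powr (\<alpha> $ j + 1/2)) *
        (\<Prod>j\<in>UNIV. laguerre (\<alpha> $ j) (\<mu> $ j) ((y $ j)\<^sup>2)) * (\<Prod>j\<in>UNIV. exp (- (y $ j)\<^sup>2 / 2))" for y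
      unfolding laguerre_fun_def laguerre_fun1_def s_def prod.distrib ..
    have ex: "(\<Prod>j\<in>UNIV. exp (- (y $ j)\<^sup>2 / 2)) = exp (- (norm y)\<^sup>2 / 2)" for y :: "real ^ 'n"
      unfolding norm_vec_sq exp_sum[OF finite, symmetric] by (simp add: sum_negf sum_divide_distrib)
    have pt: "indicator pos_orthant y * (f y * laguerre_fun \<alpha> \<mu> y) =
       (\<Prod>j\<in>UNIV. s j) * (laguerre_weight \<alpha> \<mu> y * G (exp (- (norm y)\<^sup>2)))" for y
    proof (cases "y \<in> pos_orthant")
      case True
      then have "indicator {0<..} (y $ j) = (1::real)" for j by (simp add: pos_orthant_def)
      moreover have "y $ j powr (2 * \<alpha> $ j + 1) = y $ j powr (\<alpha> $ j + 1/2) * y $ j powr (\<alpha> $ j + 1/2)" for j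
        by (simp add: powr_add[symmetric])
      ultimately show ?thesis using True
        unfolding f_def fun1 laguerre_weight_def Gg by (simp add: prod.distrib mult_ac)
    next
      case False
      then show ?thesis by (simp add: laguerre_weight_outside)
    qed
    have "orthant_inner (\<lambda>y. of_real (f y)) (\<lambda>y. of_real (laguerre_fun \<alpha> \<mu> y)) =
       (LINT y|lebesgue. indicator pos_orthant y *\<^sub>R (complex_of_real (f y) * cnj (of_real (laguerre_fun \<alpha> \<mu> y))))"
      unfolding orthant_inner_def
      by (rule integral_restrict_space) (use pos_orthant_lebesgue in simp)
    also have "\<dots> = (LINT y|lebesgue. complex_of_real ((\<Prod>j\<in>UNIV. s j) * (laguerre_weight \<alpha> \<mu> y * G (exp (- (norm y)\<^sup>2)))))"
      unfolding pt[symmetric] by (simp add: scaleR_conv_of_real)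
    also have "\<dots> = of_real (LINT y|lebesgue. (\<Prod>j\<in>UNIV. s j) * (laguerre_weight \<alpha> \<mu> y * G (exp (- (norm y)\<^sup>2))))"
      by (rule integral_complex_of_real)
    also have "(LINT y|lebesgue. (\<Prod>j\<in>UNIV. s j) * (laguerre_weight \<alpha> \<mu> y * G (exp (- (norm y)\<^sup>2)))) =
       (LINT y|lborel. (\<Prod>j\<in>UNIV. s j) * (laguerre_weight \<alpha> \<mu> y * G (exp (- (norm y)\<^sup>2))))"
      by (rule integral_completion) (use borel_measurable_integrable[OF radial_integral(1)[OF \<alpha> G, of \<mu>]] in simp)
    also have "\<dots> = (\<Prod>j\<in>UNIV. s j) * ((\<Prod>j\<in>UNIV. Gamma (\<alpha> $ j + real (\<mu> $ j) + 1) / (2 * fact (\<mu> $ j))) / radial_mass \<alpha> n * I)"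
      by (simp only: integral_mult_right_zero radial_integral(3)[OF \<alpha> G] \<mu>) (simp only: Gg I_def)
    finally have "orthant_inner (\<lambda>y. of_real (f y)) (\<lambda>y. of_real (laguerre_fun \<alpha> \<mu> y)) * of_real (laguerre_fun \<alpha> \<mu> x) =
      of_real (((\<Prod>j\<in>UNIV. s j * s j) * (\<Prod>j\<in>UNIV. Gamma (\<alpha> $ j + real (\<mu> $ j) + 1) / (2 * fact (\<mu> $ j)))) * I / radial_mass \<alpha> n *
        (\<Prod>j\<in>UNIV. x $ j powr (\<alpha> $ j + 1/2)) * exp (- (norm x)\<^sup>2 / 2) * (\<Prod>j\<in>UNIV. laguerre (\<alpha> $ j) (\<mu> $ j) ((x $ j)\<^sup>2)))"
      unfolding fun1 ex prod.distrib by (simp add: mult_ac)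
    moreover have "(\<Prod>j\<in>UNIV. s j * s j) * (\<Prod>j\<in>UNIV. Gamma (\<alpha> $ j + real (\<mu> $ j) + 1) / (2 * fact (\<mu> $ j))) = 1"
      unfolding prod.distrib[symmetric] s2 using gp by (intro prod.neutral ballI) (simp add: less_imp_neq[symmetric])
    ultimately show ?thesis by (simp only: mult_1)
  qed
  have "spectral_proj \<alpha> n (\<lambda>y. of_real (f y)) x = (\<Sum>\<mu> | l1 \<mu> = n.
     of_real (I / radial_mass \<alpha> n * (\<Prod>j\<in>UNIV. x $ j powr (\<alpha> $ j + 1/2)) * exp (- (norm x)\<^sup>2 / 2) *
       (\<Prod>j\<in>UNIV. laguerre (\<alpha> $ j) (\<mu> $ j) ((x $ j)\<^sup>2))))"
    unfolding spectral_proj_def by (rule sum.cong) (use summand in auto)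
  also have "\<dots> = of_real (I / radial_mass \<alpha> n * (\<Prod>j\<in>UNIV. x $ j powr (\<alpha> $ j + 1/2)) * exp (- (norm x)\<^sup>2 / 2) *
       (\<Sum>\<mu> | l1 \<mu> = n. (\<Prod>j\<in>UNIV. laguerre (\<alpha> $ j) (\<mu> $ j) ((x $ j)\<^sup>2))))"
    by (simp add: sum_distrib_left)
  also have "(\<Sum>\<mu> | l1 \<mu> = n. (\<Prod>j\<in>UNIV. laguerre (\<alpha> $ j) (\<mu> $ j) ((x $ j)\<^sup>2))) = laguerre (radial_order \<alpha>) n ((norm x)\<^sup>2)"
    using laguerre_addition[where \<alpha> = \<alpha> and n = n and y = "\<chi> j. (x $ j)\<^sup>2"] by (simp add: radial_order_def norm_sq_l1)
  finally show ?thesis unfolding f_def I_def radial_eigenfun_def by (simp add: mult_ac)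
qed

section \<open>Large values of the radial eigenfunctions\<close>

text \<open>A cutoff that is continuous, because the radial formula is applied to continuous
  profiles.\<close>

definition trapezoid :: "real \<Rightarrow> real \<Rightarrow> real \<Rightarrow> real" where
  "trapezoid p q s = max 0 (min 1 (min (s - p) (q - s)))"

lemma trapezoid_bounds: "0 \<le> trapezoid p q s" "trapezoid p q s \<le> 1"
  by (auto simp: trapezoid_def)

lemma trapezoid_eq_1: "p + 1 \<le> s \<Longrightarrow> s + 1 \<le> q \<Longrightarrow> trapezoid p q s = 1"
  by (auto simp: trapezoid_def)

lemma trapezoid_eq_0: "s \<le> p \<or> q \<le> s \<Longrightarrow> trapezoid p q s = 0"
  by (auto simp: trapezoid_def)

lemma continuous_trapezoid: "continuous_on S (trapezoid p q)"
  unfolding trapezoid_def[abs_def] by (intro continuous_intros)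

lemma integral_ge_on_interval:
  fixes F v :: "real \<Rightarrow> real"
  assumes F: "integrable lborel F" "\<And>r. 0 \<le> F r" and v: "continuous_on {a..b} v"
    and le: "\<And>r. r \<in> {a..b} \<Longrightarrow> \<kappa> * v r \<le> F r"
  shows "\<kappa> * integral {a..b} v \<le> (LINT r|lborel. F r)"
proof -
  have si: "set_integrable lborel {a..b} v"
    by (rule borel_integrable_atLeastAtMost'[OF v])
  have "\<kappa> * integral {a..b} v = \<kappa> * (LINT r:{a..b}|lborel. v r)"
    using set_borel_integral_eq_integral(2)[OF si] by simp
  also have "\<dots> = (LINT r|lborel. \<kappa> * (indicator {a..b} r *\<^sub>R v r))"
    unfolding set_lebesgue_integral_def by simp
  also have "\<dots> \<le> (LINT r|lborel. F r)"
    using si F le unfolding set_integrable_def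
    by (intro integral_mono) (auto simp: indicator_def)
  finally show ?thesis .
qed

lemma radial_integral_profile:
  fixes \<alpha> :: "real ^ 'n" and \<mu> :: "nat ^ 'n" and g :: "real \<Rightarrow> real"
  assumes \<alpha>: "\<forall>j. \<alpha> $ j > -1" and g: "continuous_on {0..} g" and lim: "(g \<longlongrightarrow> 0) at_top"
  shows "integrable lborel (\<lambda>x. laguerre_weight \<alpha> \<mu> x * g ((norm x)\<^sup>2))"
    "integrable lborel (\<lambda>r. radial_weight (radial_order \<alpha>) (l1 \<mu>) r * g (r\<^sup>2))"
    "(LINT x|lborel. laguerre_weight \<alpha> \<mu> x * g ((norm x)\<^sup>2)) =
      (\<Prod>j\<in>UNIV. Gamma (\<alpha> $ j + real (\<mu> $ j) + 1) / (2 * fact (\<mu> $ j))) / radial_mass \<alpha> (l1 \<mu>) *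
      (LINT r|lborel. radial_weight (radial_order \<alpha>) (l1 \<mu>) r * g (r\<^sup>2))"
proof -
  define G where "G = (\<lambda>y. if y = 0 then 0 else g (- ln y))"
  have G: "continuous_on {0..1} G" unfolding G_def by (rule continuous_on_exp_profile[OF g lim])
  have Gg: "G (exp (- t)) = g t" for t by (simp add: G_def)
  note I = radial_integral[where \<alpha> = \<alpha> and \<mu> = \<mu> and G = G, OF \<alpha> G]
  show "integrable lborel (\<lambda>x. laguerre_weight \<alpha> \<mu> x * g ((norm x)\<^sup>2))"
    using I(1) by (simp only: Gg)
  show "integrable lborel (\<lambda>r. radial_weight (radial_order \<alpha>) (l1 \<mu>) r * g (r\<^sup>2))"
    using I(2) by (simp only: Gg)
  show "(LINT x|lborel. laguerre_weight \<alpha> \<mu> x * g ((norm x)\<^sup>2)) =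
      (\<Prod>j\<in>UNIV. Gamma (\<alpha> $ j + real (\<mu> $ j) + 1) / (2 * fact (\<mu> $ j))) / radial_mass \<alpha> (l1 \<mu>) *
      (LINT r|lborel. radial_weight (radial_order \<alpha>) (l1 \<mu>) r * g (r\<^sup>2))"
    using I(3) unfolding Gg .
qed

lemma laguerre_0: "laguerre a 0 x = 1"
proof -
  have "(\<lambda>n. laguerre a n x * 0 ^ n) sums 1"
    using laguerre_generating_function[of 0 a x] by simp
  then show ?thesis by (simp only: powser_sums_zero_iff)
qed

definition large_set :: "real ^ 'n \<Rightarrow> real \<Rightarrow> real \<Rightarrow> nat \<Rightarrow> (real ^ 'n) set" where
  "large_set \<alpha> \<delta> \<Gamma> n = {x \<in> pos_orthant. norm x \<le> 4 \<and>
     \<delta> * (\<Gamma> / laguerre_freq (radial_order \<alpha>) n) \<le> (radial_eigenfun \<alpha> n x)\<^sup>2}"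

text \<open>Mean square against supremum: on the shell 1 \<le> |x| \<le> 4 the squared eigenfunction
  is at most a constant times y = \<Gamma> / E, while its integral there is at least another
  constant times y. Values below \<delta> y carry at most half of this integral, so the larger ones
  occupy a set of measure bounded below.\<close>

lemma eigenfun_large_set:
  fixes \<alpha> :: "real ^ 'n" and \<Gamma> :: "nat \<Rightarrow> real"
  assumes \<alpha>: "\<forall>j. \<alpha> $ j \<ge> -1/2" and A0: "radial_order \<alpha> \<ge> 0"
    and bounds: "\<And>n. n \<ge> N \<Longrightarrow> laguerre_energy_bounds (radial_order \<alpha>) n (\<Gamma> n)"
  shows "\<exists>c>0. \<exists>\<delta>>0. \<forall>n\<ge>N. large_set \<alpha> \<delta> (\<Gamma> n) n \<in> sets lborel \<and>
    ennreal c \<le> emeasure lborel (large_set \<alpha> \<delta> (\<Gamma> n) n)"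
proof -
  define E where "E = laguerre_freq (radial_order \<alpha>)"
  note E = laguerre_energy_boundsD(1)[OF bounds, folded E_def]
    and \<Gamma> = laguerre_energy_boundsD(2)[OF bounds]
    and upper = laguerre_energy_boundsD(3)[OF bounds, folded E_def]
    and mass = laguerre_energy_boundsD(4)[OF bounds, folded E_def]
    and cont = laguerre_energy_boundsD(5)[OF bounds]
  define A where "A = radial_order \<alpha>"
  have \<alpha>1: "\<forall>j. \<alpha> $ j > -1" using \<alpha> by (smt (verit) field_sum_of_halves)
  have A1: "A > -1" unfolding A_def by (rule radial_order_gt[OF \<alpha>1])
  \<comment> \<open>With \<mu> = 0 the Laguerre factors of the weight are 1. The polynomial goes
    into the radial profile g instead, so that weight times g becomes the squared
    eigenfunction.\<close>
  define \<mu> where "(\<mu> :: nat ^ 'n) = (\<chi> j. 0)"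
  have \<mu>0: "\<mu> $ j = 0" for j :: 'n by (simp add: \<mu>_def)
  have l\<mu>: "l1 \<mu> = 0" by (simp add: l1_def \<mu>0)
  define \<kappa> where "\<kappa> = (\<Prod>j\<in>UNIV. Gamma (\<alpha> $ j + 0 + 1) / (2 * fact 0)) / radial_mass \<alpha> 0"
  have \<kappa>0: "\<kappa> > 0"
  proof -
    have "Gamma (\<alpha> $ j + 0 + 1) > 0" for j using \<alpha>1 by (intro Gamma_real_pos) (smt (verit))
    then show ?thesis unfolding \<kappa>_def by (intro divide_pos_pos prod_pos radial_mass_pos[OF \<alpha>1]) auto
  qed
  define V where "V = measure lborel (cball (0 :: real ^ 'n) 4)"
  have V0: "V > 0" unfolding V_def by (rule content_cball_pos) simp
  define U where "U = (\<Prod>j\<in>UNIV. (4::real) powr (2 * \<alpha> $ j + 1)) * (2 * exp 1)"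
  have U0: "U > 0" unfolding U_def by (intro mult_pos_pos prod_pos) auto
  \<comment> \<open>\<delta> lets the small values account for half of the lower bound \<kappa> / (8
    e); the other half, divided by U, is c.\<close>
  define \<delta> where "\<delta> = \<kappa> / (16 * exp 1 * V)"
  define c where "c = \<kappa> / (16 * exp 1 * U)"
  have \<delta>0: "\<delta> > 0" and c0: "c > 0" using \<kappa>0 V0 U0 by (simp_all add: \<delta>_def c_def)
  have cball_fin: "emeasure lborel (cball (0 :: real ^ 'n) 4) < top"
    using emeasure_lborel_cball_finite[of "0 :: real ^ 'n" 4] by simp
  define S where "S = (\<lambda>n. large_set \<alpha> \<delta> (\<Gamma> n) n)"
  have S_def': "S n = {x \<in> pos_orthant. norm x \<le> 4 \<and> \<delta> * (\<Gamma> n / E n) \<le> (radial_eigenfun \<alpha> n x)\<^sup>2}" for n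
    by (simp add: S_def large_set_def E_def)
  have \<Phi>m: "radial_eigenfun \<alpha> n \<in> borel_measurable borel" for n
  proof -
    have "(\<lambda>x :: real ^ 'n. x $ j) \<in> borel_measurable borel" for j
      by (intro borel_measurable_continuous_onI continuous_intros)
    moreover have "(\<lambda>x :: real ^ 'n. laguerre A n ((norm x)\<^sup>2)) \<in> borel_measurable borel"
      by (intro borel_measurable_continuous_onI continuous_on_compose2[OF continuous_on_laguerre[OF A1]] continuous_intros) auto
    ultimately show ?thesis unfolding radial_eigenfun_def[abs_def] A_def[symmetric] by measurable
  qed
  have Sm: "S n \<in> sets borel" for n
  proof -
    have "S n = pos_orthant \<inter> {x \<in> space borel. norm x \<le> 4 \<and> \<delta> * (\<Gamma> n / E n) \<le> (radial_eigenfun \<alpha> n x)\<^sup>2}"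
      by (auto simp: S_def')
    also have "\<dots> \<in> sets borel"
      by (intro sets.Int pos_orthant_sets) (use \<Phi>m in measurable)
    finally show ?thesis .
  qed
  have fin: "emeasure lborel (S n) < \<infinity>" for n
  proof -
    have "emeasure lborel (S n) \<le> emeasure lborel (cball (0 :: real ^ 'n) 4)"
      by (rule emeasure_mono) (auto simp: S_def')
    also have "\<dots> < \<infinity>" by (rule emeasure_lborel_cball_finite)
    finally show ?thesis .
  qed
  have main: "c \<le> measure lborel (S n)" if n: "n \<ge> N" for n
  proof -
    \<comment> \<open>In s = |x|^2 the cutoff lives on 1 \<le> |x| \<le> 4 and equals 1 for 2 \<le>
      |x| \<le> 3.\<close>
    define g where "g = (\<lambda>s. trapezoid 1 16 s * (laguerre A n s)\<^sup>2 * exp (- s / 2))"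
    have g: "continuous_on {0..} g"
      unfolding g_def
      by (rule continuous_on_mult[OF continuous_on_mult[OF continuous_trapezoid continuous_on_power[OF continuous_on_laguerre[OF A1]]]])
         (intro continuous_intros; simp)
    have lim: "(g \<longlongrightarrow> 0) at_top"
      by (rule tendsto_eventually, rule eventually_mono[OF eventually_ge_at_top[of 16]])
         (simp add: g_def trapezoid_eq_0)
    note I = radial_integral_profile[OF \<alpha>1 g lim, of \<mu>, unfolded l\<mu> \<mu>0, folded A_def]
    define W where "W = (\<lambda>x. laguerre_weight \<alpha> \<mu> x * g ((norm x)\<^sup>2))"
    have W: "W x = indicator pos_orthant x * ((radial_eigenfun \<alpha> n x)\<^sup>2 * trapezoid 1 16 ((norm x)\<^sup>2))" for x
    proof (cases "x \<in> pos_orthant")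
      case True
      then have "indicator {0<..} (x $ j) = (1::real)" for j by (simp add: pos_orthant_def)
      moreover have "x $ j powr (2 * \<alpha> $ j + 1) = (x $ j powr (\<alpha> $ j + 1/2))\<^sup>2" for j
        by (simp add: powr_add[symmetric] power2_eq_square)
      moreover have "(\<Prod>j\<in>UNIV. exp (- (x $ j)\<^sup>2 / 2)) = exp (- (norm x)\<^sup>2 / 2)"
        unfolding norm_vec_sq exp_sum[OF finite, symmetric] by (simp add: sum_negf sum_divide_distrib)
      ultimately have lw: "laguerre_weight \<alpha> \<mu> x = (\<Prod>j\<in>UNIV. x $ j powr (\<alpha> $ j + 1/2))\<^sup>2 * exp (- (norm x)\<^sup>2 / 2)"
        unfolding laguerre_weight_def \<mu>0 laguerre_0 by (simp add: prod.distrib prod_power_distrib)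
      have "P\<^sup>2 * e * (t * L\<^sup>2 * e) = 1 * ((P * L * e)\<^sup>2 * t)" for P L e t :: real
        by (simp add: power2_eq_square mult_ac)
      then show ?thesis unfolding W_def lw g_def radial_eigenfun_def A_def[symmetric] using True
        by (simp only: indicator_simps)
    next
      case False
      then show ?thesis by (simp add: W_def laguerre_weight_outside)
    qed
    have E0: "E n > 0" using E[OF n] by linarith
    have sE: "sqrt (E n) / 2 \<ge> 4" using E[OF n] by (simp add: real_le_rsqrt)
    define y where "y = \<Gamma> n / E n"
    have y0: "y > 0" using \<Gamma>[OF n] E0 by (simp add: y_def)
    have rw: "radial_weight A 0 r * g (r\<^sup>2) = indicator {0<..} r * (trapezoid 1 16 (r\<^sup>2) * (laguerre_profile A n r)\<^sup>2)" for r
    proof (cases "r > 0")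
      case True
      have "r powr (2 * A + 1) = (r powr (A + 1/2))\<^sup>2"
        by (simp add: powr_add[symmetric] power2_eq_square)
      moreover have "1 * (P\<^sup>2 * 1 * e) * (t * L\<^sup>2 * e) = 1 * (t * (P * (L * e))\<^sup>2)" for P L e t :: real
        by (simp add: power2_eq_square mult_ac)
      ultimately show ?thesis using True unfolding radial_weight_def g_def laguerre_profile_def laguerre_0
        by (simp only: indicator_simps greaterThan_iff)
    qed (simp add: radial_weight_def)
    have "1 * integral {2..3} (\<lambda>r. (laguerre_profile A n r)\<^sup>2) \<le> (LINT r|lborel. radial_weight A 0 r * g (r\<^sup>2))"
    proof (rule integral_ge_on_interval[OF I(2)])
      show "0 \<le> radial_weight A 0 r * g (r\<^sup>2)" for r
        unfolding rw by (simp add: trapezoid_bounds)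
      show "continuous_on {2..3} (\<lambda>r. (laguerre_profile A n r)\<^sup>2)"
        using cont[OF n, of 2 3] by (auto simp: A_def intro!: continuous_intros)
      fix r :: real assume r: "r \<in> {2..3}"
      then have "2\<^sup>2 \<le> r\<^sup>2" "r\<^sup>2 \<le> 3\<^sup>2" using power_mono[of 2 r 2] power_mono[of r 3 2] by auto
      then have "trapezoid 1 16 (r\<^sup>2) = 1" by (intro trapezoid_eq_1) auto
      then show "1 * (laguerre_profile A n r)\<^sup>2 \<le> radial_weight A 0 r * g (r\<^sup>2)"
        unfolding rw using r by (simp only: indicator_simps) simp
    qed
    moreover have "y / (8 * exp 1) \<le> integral {2..3} (\<lambda>r. (laguerre_profile A n r)\<^sup>2)"
    proof -
      have "y / (8 * exp 1) = (3 - 2) * \<Gamma> n / (8 * exp 1 * E n)" by (simp add: y_def)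
      also have "\<dots> \<le> integral {2..3} (\<lambda>r. (laguerre_profile A n r)\<^sup>2)"
        unfolding A_def by (rule mass[OF n]) (use sE in linarith)+
      finally show ?thesis .
    qed
    ultimately have "\<kappa> * (y / (8 * exp 1)) \<le> \<kappa> * (LINT r|lborel. radial_weight A 0 r * g (r\<^sup>2))"
      using \<kappa>0 by (intro mult_left_mono) auto
    also have "\<dots> = integral\<^sup>L lborel W"
      unfolding W_def using I(3) by (simp add: \<kappa>_def)
    also have "\<dots> \<le> (LINT x|lborel. U * y * indicator (S n) x + \<delta> * y * indicator (cball 0 4) x)"
    proof (rule integral_mono)
      show "integrable lborel W" unfolding W_def by (rule I(1))
      show "integrable lborel (\<lambda>x. U * y * indicator (S n) x + \<delta> * y * indicator (cball 0 4) x)"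
        using Sm fin by (intro Bochner_Integration.integrable_add integrable_mult_right integrable_real_indicator)
          (auto simp: cball_fin)
      fix x
      have nn: "0 \<le> U * y * indicator (S n) x" "0 \<le> \<delta> * y * indicator (cball 0 4) x"
        using U0 y0 \<delta>0 by (simp_all add: indicator_def)
      show "W x \<le> U * y * indicator (S n) x + \<delta> * y * indicator (cball 0 4) x"
      proof (cases "x \<in> pos_orthant \<and> 1 \<le> norm x \<and> norm x \<le> 4")
        case False
        have "W x = 0"
        proof (cases "x \<in> pos_orthant")
          case True
          with False have "(norm x)\<^sup>2 \<le> 1\<^sup>2 \<or> 4\<^sup>2 \<le> (norm x)\<^sup>2"
            using power_mono[of "norm x" 1 2] power_mono[of 4 "norm x" 2] by auto
          then show ?thesis unfolding W by (simp add: trapezoid_eq_0)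
        qed (simp add: W)
        then show ?thesis using nn by linarith
      next
        case True
        have W1: "W x \<le> (radial_eigenfun \<alpha> n x)\<^sup>2"
          using True unfolding W by (simp add: trapezoid_bounds mult_left_le)
        show ?thesis
        proof (cases "x \<in> S n")
          case True': True
          have pr: "(\<Prod>j\<in>UNIV. x $ j powr (\<alpha> $ j + 1/2))\<^sup>2 \<le> (\<Prod>j\<in>UNIV. (4::real) powr (2 * \<alpha> $ j + 1))"
          proof -
            have "(\<Prod>j\<in>UNIV. x $ j powr (\<alpha> $ j + 1/2))\<^sup>2 = (\<Prod>j\<in>UNIV. x $ j powr (2 * \<alpha> $ j + 1))"
              unfolding prod_power_distrib by (simp add: powr_add[symmetric] power2_eq_square)
            also have "\<dots> \<le> (\<Prod>j\<in>UNIV. (4::real) powr (2 * \<alpha> $ j + 1))"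
            proof (intro prod_mono conjI powr_mono2)
              fix j
              have "\<alpha> $ j \<ge> -1/2" using \<alpha> by blast
              then show "0 \<le> 2 * \<alpha> $ j + 1" by linarith
              show "0 \<le> x $ j" using True by (auto simp: pos_orthant_def less_imp_le)
              show "x $ j \<le> 4" using True component_le_norm_cart[of x j] by linarith
            qed auto
            finally show ?thesis .
          qed
          define v where "v = laguerre A n ((norm x)\<^sup>2) * exp (- (norm x)\<^sup>2 / 2)"
          have "1 \<le> norm x powr (A + 1/2)"
            using A0 True by (intro ge_one_powr_ge_zero) (auto simp: A_def)
          then have "1\<^sup>2 \<le> (norm x powr (A + 1/2))\<^sup>2" by (intro power_mono) auto
          then have "1\<^sup>2 * v\<^sup>2 \<le> (norm x powr (A + 1/2))\<^sup>2 * v\<^sup>2" by (rule mult_right_mono) simp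
          then have "v\<^sup>2 \<le> (laguerre_profile A n (norm x))\<^sup>2"
            unfolding laguerre_profile_def v_def[symmetric] power_mult_distrib by simp
          also have "\<dots> \<le> 2 * exp 1 * y"
          proof -
            have "E n * (laguerre_profile A n (norm x))\<^sup>2 \<le> 2 * exp 1 * \<Gamma> n"
              unfolding A_def by (rule upper[OF n]) (use True sE in linarith)+
            then show ?thesis using E0 by (simp add: y_def pos_le_divide_eq mult.commute)
          qed
          finally have v: "v\<^sup>2 \<le> 2 * exp 1 * y" .
          have "(radial_eigenfun \<alpha> n x)\<^sup>2 = (\<Prod>j\<in>UNIV. x $ j powr (\<alpha> $ j + 1/2))\<^sup>2 * v\<^sup>2"
            unfolding radial_eigenfun_def A_def[symmetric] mult.assoc v_def[symmetric] by (rule power_mult_distrib)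
          also have "\<dots> \<le> (\<Prod>j\<in>UNIV. (4::real) powr (2 * \<alpha> $ j + 1)) * (2 * exp 1 * y)"
            by (rule mult_mono[OF pr v]) (simp_all add: prod_nonneg)
          also have "\<dots> = U * y" by (simp add: U_def)
          finally have "(radial_eigenfun \<alpha> n x)\<^sup>2 \<le> U * y" .
          then show ?thesis using True' W1 nn by simp
        next
          case False
          then have "(radial_eigenfun \<alpha> n x)\<^sup>2 \<le> \<delta> * y"
            using True by (auto simp: S_def' y_def)
          then show ?thesis using True W1 nn False by simp
        qed
      qed
    qed
    also have "\<dots> = U * y * measure lborel (S n) + \<delta> * y * V"
      using Sm fin by (subst Bochner_Integration.integral_add)
        (auto simp: V_def cball_fin intro!: integrable_mult_right integrable_real_indicator)
    finally have "\<kappa> / (8 * exp 1) * y \<le> (U * measure lborel (S n) + \<delta> * V) * y"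
      by (simp add: algebra_simps)
    then have 8: "\<kappa> / (8 * exp 1) \<le> U * measure lborel (S n) + \<delta> * V"
      using y0 by (rule mult_right_le_imp_le)
    have "\<delta> * V = \<kappa> / (16 * exp 1)" "\<kappa> / (8 * exp 1) = \<kappa> / (16 * exp 1) + \<kappa> / (16 * exp 1)"
      using V0 by (simp_all add: \<delta>_def)
    with 8 have "\<kappa> / (16 * exp 1) \<le> measure lborel (S n) * U"
      unfolding mult.commute[of _ U] by linarith
    then have "\<kappa> / (16 * exp 1) / U \<le> measure lborel (S n)"
      unfolding pos_divide_le_eq[OF U0] .
    then show ?thesis by (simp add: c_def)
  qed
  have "ennreal c \<le> emeasure lborel (S n)" if n: "n \<ge> N" for n
  proof -
    have "ennreal c \<le> ennreal (measure lborel (S n))" using main[OF n] by (rule ennreal_leI)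
    also have "\<dots> = emeasure lborel (S n)" using fin[of n] by (intro emeasure_eq_ennreal_measure[symmetric]) auto
    finally show ?thesis .
  qed
  moreover have "S n \<in> sets lborel" for n using Sm[of n] by simp
  ultimately show ?thesis using c0 \<delta>0 unfolding S_def by blast
qed

section \<open>Unbounded radial functionals\<close>

text \<open>Otherwise the closed sets \<open>C m\<close> cover a complete space, so by Baire one of
  them contains a ball of radius e; differences of its points then bound every \<open>T n\<close> on
  the unit ball by 4 m / e.\<close>

lemma unbounded_functionals_at_point:
  fixes T :: "nat \<Rightarrow> 'a::{real_normed_vector, complete_space} \<Rightarrow> real"
  assumes lin: "\<And>n. bounded_linear (T n)"
    and unb: "\<And>K. \<exists>n x. norm x \<le> 1 \<and> \<bar>T n x\<bar> > K"
  shows "\<exists>x. \<forall>K. \<exists>n. \<bar>T n x\<bar> > K"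
proof (rule ccontr)
  assume "\<not> ?thesis"
  then have bdd: "\<exists>K. \<forall>n. \<bar>T n x\<bar> \<le> K" for x by (metis not_le)
  define C where "C = (\<lambda>m::nat. {x. \<forall>n. \<bar>T n x\<bar> \<le> real m})"
  have closed: "closed (C m)" for m
  proof -
    have "C m = (\<Inter>n. {x. \<bar>T n x\<bar> \<le> real m})" by (auto simp: C_def)
    also have "closed \<dots>"
      by (intro closed_INT ballI closed_Collect_le continuous_intros linear_continuous_on lin)
    finally show ?thesis .
  qed
  have "(\<Union>m. C m) = UNIV"
  proof (intro equalityI subsetI)
    fix x :: 'a
    obtain K where "\<And>n. \<bar>T n x\<bar> \<le> K" using bdd by blast
    moreover obtain m :: nat where "K \<le> real m" using real_arch_simple by blast
    ultimately have "x \<in> C m" unfolding C_def using order_trans by blast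
    then show "x \<in> (\<Union>m. C m)" by blast
  qed simp
  then have "interior (\<Union>(range C)) \<noteq> {}" by simp
  moreover have "interior (\<Union>(range C)) = {}" if "\<And>m. interior (C m) = {}"
    using Baire_category_alt[of "euclidean :: 'a topology" "range C"] that closed
    by (auto simp: completely_metrizable_space_euclidean)
  ultimately obtain m where "interior (C m) \<noteq> {}" by blast
  then obtain x0 e where e: "e > 0" "ball x0 e \<subseteq> C m"
    by (metis equals0I mem_interior)
  obtain n x where x: "norm x \<le> 1" "\<bar>T n x\<bar> > 4 * real m / e" using unb by blast
  interpret bounded_linear "T n" by (rule lin)
  have "x0 \<in> C m" "x0 + (e / 2) *\<^sub>R x \<in> C m"
    using e x by (auto intro!: subsetD[OF e(2)] simp: dist_norm)
  then have "\<bar>T n x0\<bar> \<le> real m" "\<bar>T n (x0 + (e / 2) *\<^sub>R x)\<bar> \<le> real m"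
    by (auto simp: C_def)
  then have "\<bar>T n x0\<bar> \<le> real m" "\<bar>T n x0 + e / 2 * T n x\<bar> \<le> real m"
    by (simp_all add: add scale)
  then have "\<bar>e / 2 * T n x\<bar> \<le> 2 * real m" by linarith
  then show False using e x by (simp add: abs_mult field_simps)
qed

text \<open>Divided by \<open>radial_mass\<close> this is the coefficient of
  \<open>test_fun\<close>. The decay is split off so that h ranges over all bounded continuous
  functions, a Banach space in the supremum norm to which Baire's theorem applies.\<close>

definition radial_functional :: "real \<Rightarrow> real \<Rightarrow> nat \<Rightarrow> (real \<Rightarrow>\<^sub>C real) \<Rightarrow> real" where
  "radial_functional A \<gamma> n h =
     (LINT r|lborel. radial_weight A n r * ((1 + r\<^sup>2) powr (- \<gamma>) * apply_bcontfun h (r\<^sup>2)))"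

lemma integrable_radial_weight: "A > -1 \<Longrightarrow> integrable lborel (radial_weight A n)"
  using has_bochner_integral_laguerre_Gaussian[of A "1/2" n]
  by (simp add: has_bochner_integral_iff radial_weight_def[abs_def])

lemma bcontfun_measurable: "apply_bcontfun (h :: real \<Rightarrow>\<^sub>C real) \<in> borel_measurable borel"
  using apply_bcontfun[of h] by (auto simp: bcontfun_def intro: borel_measurable_continuous_onI)

lemma powr_neg_le_1: "\<gamma> \<ge> 0 \<Longrightarrow> (1 + (r::real)\<^sup>2) powr (- \<gamma>) \<le> 1"
  using powr_mono2'[of "- \<gamma>" 1 "1 + r\<^sup>2"] by simp

lemma integrable_radial_functional:
  assumes A: "A > -1" and \<gamma>: "\<gamma> \<ge> 0"
  shows "integrable lborel (\<lambda>r. radial_weight A n r * ((1 + r\<^sup>2) powr (- \<gamma>) * apply_bcontfun h (r\<^sup>2)))"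
proof (rule Bochner_Integration.integrable_bound)
  show "integrable lborel (\<lambda>r. norm h * radial_weight A n r)"
    by (intro integrable_mult_right integrable_radial_weight A)
  have "(\<lambda>r. apply_bcontfun h (r\<^sup>2)) \<in> borel_measurable borel"
    by (rule measurable_compose[OF _ bcontfun_measurable]) measurable
  then show "(\<lambda>r. radial_weight A n r * ((1 + r\<^sup>2) powr (- \<gamma>) * apply_bcontfun h (r\<^sup>2))) \<in> borel_measurable lborel"
    using borel_measurable_integrable[OF integrable_radial_weight[OF A, of n]] by simp
  show "AE r in lborel. norm (radial_weight A n r * ((1 + r\<^sup>2) powr (- \<gamma>) * apply_bcontfun h (r\<^sup>2))) \<le> norm (norm h * radial_weight A n r)"
  proof (rule AE_I2)
    fix r :: real
    have "(1 + r\<^sup>2) powr (- \<gamma>) * \<bar>apply_bcontfun h (r\<^sup>2)\<bar> \<le> 1 * norm h"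
      using norm_bounded[of h "r\<^sup>2"] by (intro mult_mono powr_neg_le_1 \<gamma>) auto
    then show "norm (radial_weight A n r * ((1 + r\<^sup>2) powr (- \<gamma>) * apply_bcontfun h (r\<^sup>2))) \<le> norm (norm h * radial_weight A n r)"
      by (simp add: abs_mult mult.commute[of "norm h"] mult_left_mono)
  qed
qed

lemma bounded_linear_radial_functional:
  assumes A: "A > -1" and \<gamma>: "\<gamma> \<ge> 0"
  shows "bounded_linear (radial_functional A \<gamma> n)"
proof (rule bounded_linear_intro)
  note int = integrable_radial_functional[OF A \<gamma>, of n]
  show "radial_functional A \<gamma> n (h + k) = radial_functional A \<gamma> n h + radial_functional A \<gamma> n k" for h k
    unfolding radial_functional_def Bochner_Integration.integral_add[OF int int, symmetric]
    by (simp add: plus_bcontfun.rep_eq algebra_simps)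
  show "radial_functional A \<gamma> n (c *\<^sub>R h) = c *\<^sub>R radial_functional A \<gamma> n h" for c h
    unfolding radial_functional_def real_scaleR_def integral_mult_right_zero[symmetric]
    by (simp add: scaleR_bcontfun.rep_eq mult_ac)
  show "norm (radial_functional A \<gamma> n h) \<le> norm h * (LINT r|lborel. \<bar>radial_weight A n r\<bar>)" for h
  proof -
    have "\<bar>radial_functional A \<gamma> n h\<bar> \<le> (LINT r|lborel. \<bar>radial_weight A n r * ((1 + r\<^sup>2) powr (- \<gamma>) * apply_bcontfun h (r\<^sup>2))\<bar>)"
      unfolding radial_functional_def by (rule integral_abs_bound)
    also have "\<dots> \<le> (LINT r|lborel. norm h * \<bar>radial_weight A n r\<bar>)"
    proof (rule integral_mono)
      fix r :: real
      have "(1 + r\<^sup>2) powr (- \<gamma>) * \<bar>apply_bcontfun h (r\<^sup>2)\<bar> \<le> 1 * norm h"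
        using norm_bounded[of h "r\<^sup>2"] by (intro mult_mono powr_neg_le_1 \<gamma>) auto
      then show "\<bar>radial_weight A n r * ((1 + r\<^sup>2) powr (- \<gamma>) * apply_bcontfun h (r\<^sup>2))\<bar> \<le> norm h * \<bar>radial_weight A n r\<bar>"
        by (simp add: abs_mult mult.commute[of "norm h"] mult_left_mono)
    qed (use int[of h] integrable_radial_weight[OF A, of n] in auto)
    finally show ?thesis by simp
  qed
qed

text \<open>The functional is tested on the eigenfunction itself, cut off to radii comparable to
  \<sigma> = sqrt E. There the profile is at most S, of order sqrt \<Gamma> / \<sigma>, and its
  square has mass of order \<Gamma> / \<sigma>. The pairing is of the order of their quotient sqrt
  \<Gamma>, times \<sigma>^(A + 1/2) from the normalization and E^(- \<gamma>) from the
  weight.\<close>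

lemma radial_functional_lower:
  fixes A :: real and n :: nat and \<Gamma> :: real
  defines "E \<equiv> laguerre_freq A n"
  assumes A: "A \<ge> 0" and \<gamma>: "\<gamma> \<ge> 0" and bounds: "laguerre_energy_bounds A n \<Gamma>"
  shows "\<exists>h. norm h \<le> 1 \<and>
    (1/4) powr (A + 1/2) / (80 * exp 1 * sqrt (2 * exp 1)) * E powr (A / 2 + 1/4 - \<gamma>) * sqrt \<Gamma> \<le> radial_functional A \<gamma> n h"
proof -
  note E = laguerre_energy_boundsD(1)[OF bounds, folded E_def]
    and \<Gamma> = laguerre_energy_boundsD(2)[OF bounds]
    and upper = laguerre_energy_boundsD(3)[OF bounds, folded E_def]
    and mass = laguerre_energy_boundsD(4)[OF bounds, folded E_def]
    and cont = laguerre_energy_boundsD(5)[OF bounds]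
  have A1: "A > -1" using A by simp
  define \<sigma> where "\<sigma> = sqrt E"
  have \<sigma>: "\<sigma> > 0" "\<sigma>\<^sup>2 = E" "\<sigma> \<ge> 40"
    using E by (auto simp: \<sigma>_def intro!: real_le_rsqrt)
  define S where "S = sqrt (2 * exp 1) * sqrt \<Gamma> / \<sigma>"
  have S0: "S > 0" using \<sigma> \<Gamma> by (simp add: S_def)
  \<comment> \<open>Normalizes h to |h| \<le> 1: |v| is r^(- A - 1/2) times the absolute value of
    the profile, with r \<ge> \<sigma> / 4 on the support of the cutoff.\<close>
  define k where "k = (\<sigma> / 4) powr (A + 1/2) / S"
  have k0: "k > 0" using S0 \<sigma> by (simp add: k_def)
  define tz where "tz = trapezoid (E / 16) (E / 4)"
  define v where "v = (\<lambda>s. laguerre A n s * exp (- s / 2))"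
  define h where "h = (\<lambda>s. tz s * v s * k)"
  have h1: "\<bar>h s\<bar> \<le> 1" for s
  proof (cases "E / 16 \<le> s \<and> s \<le> E / 4")
    case False
    then show ?thesis by (auto simp: h_def tz_def trapezoid_eq_0)
  next
    case True
    define r where "r = sqrt s"
    have s: "s = r\<^sup>2" "s > 0" using True E by (simp_all add: r_def)
    have "\<sigma> / 4 = sqrt (E / 16)" by (simp add: \<sigma>_def real_sqrt_divide)
    also have "\<dots> \<le> r" unfolding r_def using True by simp
    finally have r1: "\<sigma> / 4 \<le> r" .
    have "r \<le> sqrt (E / 4)" unfolding r_def using True by simp
    also have "\<dots> = \<sigma> / 2" by (simp add: \<sigma>_def real_sqrt_divide)
    finally have r2: "r \<le> \<sigma> / 2" .
    have "E * (laguerre_profile A n r)\<^sup>2 \<le> 2 * exp 1 * \<Gamma>"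
      by (rule upper) (use r1 r2 \<sigma> in \<open>auto simp: \<sigma>_def\<close>)
    then have "(laguerre_profile A n r)\<^sup>2 \<le> 2 * exp 1 * \<Gamma> / E"
      using E by (simp add: pos_le_divide_eq mult.commute)
    also have "\<dots> = S\<^sup>2" using \<Gamma> by (simp add: S_def power_divide power_mult_distrib \<sigma>)
    finally have "\<bar>laguerre_profile A n r\<bar> \<le> S"
      using S0 by (simp add: abs_le_square_iff[symmetric])
    then have "r powr (A + 1/2) * \<bar>v s\<bar> \<le> S"
      unfolding laguerre_profile_def s(1) v_def by (simp add: abs_mult)
    moreover have "(\<sigma> / 4) powr (A + 1/2) * \<bar>v s\<bar> \<le> r powr (A + 1/2) * \<bar>v s\<bar>"
      using r1 \<sigma> A by (intro mult_right_mono powr_mono2) auto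
    ultimately have "\<bar>v s\<bar> * k \<le> 1"
      unfolding k_def using S0 by (simp add: field_simps)
    moreover have "tz s * (\<bar>v s\<bar> * k) \<le> 1 * (\<bar>v s\<bar> * k)"
      unfolding tz_def using trapezoid_bounds k0 by (intro mult_right_mono) auto
    moreover have "\<bar>h s\<bar> = tz s * (\<bar>v s\<bar> * k)"
      using k0 trapezoid_bounds(1)[of "E / 16" "E / 4" s] by (simp add: h_def tz_def abs_mult)
    ultimately show ?thesis by linarith
  qed
  have h_cont: "continuous_on UNIV h"
  proof -
    have "continuous_on UNIV (\<lambda>s::real. exp (- s / 2))" by (intro continuous_intros) simp
    then show ?thesis unfolding h_def tz_def v_def
      by (intro continuous_on_mult continuous_trapezoid continuous_on_laguerre A1 continuous_on_const)
  qed
  have h_bcont: "h \<in> bcontfun"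
    using h_cont h1 unfolding bcontfun_def by (auto intro!: boundedI[of _ 1])
  have happ: "apply_bcontfun (Bcontfun h) = h" by (rule Bcontfun_inverse[OF h_bcont])
  have F: "radial_weight A n r * ((1 + r\<^sup>2) powr (- \<gamma>) * h (r\<^sup>2)) =
      indicator {0<..} r * ((laguerre_profile A n r)\<^sup>2 * ((1 + r\<^sup>2) powr (- \<gamma>) * (tz (r\<^sup>2) * k)))" for r
  proof (cases "r > 0")
    case True
    have e: "r powr (2 * A + 1) = (r powr (A + 1/2))\<^sup>2"
      by (simp add: powr_add[symmetric] power2_eq_square)
    have "radial_weight A n r = (r powr (A + 1/2))\<^sup>2 * v (r\<^sup>2)"
      using True unfolding radial_weight_def v_def e by simp
    moreover have "laguerre_profile A n r = r powr (A + 1/2) * v (r\<^sup>2)"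
      unfolding laguerre_profile_def v_def ..
    ultimately show ?thesis using True unfolding h_def by (simp add: power2_eq_square mult_ac)
  qed (simp add: radial_weight_def)
  \<comment> \<open>This interval keeps r^2 between 9 E / 100 and 16 E / 100, where the cutoff is 1,
    and has length \<sigma> / 10 \<ge> 4, enough for the mass bound.\<close>
  have "E powr (- \<gamma>) * k * integral {3 * \<sigma> / 10..4 * \<sigma> / 10} (\<lambda>r. (laguerre_profile A n r)\<^sup>2) \<le>
      (LINT r|lborel. radial_weight A n r * ((1 + r\<^sup>2) powr (- \<gamma>) * h (r\<^sup>2)))"
  proof (rule integral_ge_on_interval)
    show "integrable lborel (\<lambda>r. radial_weight A n r * ((1 + r\<^sup>2) powr (- \<gamma>) * h (r\<^sup>2)))"
      using integrable_radial_functional[OF A1 \<gamma>, of n "Bcontfun h"] by (simp add: happ)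
    show "0 \<le> radial_weight A n r * ((1 + r\<^sup>2) powr (- \<gamma>) * h (r\<^sup>2))" for r
      unfolding F using k0 by (simp add: tz_def trapezoid_bounds)
    show "continuous_on {3 * \<sigma> / 10..4 * \<sigma> / 10} (\<lambda>r. (laguerre_profile A n r)\<^sup>2)"
      by (intro continuous_on_power cont) (use \<sigma> in simp)
    fix r assume r: "r \<in> {3 * \<sigma> / 10..4 * \<sigma> / 10}"
    then have r0: "r > 0" using \<sigma> by auto
    have "(3 * \<sigma> / 10)\<^sup>2 \<le> r\<^sup>2" "r\<^sup>2 \<le> (4 * \<sigma> / 10)\<^sup>2"
      using r \<sigma> r0 by (auto intro!: power_mono)
    then have r2: "9 * E / 100 \<le> r\<^sup>2" "r\<^sup>2 \<le> 16 * E / 100"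
      by (simp_all add: power_divide power_mult_distrib \<sigma>)
    then have "tz (r\<^sup>2) = 1" unfolding tz_def by (intro trapezoid_eq_1) (use E in linarith)+
    moreover have "E powr (- \<gamma>) \<le> (1 + r\<^sup>2) powr (- \<gamma>)"
      using r2 E \<gamma> by (intro powr_mono2') (auto intro: add_pos_nonneg)
    then have "E powr (- \<gamma>) * (k * (laguerre_profile A n r)\<^sup>2) \<le> (1 + r\<^sup>2) powr (- \<gamma>) * (k * (laguerre_profile A n r)\<^sup>2)"
      using k0 by (intro mult_right_mono) auto
    ultimately show "E powr (- \<gamma>) * k * (laguerre_profile A n r)\<^sup>2 \<le> radial_weight A n r * ((1 + r\<^sup>2) powr (- \<gamma>) * h (r\<^sup>2))"
      unfolding F using r0 by (simp add: mult_ac)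
  qed
  also have "\<dots> = radial_functional A \<gamma> n (Bcontfun h)"
    unfolding radial_functional_def happ ..
  finally have 1: "E powr (- \<gamma>) * k * integral {3 * \<sigma> / 10..4 * \<sigma> / 10} (\<lambda>r. (laguerre_profile A n r)\<^sup>2) \<le> radial_functional A \<gamma> n (Bcontfun h)" .
  have "(4 * \<sigma> / 10 - 3 * \<sigma> / 10) * \<Gamma> / (8 * exp 1 * E) \<le> integral {3 * \<sigma> / 10..4 * \<sigma> / 10} (\<lambda>r. (laguerre_profile A n r)\<^sup>2)"
    by (rule mass) (use \<sigma> in \<open>auto simp: \<sigma>_def\<close>)
  then have 2: "E powr (- \<gamma>) * k * ((4 * \<sigma> / 10 - 3 * \<sigma> / 10) * \<Gamma> / (8 * exp 1 * E)) \<le> radial_functional A \<gamma> n (Bcontfun h)"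
    by (rule order_trans[OF mult_left_mono 1]) (use k0 in simp)
  have "(\<sigma> / 4) powr (A + 1/2) = (1/4) powr (A + 1/2) * E powr (A / 2 + 1/4)"
  proof -
    have "\<sigma> / 4 = 1/4 * \<sigma>" by simp
    moreover have "(1/4 * \<sigma>) powr (A + 1/2) = (1/4) powr (A + 1/2) * \<sigma> powr (A + 1/2)" by (rule powr_mult)
    moreover have "\<sigma> powr (A + 1/2) = E powr (1/2 * (A + 1/2))"
      unfolding \<sigma>_def using E by (subst powr_half_sqrt[symmetric]) (simp_all add: powr_powr)
    moreover have "1/2 * (A + 1/2) = A / 2 + 1/4" by simp
    ultimately show ?thesis by metis
  qed
  moreover have "E powr (A / 2 + 1/4 - \<gamma>) = E powr (A / 2 + 1/4) * E powr (- \<gamma>)"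
    by (simp add: powr_add[symmetric])
  moreover have "(4 * \<sigma> / 10 - 3 * \<sigma> / 10) * \<Gamma> / (8 * exp 1 * E) / S = sqrt \<Gamma> / (80 * exp 1 * sqrt (2 * exp 1))"
  proof -
    have "\<Gamma> = sqrt \<Gamma> * sqrt \<Gamma>" using \<Gamma> by simp
    then have "(4 * \<sigma> / 10 - 3 * \<sigma> / 10) * \<Gamma> / (8 * exp 1 * E) / S = (\<sigma> / 10) * (sqrt \<Gamma> * sqrt \<Gamma>) / (8 * exp 1 * (\<sigma> * \<sigma>)) / (sqrt (2 * exp 1) * sqrt \<Gamma> / \<sigma>)"
      unfolding S_def using \<sigma>(2) by (simp add: power2_eq_square)
    also have "\<dots> = sqrt \<Gamma> / (80 * exp 1 * sqrt (2 * exp 1))"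
      using \<sigma>(1) \<Gamma> by (simp add: divide_simps del: real_sqrt_mult_self)
    finally show ?thesis .
  qed
  moreover have "E powr (- \<gamma>) * k * ((4 * \<sigma> / 10 - 3 * \<sigma> / 10) * \<Gamma> / (8 * exp 1 * E)) =
      E powr (- \<gamma>) * (\<sigma> / 4) powr (A + 1/2) * ((4 * \<sigma> / 10 - 3 * \<sigma> / 10) * \<Gamma> / (8 * exp 1 * E) / S)"
    by (simp add: k_def)
  ultimately have "E powr (- \<gamma>) * k * ((4 * \<sigma> / 10 - 3 * \<sigma> / 10) * \<Gamma> / (8 * exp 1 * E)) =
      (1/4) powr (A + 1/2) / (80 * exp 1 * sqrt (2 * exp 1)) * E powr (A / 2 + 1/4 - \<gamma>) * sqrt \<Gamma>"
    by (simp only: times_divide_eq_right times_divide_eq_left mult_ac)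
  with 2 have "(1/4) powr (A + 1/2) / (80 * exp 1 * sqrt (2 * exp 1)) * E powr (A / 2 + 1/4 - \<gamma>) * sqrt \<Gamma> \<le> radial_functional A \<gamma> n (Bcontfun h)"
    by simp
  moreover have "norm (Bcontfun h) \<le> 1"
    by (rule norm_bound) (simp add: happ h1)
  ultimately show ?thesis by blast
qed

section \<open>The test functions\<close>

lemma integrable_Japanese_bracket:
  fixes s :: real
  assumes s: "s > 1/2"
  shows "integrable lborel (\<lambda>y::real. indicator {0<..} y * (1 + y\<^sup>2) powr (- s))"
proof (rule Bochner_Integration.integrable_bound)
  have "((\<lambda>y. y powr (- 2 * s)) has_integral - (1 powr (- 2 * s + 1)) / (- 2 * s + 1)) {1..}"
    by (rule has_integral_powr_to_inf) (use s in auto)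
  then have "(\<lambda>y. y powr (- 2 * s)) absolutely_integrable_on {1..}"
    by (auto intro!: nonnegative_absolutely_integrable_1)
  then have "integrable lebesgue (\<lambda>y. indicator {1..} y *\<^sub>R (y powr (- 2 * s)))"
    unfolding set_integrable_def .
  then have "integrable lborel (\<lambda>y. indicator {1..} y *\<^sub>R (y powr (- 2 * s)))"
    by (subst (asm) integrable_completion) auto
  moreover have "integrable lborel (\<lambda>y::real. indicator {0..1} y :: real)"
    by (rule integrable_real_indicator) auto
  ultimately show "integrable lborel (\<lambda>y. indicator {0..1} y + indicator {1..} y *\<^sub>R (y powr (- 2 * s)))"
    by (rule Bochner_Integration.integrable_add[rotated])
  show "(\<lambda>y::real. indicator {0<..} y * (1 + y\<^sup>2) powr (- s)) \<in> borel_measurable lborel" by measurable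
  show "AE y in lborel. norm (indicator {0<..} y * (1 + y\<^sup>2) powr (- s)) \<le>
      norm (indicator {0..1} y + indicator {1..} y *\<^sub>R (y powr (- 2 * s)))"
  proof (rule AE_I2)
    fix y :: real
    have "(1 + y\<^sup>2) powr (- s) \<le> y powr (- 2 * s)" if "y > 0"
    proof -
      have "(1 + y\<^sup>2) powr (- s) \<le> (y\<^sup>2) powr (- s)" using that s by (intro powr_mono2') auto
      also have "\<dots> = y powr (- 2 * s)" using that powr_powr[of y 2 "- s"] by simp
      finally show ?thesis .
    qed
    moreover have "(1 + y\<^sup>2) powr (- s) \<le> 1" using s by (intro powr_neg_le_1) auto
    ultimately show "norm (indicator {0<..} y * (1 + y\<^sup>2) powr (- s)) \<le>
      norm (indicator {0..1} y + indicator {1..} y *\<^sub>R (y powr (- 2 * s)))"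
      by (auto simp: indicator_def)
  qed
qed

definition test_fun :: "real ^ 'n \<Rightarrow> real \<Rightarrow> (real \<Rightarrow>\<^sub>C real) \<Rightarrow> real ^ 'n \<Rightarrow> real" where
  "test_fun \<alpha> \<gamma> h x = (\<Prod>j\<in>UNIV. x $ j powr (\<alpha> $ j + 1/2)) *
     ((1 + (norm x)\<^sup>2) powr (- \<gamma>) * apply_bcontfun h ((norm x)\<^sup>2))"

lemma test_fun_measurable:
  fixes \<alpha> :: "real ^ 'n"
  shows "test_fun \<alpha> \<gamma> h \<in> borel_measurable borel"
proof -
  have "(\<lambda>x :: real ^ 'n. x $ j) \<in> borel_measurable borel" for j
    by (intro borel_measurable_continuous_onI continuous_intros)
  moreover have "(\<lambda>x :: real ^ 'n. apply_bcontfun h ((norm x)\<^sup>2)) \<in> borel_measurable borel"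
    by (rule measurable_compose[OF _ bcontfun_measurable]) measurable
  ultimately show ?thesis unfolding test_fun_def[abs_def] by measurable
qed

text \<open>Since \<alpha>_j + 1/2 \<ge> 0, the monomial is at most |x|^(|\<alpha>|_1 + d/2), which
  the first part of the exponent compensates; \<beta> is the decay that remains.\<close>

lemma test_fun_bound:
  fixes \<alpha> :: "real ^ 'n"
  assumes \<alpha>: "\<forall>j. \<alpha> $ j \<ge> -1/2" and x: "x \<in> pos_orthant"
  shows "\<bar>test_fun \<alpha> ((l1 \<alpha> + real CARD('n) / 2) / 2 + \<beta>) h x\<bar> \<le> norm h * (1 + (norm x)\<^sup>2) powr (- \<beta>)"
proof -
  define \<kappa> where "\<kappa> = (l1 \<alpha> + real CARD('n) / 2) / 2"
  have \<alpha>': "\<alpha> $ j + 1/2 \<ge> 0" for j using \<alpha>[rule_format, of j] by linarith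
  have s: "(\<Sum>j\<in>UNIV. \<alpha> $ j + 1/2) = 2 * \<kappa>" by (simp add: \<kappa>_def l1_def sum.distrib)
  have xp: "x $ j > 0" for j using x by (simp add: pos_orthant_def)
  have nx: "norm x > 0" using xp component_le_norm_cart[of x] by (metis abs_le_D1 less_le_trans)
  have "(\<Prod>j\<in>UNIV. x $ j powr (\<alpha> $ j + 1/2)) \<le> (\<Prod>j\<in>UNIV. norm x powr (\<alpha> $ j + 1/2))"
    using xp \<alpha>' component_le_norm_cart[of x]
    by (intro prod_mono conjI powr_mono2) (auto intro: less_imp_le abs_le_D1)
  also have "\<dots> = norm x powr (2 * \<kappa>)"
    using nx by (simp add: powr_sum[symmetric] s)
  also have "\<dots> = ((norm x)\<^sup>2) powr \<kappa>"
    using nx powr_powr[of "norm x" 2 \<kappa>] by simp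
  also have "\<dots> \<le> (1 + (norm x)\<^sup>2) powr \<kappa>"
  proof (intro powr_mono2)
    have "0 \<le> (\<Sum>j\<in>UNIV. \<alpha> $ j + 1/2)" by (intro sum_nonneg \<alpha>')
    then show "0 \<le> \<kappa>" using s by simp
  qed auto
  finally have 1: "(\<Prod>j\<in>UNIV. x $ j powr (\<alpha> $ j + 1/2)) \<le> (1 + (norm x)\<^sup>2) powr \<kappa>" .
  have "\<bar>test_fun \<alpha> (\<kappa> + \<beta>) h x\<bar> = (\<Prod>j\<in>UNIV. x $ j powr (\<alpha> $ j + 1/2)) * ((1 + (norm x)\<^sup>2) powr (- (\<kappa> + \<beta>)) * \<bar>apply_bcontfun h ((norm x)\<^sup>2)\<bar>)"
    unfolding test_fun_def by (simp add: abs_mult abs_prod)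
  also have "\<dots> \<le> (1 + (norm x)\<^sup>2) powr \<kappa> * ((1 + (norm x)\<^sup>2) powr (- (\<kappa> + \<beta>)) * norm h)"
    using norm_bounded[of h "(norm x)\<^sup>2"] by (intro mult_mono 1) auto
  also have "\<dots> = norm h * ((1 + (norm x)\<^sup>2) powr \<kappa> * (1 + (norm x)\<^sup>2) powr (- (\<kappa> + \<beta>)))" by simp
  also have "(1 + (norm x)\<^sup>2) powr \<kappa> * (1 + (norm x)\<^sup>2) powr (- (\<kappa> + \<beta>)) = (1 + (norm x)\<^sup>2) powr (- \<beta>)"
    by (simp add: powr_add[symmetric])
  finally show ?thesis by (simp add: \<kappa>_def)
qed

text \<open>For finite p the p-th power is bounded by a multiple of (1 + |x|^2)^(- d s) with s =
  \<beta> p / d, hence by the product over j of (1 + x_j^2)^(- s). Each factor is integrable for 2 s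
  > 1, which is the condition \<beta> > d / (2 p).\<close>

lemma test_fun_in_Lp:
  fixes \<alpha> :: "real ^ 'n" and p :: ennreal
  assumes \<alpha>: "\<forall>j. \<alpha> $ j \<ge> -1/2" and p: "p > 0" and \<beta>: "\<beta> > real CARD('n) / 2 * enn2real (1 / p)"
  shows "in_Lp (lebesgue_on pos_orthant) p (\<lambda>x. of_real (test_fun \<alpha> ((l1 \<alpha> + real CARD('n) / 2) / 2 + \<beta>) h x))"
proof -
  define \<gamma> where "\<gamma> = (l1 \<alpha> + real CARD('n) / 2) / 2 + \<beta>"
  have \<beta>0: "\<beta> > 0" using \<beta> by (rule le_less_trans[rotated]) simp
  have B: "\<bar>test_fun \<alpha> \<gamma> h x\<bar> \<le> norm h * (1 + (norm x)\<^sup>2) powr (- \<beta>)" if "x \<in> pos_orthant" for x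
    unfolding \<gamma>_def by (rule test_fun_bound[OF \<alpha> that])
  have "(\<lambda>x. complex_of_real (test_fun \<alpha> \<gamma> h x)) \<in> borel_measurable lborel"
    using test_fun_measurable[of \<alpha> \<gamma> h] by simp
  then have meas: "(\<lambda>x. complex_of_real (test_fun \<alpha> \<gamma> h x)) \<in> borel_measurable (lebesgue_on pos_orthant)"
    by (intro measurable_restrict_space1 measurable_completion)
  show ?thesis unfolding \<gamma>_def[symmetric]
  proof (cases "p = \<infinity>")
    case True
    have "AE x in lebesgue_on pos_orthant. norm (complex_of_real (test_fun \<alpha> \<gamma> h x)) \<le> norm h"
    proof (rule AE_I2)
      fix x assume "x \<in> space (lebesgue_on (pos_orthant :: (real ^ 'n) set))"
      then have x: "x \<in> pos_orthant" by (simp add: space_restrict_space)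
      have "\<bar>test_fun \<alpha> \<gamma> h x\<bar> \<le> norm h * (1 + (norm x)\<^sup>2) powr (- \<beta>)" by (rule B[OF x])
      also have "\<dots> \<le> norm h * 1" using \<beta>0 by (intro mult_left_mono powr_neg_le_1) auto
      finally show "norm (complex_of_real (test_fun \<alpha> \<gamma> h x)) \<le> norm h" by simp
    qed
    then show "in_Lp (lebesgue_on pos_orthant) p (\<lambda>x. complex_of_real (test_fun \<alpha> \<gamma> h x))"
      using True meas unfolding in_Lp_def by auto
  next
    case False
    define q where "q = enn2real p"
    have q0: "q > 0" using p False unfolding q_def by (simp add: enn2real_positive_iff top.not_eq_extremum)
    have "p = ennreal q" using False unfolding q_def by (simp add: top.not_eq_extremum)
    then have ip: "enn2real (1 / p) = 1 / q" using q0
      by (simp add: divide_ennreal[of 1 q, symmetric] flip: ennreal_1)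
    define s where "s = \<beta> * q / real CARD('n)"
    have s: "s > 1/2" using \<beta> q0 unfolding ip s_def by (simp add: field_simps)
    define K where "K = (\<lambda>x :: real ^ 'n. \<Prod>j\<in>UNIV. indicator {0<..} (x $ j) * (1 + (x $ j)\<^sup>2) powr (- s))"
    have K: "integrable lborel K"
      using has_bochner_integral_lborel_vec_prod[of "\<lambda>(_::'n) y. indicator {0<..} y * (1 + y\<^sup>2) powr (- s)"
          "\<lambda>_. LINT y|lborel. indicator {0<..} y * (1 + y\<^sup>2) powr (- s)"]
        integrable_Japanese_bracket[OF s]
      by (simp add: has_bochner_integral_iff K_def[abs_def])
    have K0: "K x \<ge> 0" for x unfolding K_def by (intro prod_nonneg) auto
    have le: "indicator pos_orthant x * \<bar>test_fun \<alpha> \<gamma> h x\<bar> powr q \<le> norm h powr q * K x" for x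
    proof (cases "x \<in> pos_orthant")
      case True
      have "\<bar>test_fun \<alpha> \<gamma> h x\<bar> powr q \<le> (norm h * (1 + (norm x)\<^sup>2) powr (- \<beta>)) powr q"
        using B[OF True] q0 by (intro powr_mono2) auto
      also have "\<dots> = norm h powr q * (1 + (norm x)\<^sup>2) powr (- \<beta> * q)"
        by (simp add: powr_mult powr_powr)
      also have "(1 + (norm x)\<^sup>2) powr (- \<beta> * q) = (\<Prod>j\<in>(UNIV :: 'n set). (1 + (norm x)\<^sup>2) powr (- s))"
        unfolding prod_constant by (simp add: powr_power s_def add_nonneg_eq_0_iff)
      also have "\<dots> \<le> K x"
        unfolding K_def
      proof (intro prod_mono conjI)
        fix j
        have "(x $ j)\<^sup>2 \<le> (norm x)\<^sup>2"
          using component_le_norm_cart[of x j] power_mono[of "\<bar>x $ j\<bar>" "norm x" 2] by simp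
        then have "(1 + (norm x)\<^sup>2) powr (- s) \<le> (1 + (x $ j)\<^sup>2) powr (- s)"
          using s by (intro powr_mono2') (auto intro: add_pos_nonneg)
        then show "(1 + (norm x)\<^sup>2) powr (- s) \<le> indicator {0<..} (x $ j) * (1 + (x $ j)\<^sup>2) powr (- s)"
          using True by (simp add: pos_orthant_def)
      qed auto
      finally show ?thesis using True by (simp add: mult_left_mono)
    next
      case False
      then show ?thesis using K0[of x] by simp
    qed
    have "(\<integral>\<^sup>+ x. ennreal (norm (complex_of_real (test_fun \<alpha> \<gamma> h x)) powr q) \<partial>lebesgue_on pos_orthant)
       = (\<integral>\<^sup>+ x. ennreal (norm (complex_of_real (test_fun \<alpha> \<gamma> h x)) powr q) * indicator pos_orthant x \<partial>lebesgue)"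
      by (rule nn_integral_restrict_space) (use pos_orthant_lebesgue in simp)
    also have "\<dots> \<le> (\<integral>\<^sup>+ x. ennreal (norm h powr q * K x) \<partial>lebesgue)"
    proof (rule nn_integral_mono)
      fix x :: "real ^ 'n"
      show "ennreal (norm (complex_of_real (test_fun \<alpha> \<gamma> h x)) powr q) * indicator pos_orthant x \<le> ennreal (norm h powr q * K x)"
        using le[of x] by (cases "x \<in> pos_orthant") (auto intro!: ennreal_leI)
    qed
    also have "\<dots> = (\<integral>\<^sup>+ x. ennreal (norm h powr q * K x) \<partial>lborel)"
      by (rule nn_integral_completion)
    also have "\<dots> = ennreal (LINT x|lborel. norm h powr q * K x)"
      using K K0 by (intro nn_integral_eq_integral) auto
    also have "\<dots> < \<infinity>" by simp
    finally show "in_Lp (lebesgue_on pos_orthant) p (\<lambda>x. complex_of_real (test_fun \<alpha> \<gamma> h x))"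
      using False meas unfolding in_Lp_def q_def by simp
  qed
qed

section \<open>From Riesz means to spectral projections\<close>

fun backward_diff :: "real \<Rightarrow> nat \<Rightarrow> (real \<Rightarrow> 'a::real_normed_vector) \<Rightarrow> real \<Rightarrow> 'a" where
  "backward_diff \<epsilon> 0 f x = f x"
| "backward_diff \<epsilon> (Suc M) f x = backward_diff \<epsilon> M f x - backward_diff \<epsilon> M f (x - \<epsilon>)"

lemma backward_diff_Suc':
  "backward_diff \<epsilon> (Suc M) f x = backward_diff \<epsilon> M (\<lambda>s. f s - f (s - \<epsilon>)) x"
proof (induction M arbitrary: x)
  case (Suc M)
  then show ?case by (metis backward_diff.simps(2))
qed simp

lemma backward_diff_sum:
  "backward_diff \<epsilon> M (\<lambda>s. \<Sum>k\<in>K. f k s *\<^sub>R v k) x = (\<Sum>k\<in>K. backward_diff \<epsilon> M (f k) x *\<^sub>R v k)"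
  by (induction M arbitrary: x) (simp_all add: sum_subtractf[symmetric] scaleR_left_diff_distrib)

lemma norm_backward_diff_le:
  assumes "\<And>i. i \<le> M \<Longrightarrow> norm (f (x - real i * \<epsilon>)) \<le> K"
  shows "norm (backward_diff \<epsilon> M f x) \<le> 2 ^ M * K"
  using assms
proof (induction M arbitrary: x)
  case 0
  then show ?case by (auto dest: spec[of _ 0])
next
  case (Suc M)
  have 1: "norm (backward_diff \<epsilon> M f x) \<le> 2 ^ M * K"
    by (rule Suc.IH) (use Suc.prems in simp)
  have 2: "norm (backward_diff \<epsilon> M f (x - \<epsilon>)) \<le> 2 ^ M * K"
  proof (rule Suc.IH)
    fix i assume "i \<le> M"
    then show "norm (f (x - \<epsilon> - real i * \<epsilon>)) \<le> K"
      using Suc.prems[of "Suc i"] by (simp add: algebra_simps)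
  qed
  show ?case
    using norm_triangle_ineq4[of "backward_diff \<epsilon> M f x" "backward_diff \<epsilon> M f (x - \<epsilon>)"] 1 2 by simp
qed

lemma backward_diff_eq_leading:
  assumes "\<And>i. 1 \<le> i \<Longrightarrow> i \<le> M \<Longrightarrow> f (x - real i * \<epsilon>) = 0"
  shows "backward_diff \<epsilon> M f x = f x"
  using assms
proof (induction M)
  case (Suc M)
  have "norm (backward_diff \<epsilon> M f (x - \<epsilon>)) \<le> 2 ^ M * 0"
  proof (rule norm_backward_diff_le)
    fix i assume "i \<le> M"
    then show "norm (f (x - \<epsilon> - real i * \<epsilon>)) \<le> 0"
      using Suc.prems[of "Suc i"] by (simp add: algebra_simps)
  qed
  then show ?case using Suc by simp
qed simp

text \<open>\<open>f j\<close> stands for the j-th derivative of \<open>f 0\<close>. By the mean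
  value theorem each difference gains a factor \<epsilon> and costs one derivative; the induction is
  applied to the differences of all \<open>f j\<close> at once.\<close>

lemma backward_diff_le_deriv:
  fixes f :: "nat \<Rightarrow> real \<Rightarrow> real"
  assumes "\<epsilon> > 0"
    and "\<And>j s. j < M \<Longrightarrow> x - real M * \<epsilon> \<le> s \<Longrightarrow> s \<le> x \<Longrightarrow> (f j has_real_derivative f (Suc j) s) (at s)"
    and "\<And>s. x - real M * \<epsilon> \<le> s \<Longrightarrow> s \<le> x \<Longrightarrow> \<bar>f M s\<bar> \<le> K"
  shows "\<bar>backward_diff \<epsilon> M (f 0) x\<bar> \<le> \<epsilon> ^ M * K"
  using assms(2,3)
proof (induction M arbitrary: f K)
  case 0
  then show ?case by simp
next
  case (Suc M)
  define g where "g = (\<lambda>j s. f j s - f j (s - \<epsilon>))"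
  have "\<bar>backward_diff \<epsilon> M (g 0) x\<bar> \<le> \<epsilon> ^ M * (\<epsilon> * K)"
  proof (rule Suc.IH)
    fix j s assume j: "j < M" and s: "x - real M * \<epsilon> \<le> s" "s \<le> x"
    have "(f j has_real_derivative f (Suc j) s) (at s)"
      by (rule Suc.prems(1)) (use j s assms(1) in \<open>auto simp: algebra_simps\<close>)
    moreover have "(f j has_real_derivative f (Suc j) (s - \<epsilon>)) (at (s - \<epsilon>))"
      by (rule Suc.prems(1)) (use j s assms(1) in \<open>auto simp: algebra_simps\<close>)
    ultimately show "(g j has_real_derivative g (Suc j) s) (at s)"
      unfolding g_def by (intro derivative_intros) (auto intro!: DERIV_chain2[where g="\<lambda>s. s - \<epsilon>", THEN DERIV_cong] derivative_eq_intros)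
  next
    fix s assume s: "x - real M * \<epsilon> \<le> s" "s \<le> x"
    have "\<exists>z>s - \<epsilon>. z < s \<and> f M s - f M (s - \<epsilon>) = (s - (s - \<epsilon>)) * f (Suc M) z"
      by (rule MVT2) (use assms(1) s in \<open>auto intro!: Suc.prems(1) simp: algebra_simps\<close>)
    then obtain z where z: "s - \<epsilon> < z" "z < s" "g M s = \<epsilon> * f (Suc M) z" by (auto simp: g_def)
    have "\<bar>f (Suc M) z\<bar> \<le> K"
      by (rule Suc.prems(2)) (use z s in \<open>auto simp: algebra_simps\<close>)
    then show "\<bar>g M s\<bar> \<le> \<epsilon> * K" using z assms(1) by (simp add: abs_mult)
  qed
  then show ?case unfolding backward_diff_Suc' g_def by (simp add: mult_ac)
qed

text \<open>A high order backward difference with small step isolates the last coefficient: the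
  power \<open>(s - k)\<^sup>\<lambda>\<close> is smooth near \<open>n\<close> for every \<open>k < n\<close>, with summable derivative bounds.\<close>

lemma riesz_means_coeff_bound:
  fixes lam :: real
  assumes lam: "lam \<ge> 0"
  obtains C where "C > 0"
    "\<And>(b :: nat \<Rightarrow> 'a::real_normed_vector) B c n. \<lbrakk>c \<ge> 0; B \<ge> 0;
       \<And>s N. 0 < s \<Longrightarrow> s \<le> real N + 1 \<Longrightarrow>
         norm (\<Sum>k\<le>N. (max 0 (s - real k) powr lam) *\<^sub>R b k) \<le> B * (s + c) powr lam\<rbrakk>
     \<Longrightarrow> norm (b n) \<le> C * B * (real n + 1 + c) powr lam"
proof -
  \<comment> \<open>M exceeds \<lambda> + 1, which makes the derivative bounds summable over k and
    yields \<open>\<epsilon> ^ M \<le> \<epsilon> powr lam * \<epsilon>\<close>.\<close>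
  define M where "M = nat \<lfloor>lam\<rfloor> + 2"
  have M: "lam + 1 < real M" "M > 0" using lam unfolding M_def by linarith+
  \<comment> \<open>Falling factorials: the j-th derivative of x^\<lambda> for x > 0 is
    \<open>p j * x powr (lam - real j)\<close>.\<close>
  define p where "p = (\<lambda>j. \<Prod>i<j. lam - real i)"
  define S where "S = (\<Sum>m. (real m / 2) powr (lam - real M))"
  have sm: "summable (\<lambda>m. (real m / 2) powr (lam - real M))"
    using M by (simp add: powr_divide summable_real_powr_iff)
  define K where "K = \<bar>p M\<bar> * S"
  have S0: "S \<ge> 0" unfolding S_def by (rule suminf_nonneg[OF sm]) simp
  have K0: "K \<ge> 0" unfolding K_def using S0 by simp
  \<comment> \<open>The first bound keeps all nodes at distance at least (n - k) / 2 from each k <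
    n. The second lets the earlier coefficients contribute at most half, so that the induction
    closes with the same C.\<close>
  define \<epsilon> where "\<epsilon> = min (1 / (2 * real M)) (1 / (2 * K + 2))"
  have e: "\<epsilon> > 0" "real M * \<epsilon> \<le> 1/2" "\<epsilon> * K \<le> 1/2" "\<epsilon> < 1"
  proof -
    show "\<epsilon> > 0" using K0 M by (simp add: \<epsilon>_def)
    have "\<epsilon> \<le> 1 / (2 * real M)" by (simp add: \<epsilon>_def)
    then show "real M * \<epsilon> \<le> 1/2" using M by (simp add: field_simps)
    have "\<epsilon> \<le> 1 / (2 * K + 2)" by (simp add: \<epsilon>_def)
    then show "\<epsilon> * K \<le> 1/2" using K0 \<open>\<epsilon> > 0\<close> by (simp add: field_simps)
    have "1 / (2 * K + 2) < 1" using K0 by (simp add: field_simps)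
    with \<open>\<epsilon> \<le> 1 / (2 * K + 2)\<close> show "\<epsilon> < 1" by linarith
  qed
  define C where "C = 2 ^ (M + 1) / \<epsilon> powr lam"
  have "C > 0" using e by (simp add: C_def)
  moreover have "norm (b n) \<le> C * B * (real n + 1 + c) powr lam"
    if c: "c \<ge> 0" and B: "B \<ge> 0" and T: "\<And>s N. 0 < s \<Longrightarrow> s \<le> real N + 1 \<Longrightarrow>
      norm (\<Sum>k\<le>N. (max 0 (s - real k) powr lam) *\<^sub>R b k) \<le> B * (s + c) powr lam"
    for b :: "nat \<Rightarrow> 'a" and B c n
  proof (induction n rule: less_induct)
    case (less n)
    define Q where "Q = C * B * (real n + 1 + c) powr lam"
    have Q0: "Q \<ge> 0" using \<open>C > 0\<close> B by (simp add: Q_def)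
    have prev: "norm (b k) \<le> Q" if "k < n" for k
    proof -
      have "norm (b k) \<le> C * B * (real k + 1 + c) powr lam" by (rule less.IH[OF that])
      also have "\<dots> \<le> Q" unfolding Q_def
        using that lam \<open>C > 0\<close> B c by (intro mult_left_mono powr_mono2) auto
      finally show ?thesis .
    qed
    define P where "P = (\<lambda>k s. max 0 (s - real k) powr lam)"
    have "norm (backward_diff \<epsilon> M (\<lambda>s. \<Sum>k\<le>n. P k s *\<^sub>R b k) (real n + \<epsilon>)) \<le> 2 ^ M * (B * (real n + 1 + c) powr lam)"
    proof (rule norm_backward_diff_le)
      fix i assume "i \<le> M"
      define s where "s = real n + \<epsilon> - real i * \<epsilon>"
      have sn: "s \<le> real n + 1" using e by (simp add: s_def) (smt (verit) mult_nonneg_nonneg of_nat_0_le_iff)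
      show "norm (\<Sum>k\<le>n. P k (real n + \<epsilon> - real i * \<epsilon>) *\<^sub>R b k) \<le> B * (real n + 1 + c) powr lam"
      proof (cases "s > 0")
        case True
        have "norm (\<Sum>k\<le>n. P k s *\<^sub>R b k) \<le> B * (s + c) powr lam"
          unfolding P_def by (rule T[OF True sn])
        also have "\<dots> \<le> B * (real n + 1 + c) powr lam"
          using True sn lam B c by (intro mult_left_mono powr_mono2) auto
        finally show ?thesis by (simp add: s_def)
      next
        case False
        then have "P k s = 0" for k by (simp add: P_def max_absorb1)
        then show ?thesis using B by (simp add: s_def)
      qed
    qed
    moreover have "backward_diff \<epsilon> M (\<lambda>s. \<Sum>k\<le>n. P k s *\<^sub>R b k) (real n + \<epsilon>) =
        (\<Sum>k<n. backward_diff \<epsilon> M (P k) (real n + \<epsilon>) *\<^sub>R b k) + \<epsilon> powr lam *\<^sub>R b n"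
    proof -
      \<comment> \<open>Only the top node lies above n. The next one is n itself, where the term is
        0 even for \<lambda> = 0 because \<open>0 powr 0 = 0\<close>.\<close>
      have "backward_diff \<epsilon> M (P n) (real n + \<epsilon>) = P n (real n + \<epsilon>)"
      proof (rule backward_diff_eq_leading)
        fix i :: nat assume "1 \<le> i"
        then have "\<epsilon> - real i * \<epsilon> \<le> 0" using e by (simp add: mult_le_cancel_right1)
        then show "P n (real n + \<epsilon> - real i * \<epsilon>) = 0"
          unfolding P_def by (simp add: max_absorb1)
      qed
      then show ?thesis
        unfolding backward_diff_sum lessThan_Suc_atMost[symmetric] using e by (simp add: P_def)
    qed
    moreover have "norm (\<Sum>k<n. backward_diff \<epsilon> M (P k) (real n + \<epsilon>) *\<^sub>R b k) \<le> \<epsilon> ^ M * K * Q"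
    proof -
      have "\<bar>backward_diff \<epsilon> M (P k) (real n + \<epsilon>)\<bar> \<le> \<epsilon> ^ M * (\<bar>p M\<bar> * (real (n - k) / 2) powr (lam - real M))"
        if "k < n" for k
      proof -
        \<comment> \<open>For j = 0 the truncated power itself is kept; it agrees with the smooth
          power for s > k, which covers the range of the nodes.\<close>
        define f where "f = (\<lambda>j s. if j = 0 then P k s else p j * (s - real k) powr (lam - real j))"
        have low: "real (n - k) / 2 \<le> s - real k" if "real n + \<epsilon> - real M * \<epsilon> \<le> s" for s
        proof -
          have "real n - real k \<ge> 1" using \<open>k < n\<close> by linarith
          then show ?thesis using that e \<open>k < n\<close> by (simp add: of_nat_diff)
        qed
        have pos: "real (n - k) / 2 > 0" using \<open>k < n\<close> by simp
        have "\<bar>backward_diff \<epsilon> M (f 0) (real n + \<epsilon>)\<bar> \<le> \<epsilon> ^ M * (\<bar>p M\<bar> * (real (n - k) / 2) powr (lam - real M))"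
        proof (rule backward_diff_le_deriv)
          fix s assume s: "real n + \<epsilon> - real M * \<epsilon> \<le> s"
          note ls = low[OF s] pos
          have "(s - real k) powr (lam - real M) \<le> (real (n - k) / 2) powr (lam - real M)"
            using ls M by (intro powr_mono2') auto
          then show "\<bar>f M s\<bar> \<le> \<bar>p M\<bar> * (real (n - k) / 2) powr (lam - real M)"
            using M by (simp add: f_def abs_mult mult_left_mono)
          fix j
          have "s - real k > 0" using ls by linarith
          then have D: "((\<lambda>s. p j * (s - real k) powr (lam - real j)) has_real_derivative f (Suc j) s) (at s)"
            by (auto simp: f_def p_def algebra_simps intro!: derivative_eq_intros)
          show "(f j has_real_derivative f (Suc j) s) (at s)"
          proof (cases "j = 0")
            case True
            have "eventually (\<lambda>t. t > real k) (nhds s)"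
              using \<open>s - real k > 0\<close> by (intro eventually_nhds_in_open[of "{real k<..}", simplified]) auto
            then have "eventually (\<lambda>t. f 0 t = p 0 * (t - real k) powr (lam - real 0)) (nhds s)"
              by eventually_elim (simp add: f_def P_def p_def)
            then show ?thesis using D True by (subst DERIV_cong_ev[OF refl _ refl]) auto
          next
            case False
            then have "f j = (\<lambda>s. p j * (s - real k) powr (lam - real j))" by (auto simp: f_def)
            with D show ?thesis by simp
          qed
        qed (use e in auto)
        moreover have "f 0 = P k" by (auto simp: f_def)
        ultimately show ?thesis by simp
      qed
      then have "norm (\<Sum>k<n. backward_diff \<epsilon> M (P k) (real n + \<epsilon>) *\<^sub>R b k) \<le>
          (\<Sum>k<n. (\<epsilon> ^ M * (\<bar>p M\<bar> * (real (n - k) / 2) powr (lam - real M))) * Q)"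
        using prev Q0 by (intro sum_norm_le) (auto intro!: mult_mono mult_nonneg_nonneg simp: e(1) less_imp_le)
      also have "\<dots> = \<epsilon> ^ M * \<bar>p M\<bar> * Q * (\<Sum>k<n. (real (n - k) / 2) powr (lam - real M))"
        by (simp add: sum_distrib_left mult_ac)
      also have "(\<Sum>k<n. (real (n - k) / 2) powr (lam - real M)) = (\<Sum>m\<in>{1..n}. (real m / 2) powr (lam - real M))"
        by (rule sum.reindex_bij_witness[of _ "\<lambda>m. n - m" "\<lambda>k. n - k"]) auto
      also have "\<epsilon> ^ M * \<bar>p M\<bar> * Q * \<dots> \<le> \<epsilon> ^ M * \<bar>p M\<bar> * Q * S"
        unfolding S_def using Q0 e by (intro mult_left_mono sum_le_suminf[OF sm]) auto
      finally show ?thesis by (simp add: K_def mult_ac)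
    qed
    ultimately have "norm (\<epsilon> powr lam *\<^sub>R b n) \<le> 2 ^ M * (B * (real n + 1 + c) powr lam) + \<epsilon> ^ M * K * Q"
      by (smt (verit) norm_triangle_ineq4 add_diff_cancel_left')
    also have "2 ^ M * (B * (real n + 1 + c) powr lam) = \<epsilon> powr lam * (Q / 2)"
      using e by (simp add: Q_def C_def)
    also have "\<epsilon> ^ M * K * Q \<le> \<epsilon> powr lam * (Q / 2)"
    proof -
      have "\<epsilon> ^ M = \<epsilon> powr (real M)" using e by (simp add: powr_realpow)
      also have "\<dots> \<le> \<epsilon> powr (lam + 1)" using e M by (intro powr_mono') auto
      also have "\<dots> = \<epsilon> powr lam * \<epsilon>" using e by (simp add: powr_add)
      finally have "\<epsilon> ^ M * K \<le> \<epsilon> powr lam * \<epsilon> * K" using K0 by (rule mult_right_mono)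
      also have "\<dots> \<le> \<epsilon> powr lam * (1/2)" using e by (simp add: mult.assoc)
      finally show ?thesis using Q0 mult_right_mono by fastforce
    qed
    finally have "\<epsilon> powr lam * norm (b n) \<le> \<epsilon> powr lam * Q" by (simp add: mult.commute)
    then show ?case using e by (simp add: Q_def)
  qed
  ultimately show ?thesis using that by blast
qed

section \<open>Measurability of the divergence set\<close>

lemma laguerre_fun_continuous:
  assumes \<alpha>: "\<forall>j. \<alpha> $ j > -1"
  shows "continuous_on pos_orthant (laguerre_fun \<alpha> \<mu>)"
  unfolding laguerre_fun_def laguerre_fun1_def
proof (intro continuous_on_prod continuous_on_mult continuous_on_const)
  fix j
  show "continuous_on pos_orthant (\<lambda>x. x $ j powr (\<alpha> $ j + 1/2))"
    by (intro continuous_intros) (auto simp: pos_orthant_def less_imp_neq[symmetric])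
  show "continuous_on pos_orthant (\<lambda>x. laguerre (\<alpha> $ j) (\<mu> $ j) ((x $ j)\<^sup>2))"
    by (rule continuous_on_compose2[OF continuous_on_laguerre[of "\<alpha> $ j" UNIV]])
       (use \<alpha> in \<open>auto intro!: continuous_intros\<close>)
  show "continuous_on pos_orthant (\<lambda>x. exp (- (x $ j)\<^sup>2 / 2))"
    by (intro continuous_intros) simp
qed

lemma spectral_proj_continuous:
  assumes \<alpha>: "\<forall>j. \<alpha> $ j > -1"
  shows "continuous_on pos_orthant (spectral_proj \<alpha> n f)"
  unfolding spectral_proj_def[abs_def]
  by (intro continuous_on_sum continuous_on_mult continuous_on_const continuous_on_of_real laguerre_fun_continuous \<alpha>)

lemma bochner_riesz_finite_sum:
  fixes \<alpha> :: "real ^ 'n"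
  assumes "R > 0"
  obtains K where "finite K" "\<And>f x. bochner_riesz \<alpha> lam R f x =
    (\<Sum>n\<in>K. of_real (max 0 (1 - laguerre_eigenvalue \<alpha> n / R\<^sup>2) powr lam) * spectral_proj \<alpha> n f x)"
proof (rule that[OF finite_bochner_riesz_terms[OF assms]])
  show "bochner_riesz \<alpha> lam R f x = (\<Sum>n\<in>{n. max 0 (1 - laguerre_eigenvalue \<alpha> n / R\<^sup>2) powr lam \<noteq> 0}.
     of_real (max 0 (1 - laguerre_eigenvalue \<alpha> n / R\<^sup>2) powr lam) * spectral_proj \<alpha> n f x)" for f x
    unfolding bochner_riesz_def
    by (rule suminf_finite[OF finite_bochner_riesz_terms[OF assms]]) auto
qed

text \<open>The supremum runs over uncountably many R, but each mean is a finite sum of continuous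
  functions of x, so its superlevel sets are open. The divergence set is a countable intersection of
  unions of these.\<close>

lemma divergence_set_measurable:
  fixes \<alpha> :: "real ^ 'n"
  assumes \<alpha>: "\<forall>j. \<alpha> $ j > -1"
  shows "{x \<in> pos_orthant. (SUP R\<in>{0<..}. ennreal (norm (bochner_riesz \<alpha> lam R f x))) = \<infinity>} \<in> sets borel"
proof -
  have "(SUP R\<in>{0<..}. ennreal (norm (bochner_riesz \<alpha> lam R f x))) = \<infinity> \<longleftrightarrow>
     (\<forall>m::nat. \<exists>R\<in>{0<..}. real m < norm (bochner_riesz \<alpha> lam R f x))" for x
  proof -
    have "(SUP R\<in>{0<..}. ennreal (norm (bochner_riesz \<alpha> lam R f x))) = \<infinity> \<longleftrightarrow>
      (\<forall>y<top. \<exists>R\<in>{0<..}. y < ennreal (norm (bochner_riesz \<alpha> lam R f x)))"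
      unfolding infinity_ennreal_def SUP_eq_top_iff ..
    also have "\<dots> \<longleftrightarrow> (\<forall>m::nat. \<exists>R\<in>{0<..}. real m < norm (bochner_riesz \<alpha> lam R f x))"
    proof (intro iffI allI impI)
      fix m :: nat assume H: "\<forall>y<top. \<exists>R\<in>{0<..}. y < ennreal (norm (bochner_riesz \<alpha> lam R f x))"
      have "ennreal (real m) < top" by simp
      with H obtain R where "R \<in> {0<..}" "ennreal (real m) < ennreal (norm (bochner_riesz \<alpha> lam R f x))" by blast
      then show "\<exists>R\<in>{0<..}. real m < norm (bochner_riesz \<alpha> lam R f x)"
        by (intro bexI[of _ R]) (auto simp: ennreal_less_iff)
    next
      fix y :: ennreal assume H: "\<forall>m::nat. \<exists>R\<in>{0<..}. real m < norm (bochner_riesz \<alpha> lam R f x)" and "y < top"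
      then obtain r where r: "y = ennreal r" "r \<ge> 0" by (cases y) auto
      obtain m :: nat where m: "r \<le> real m" using real_arch_simple by blast
      obtain R where "R \<in> {0<..}" "real m < norm (bochner_riesz \<alpha> lam R f x)" using H by blast
      then show "\<exists>R\<in>{0<..}. y < ennreal (norm (bochner_riesz \<alpha> lam R f x))"
        using r m by (intro bexI[of _ R]) (auto simp: ennreal_less_iff)
    qed
    finally show ?thesis .
  qed
  then have "{x \<in> pos_orthant. (SUP R\<in>{0<..}. ennreal (norm (bochner_riesz \<alpha> lam R f x))) = \<infinity>} =
     (\<Inter>m::nat. \<Union>R\<in>{0<..}. {x \<in> pos_orthant. real m < norm (bochner_riesz \<alpha> lam R f x)})"
    by auto
  moreover have "open {x \<in> pos_orthant. real m < norm (bochner_riesz \<alpha> lam R f x)}" if R: "R > 0" for m :: nat and R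
  proof -
    obtain K where K: "finite K" "\<And>f x. bochner_riesz \<alpha> lam R f x =
      (\<Sum>n\<in>K. of_real (max 0 (1 - laguerre_eigenvalue \<alpha> n / R\<^sup>2) powr lam) * spectral_proj \<alpha> n f x)"
      using bochner_riesz_finite_sum[OF R] by blast
    have "continuous_on pos_orthant (bochner_riesz \<alpha> lam R f)"
      unfolding K(2)[abs_def]
      by (intro continuous_on_sum continuous_on_mult continuous_on_const spectral_proj_continuous \<alpha>)
    then have "continuous_on pos_orthant (\<lambda>x. norm (bochner_riesz \<alpha> lam R f x))" by (rule continuous_on_norm)
    then have "open (pos_orthant \<inter> (\<lambda>x. norm (bochner_riesz \<alpha> lam R f x)) -` {real m<..})"
      by (rule continuous_open_preimage[OF _ open_pos_orthant]) simp
    moreover have "pos_orthant \<inter> (\<lambda>x. norm (bochner_riesz \<alpha> lam R f x)) -` {real m<..} =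
      {x \<in> pos_orthant. real m < norm (bochner_riesz \<alpha> lam R f x)}" by auto
    ultimately show ?thesis by simp
  qed
  moreover have "(\<Inter>m::nat. \<Union>R\<in>{0<..}. {x \<in> pos_orthant. real m < norm (bochner_riesz \<alpha> lam R f x)}) \<in> sets borel"
    by (intro sets.countable_INT image_subsetI borel_open open_UN ballI calculation(2)) auto
  ultimately show ?thesis by (simp only:)
qed

text \<open>With R^2 = 4 (s + c) and c = e_0 / 4 the multiplier of \<open>bochner_riesz\<close>
  becomes the \<lambda>-th power of (s - k)_+ / (s + c). Bounded means thus supply the hypothesis of
  \<open>riesz_means_coeff_bound\<close>, uniformly in s.\<close>

lemma spectral_proj_growth:
  fixes \<alpha> :: "real ^ 'n"
  assumes \<alpha>: "\<forall>j. \<alpha> $ j > -1" and lam: "lam \<ge> 0"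
    and fin: "(SUP R\<in>{0<..}. ennreal (norm (bochner_riesz \<alpha> lam R f x))) \<noteq> \<infinity>"
  shows "\<exists>C. \<forall>n. norm (spectral_proj \<alpha> n f x) \<le> C * (real n + 1) powr lam"
proof -
  define c where "c = laguerre_eigenvalue \<alpha> 0 / 4"
  have c0: "c > 0"
    using radial_order_gt[OF \<alpha>] by (simp add: c_def laguerre_eigenvalue_def radial_order_def)
  have ev: "laguerre_eigenvalue \<alpha> n = 4 * real n + 4 * c" for n
    by (simp add: c_def laguerre_eigenvalue_def)
  obtain B where B: "(SUP R\<in>{0<..}. ennreal (norm (bochner_riesz \<alpha> lam R f x))) = ennreal B" "B \<ge> 0"
    using fin by (cases "SUP R\<in>{0<..}. ennreal (norm (bochner_riesz \<alpha> lam R f x))") auto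
  have BR: "norm (bochner_riesz \<alpha> lam R f x) \<le> B" if "R > 0" for R
  proof -
    have "ennreal (norm (bochner_riesz \<alpha> lam R f x)) \<le> ennreal B"
      unfolding B(1)[symmetric] by (rule SUP_upper) (use that in simp)
    then show ?thesis using B(2) by simp
  qed
  define b where "b = (\<lambda>n. spectral_proj \<alpha> n f x)"
  have T: "norm (\<Sum>k\<le>N. (max 0 (s - real k) powr lam) *\<^sub>R b k) \<le> B * (s + c) powr lam"
    if s: "0 < s" "s \<le> real N + 1" for s N
  proof -
    define R where "R = sqrt (4 * (s + c))"
    have R: "R > 0" "R\<^sup>2 = 4 * (s + c)" using s c0 by (simp_all add: R_def)
    have co: "max 0 (s - real k) powr lam = (s + c) powr lam * max 0 (1 - laguerre_eigenvalue \<alpha> k / R\<^sup>2) powr lam" for k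
    proof -
      have "1 - laguerre_eigenvalue \<alpha> k / R\<^sup>2 = (s - real k) / (s + c)"
        unfolding R(2) ev using s c0 by (simp add: field_simps)
      moreover have "max 0 ((s - real k) / (s + c)) = max 0 (s - real k) / (s + c)"
        using s c0
        by (cases "real k \<le> s") (simp_all add: max_absorb1 max_absorb2 divide_nonpos_pos)
      moreover have "(s + c) powr lam * (max 0 (s - real k) / (s + c)) powr lam = max 0 (s - real k) powr lam"
        using s c0 by (simp add: powr_mult[symmetric])
      ultimately show ?thesis by simp
    qed
    have "bochner_riesz \<alpha> lam R f x = (\<Sum>k\<le>N. of_real (max 0 (1 - laguerre_eigenvalue \<alpha> k / R\<^sup>2) powr lam) * b k)"
      unfolding bochner_riesz_def b_def
    proof (rule suminf_finite)
      fix k assume "k \<notin> {..N}"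
      then have "s - real k \<le> 0" using s by simp
      then have "max 0 (s - real k) powr lam = 0" by (simp add: max_absorb1)
      then have "max 0 (1 - laguerre_eigenvalue \<alpha> k / R\<^sup>2) powr lam = 0"
        unfolding co using s c0 by simp
      then show "complex_of_real (max 0 (1 - laguerre_eigenvalue \<alpha> k / R\<^sup>2) powr lam) * spectral_proj \<alpha> k f x = 0" by simp
    qed simp
    then have "(\<Sum>k\<le>N. (max 0 (s - real k) powr lam) *\<^sub>R b k) = (s + c) powr lam *\<^sub>R bochner_riesz \<alpha> lam R f x"
      unfolding co by (simp add: scaleR_conv_of_real sum_distrib_left mult.assoc)
    then have "norm (\<Sum>k\<le>N. (max 0 (s - real k) powr lam) *\<^sub>R b k) = (s + c) powr lam * norm (bochner_riesz \<alpha> lam R f x)"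
      by simp
    also have "\<dots> \<le> (s + c) powr lam * B" by (intro mult_left_mono BR R) simp
    finally show ?thesis by (simp add: mult.commute)
  qed
  obtain C where C: "C > 0" "\<And>(b :: nat \<Rightarrow> complex) B c n. \<lbrakk>c \<ge> 0; B \<ge> 0;
       \<And>s N. 0 < s \<Longrightarrow> s \<le> real N + 1 \<Longrightarrow>
         norm (\<Sum>k\<le>N. (max 0 (s - real k) powr lam) *\<^sub>R b k) \<le> B * (s + c) powr lam\<rbrakk>
     \<Longrightarrow> norm (b n) \<le> C * B * (real n + 1 + c) powr lam"
    using riesz_means_coeff_bound[OF lam, where 'a = complex] by blast
  have "norm (b n) \<le> C * B * (1 + c) powr lam * (real n + 1) powr lam" for n
  proof -
    have "norm (b n) \<le> C * B * (real n + 1 + c) powr lam"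
      by (rule C(2)) (use c0 B T in auto)
    also have "\<dots> \<le> C * B * ((1 + c) * (real n + 1)) powr lam"
      using C(1) B(2) c0 lam by (intro mult_left_mono powr_mono2) (auto simp: algebra_simps)
    also have "\<dots> = C * B * (1 + c) powr lam * (real n + 1) powr lam"
      by (simp add: powr_mult)
    finally show ?thesis .
  qed
  then show ?thesis unfolding b_def by blast
qed

text \<open>Continuity from above along the unions of tails; the common bounding set D of finite
  measure prevents mass from escaping.\<close>

lemma emeasure_limsup_ge:
  fixes S :: "nat \<Rightarrow> 'a set"
  assumes S: "\<And>n. S n \<in> sets M" and c: "\<And>n. c \<le> emeasure M (S n)"
    and D: "\<And>n. S n \<subseteq> D" "D \<in> sets M" "emeasure M D < \<infinity>"
  shows "c \<le> emeasure M (\<Inter>k. \<Union>n\<in>{k..}. S n)"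
proof -
  have "(INF k. emeasure M (\<Union>n\<in>{k..}. S n)) = emeasure M (\<Inter>k. \<Union>n\<in>{k..}. S n)"
  proof (rule INF_emeasure_decseq)
    show "range (\<lambda>k. \<Union>n\<in>{k..}. S n) \<subseteq> sets M" using S by auto
    show "decseq (\<lambda>k. \<Union>n\<in>{k..}. S n)" unfolding decseq_def by (intro allI impI UN_mono) auto
    show "emeasure M (\<Union>n\<in>{k..}. S n) \<noteq> \<infinity>" for k
    proof -
      have "emeasure M (\<Union>n\<in>{k..}. S n) \<le> emeasure M D" using D by (intro emeasure_mono) auto
      then show ?thesis using D(3) by auto
    qed
  qed
  moreover have "c \<le> emeasure M (\<Union>n\<in>{k..}. S n)" for k
    by (rule order_trans[OF c[of k] emeasure_mono]) (use S in auto)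
  then have "c \<le> (INF k. emeasure M (\<Union>n\<in>{k..}. S n))" by (intro INF_greatest)
  ultimately show ?thesis by simp
qed

section \<open>Almost everywhere divergence\<close>

lemma tendsto_bcontfun_weight:
  assumes "\<gamma> > 0"
  shows "((\<lambda>s. (1 + s) powr (- \<gamma>) * apply_bcontfun (h :: real \<Rightarrow>\<^sub>C real) s) \<longlongrightarrow> 0) at_top"
proof (rule Lim_null_comparison)
  show "\<forall>\<^sub>F s in at_top. norm ((1 + s) powr (- \<gamma>) * apply_bcontfun h s) \<le> (1 + s) powr (- \<gamma>) * norm h"
    using norm_bounded[of h] by (intro always_eventually) (auto simp: abs_mult intro!: mult_left_mono)
  have "((\<lambda>s::real. (1 + s) powr (- \<gamma>)) \<longlongrightarrow> 0) at_top"
    using assms by real_asymp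
  then show "((\<lambda>s. (1 + s) powr (- \<gamma>) * norm h) \<longlongrightarrow> 0) at_top"
    by (rule tendsto_mult_left_zero)
qed

lemma spectral_proj_test_fun:
  fixes \<alpha> :: "real ^ 'n"
  assumes \<alpha>: "\<forall>j. \<alpha> $ j > -1" and \<gamma>: "\<gamma> > 0" and x: "x \<in> pos_orthant"
  shows "spectral_proj \<alpha> n (\<lambda>y. of_real (test_fun \<alpha> \<gamma> h y)) x =
    of_real (radial_functional (radial_order \<alpha>) \<gamma> n h / radial_mass \<alpha> n * radial_eigenfun \<alpha> n x)"
proof -
  have "continuous_on {0..} (apply_bcontfun h)"
    using apply_bcontfun[of h] by (auto simp: bcontfun_def intro: continuous_on_subset)
  then have "continuous_on {0..} (\<lambda>s. (1 + s) powr (- \<gamma>) * apply_bcontfun h s)"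
    by (intro continuous_intros) auto
  from spectral_proj_radial[OF \<alpha> this tendsto_bcontfun_weight[OF \<gamma>] x, of n]
  show ?thesis unfolding test_fun_def radial_functional_def .
qed

theorem proposition4p1:
  fixes \<alpha> :: "real ^ 'n"
  assumes "CARD('n) \<ge> 2"
    and "\<forall>j. \<alpha> $ j \<ge> -1/2"
  shows "\<exists>c::real. c > 0 \<and>
    (\<forall>(p::ennreal) (lam::real).
       ennreal (2 * real CARD('n) / (real CARD('n) - 1)) < p \<longrightarrow>
       0 \<le> lam \<longrightarrow> lam < critical_index CARD('n) p / 2 \<longrightarrow>
       (\<exists>f :: real ^ 'n \<Rightarrow> complex.
          in_Lp (lebesgue_on pos_orthant) p f \<and>
          emeasure lebesgue
            {x \<in> pos_orthant. (SUP R\<in>{0<..}. ennreal (norm (bochner_riesz \<alpha> lam R f x))) = \<infinity>}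
          \<ge> ennreal c))"
proof -
  define A where "A = radial_order \<alpha>"
  define E where "E = laguerre_freq A"
  define d where "d = real CARD('n)"
  have d2: "d \<ge> 2" using assms(1) by (simp add: d_def)
  have \<alpha>1: "\<forall>j. \<alpha> $ j > -1"
  proof
    fix j show "\<alpha> $ j > -1" using assms(2)[rule_format, of j] by linarith
  qed
  have "(\<Sum>j\<in>(UNIV :: 'n set). - 1/2) \<le> l1 \<alpha>"
    unfolding l1_def by (rule sum_mono) (use assms(2) in blast)
  then have l1: "- d / 2 \<le> l1 \<alpha>" by (simp add: d_def)
  then have A0: "A \<ge> 0" unfolding A_def radial_order_def d_def[symmetric] using d2 by linarith
  have A1: "A > -1" using A0 by linarith
  have mE: "radial_mass \<alpha> n = Gamma (A + real n + 1) / (2 * fact n)" for n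
    by (simp add: radial_mass_def A_def)
  note m0 = radial_mass_pos[OF \<alpha>1]
  obtain c1 N \<Gamma> where c1: "c1 > 0"
    and bounds: "\<And>n. n \<ge> N \<Longrightarrow> laguerre_energy_bounds A n (\<Gamma> n)"
    and low: "\<And>n. n \<ge> N \<Longrightarrow> c1 * radial_mass \<alpha> n * sqrt (E n) \<le> \<Gamma> n"
    unfolding E_def mE using laguerre_energy_estimates[OF A0] by blast
  note E = laguerre_energy_boundsD(1)[OF bounds, folded E_def] and \<Gamma> = laguerre_energy_boundsD(2)[OF bounds]
  obtain c \<delta> where c: "c > 0" and \<delta>: "\<delta> > 0"
    and Sm: "\<And>n. n \<ge> N \<Longrightarrow> large_set \<alpha> \<delta> (\<Gamma> n) n \<in> sets lborel"
    and Sc: "\<And>n. n \<ge> N \<Longrightarrow> ennreal c \<le> emeasure lborel (large_set \<alpha> \<delta> (\<Gamma> n) n)"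
    using eigenfun_large_set[OF assms(2) A0[unfolded A_def] bounds[unfolded A_def]] by blast
  show ?thesis
  \<comment> \<open>c is fixed before p and \<lambda>: it comes from the large sets, which are
    determined by \<alpha> and n.\<close>
  proof (intro exI[of _ c] conjI allI impI c)
    fix p :: ennreal and lam :: real
    assume p: "ennreal (2 * real CARD('n) / (real CARD('n) - 1)) < p"
      and lam: "0 \<le> lam" "lam < critical_index CARD('n) p / 2"
    have p0: "p > 0" using p by (rule le_less_trans[rotated]) simp
    define ip where "ip = enn2real (1 / p)"
    have ip0: "ip \<ge> 0" by (simp add: ip_def)
    \<comment> \<open>\<lambda> \<ge> 0 and the strict upper bound force the critical index to be
      positive, so the maximum in it is its first argument.\<close>
    have lam': "d / 2 * ip < d / 4 - 1/4 - lam"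
      using lam unfolding critical_index_def ip_def[symmetric] d_def[symmetric]
      by (auto simp: max_def algebra_simps split: if_splits)
    \<comment> \<open>Halfway between the two thresholds: above d / (2 p) for membership in L^p,
      below d/4 - 1/4 - \<lambda> for divergence.\<close>
    define \<beta> where "\<beta> = (d / 2 * ip + (d / 4 - 1/4 - lam)) / 2"
    have \<beta>: "d / 2 * ip < \<beta>" "\<beta> < d / 4 - 1/4 - lam" using lam' by (auto simp: \<beta>_def)
    have "0 \<le> d / 2 * ip" using d2 ip0 by simp
    then have \<beta>0: "\<beta> > 0" using \<beta> by linarith
    define \<gamma> where "\<gamma> = (l1 \<alpha> + d / 2) / 2 + \<beta>"
    have \<gamma>: "\<gamma> > 0" using \<beta>0 l1 unfolding \<gamma>_def by argo
    \<comment> \<open>The exponent of E that is left over; it equals d/4 - 1/4 - \<beta> -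
      \<lambda>.\<close>
    define \<theta> where "\<theta> = A / 2 + 1/4 - \<gamma> - lam"
    have \<theta>: "\<theta> > 0" using \<beta> unfolding \<theta>_def \<gamma>_def A_def radial_order_def d_def[symmetric]
      by argo
    \<comment> \<open>Up to the factor sqrt \<delta>, the guaranteed size of the eigenfunction on
      its large set, divided by the mass and the admissible growth. Thus \<open>U\<close> compares
      the projection on that set with \<open>(real n + 1) powr lam\<close>.\<close>
    define w where "w = (\<lambda>k. sqrt (\<Gamma> k / E k) / (radial_mass \<alpha> k * (real k + 1) powr lam))"
    define U where "U = (\<lambda>n h. radial_functional A \<gamma> (n + N) h * w (n + N))"
    have w0: "w k > 0" if "k \<ge> N" for k
      using E[OF that] \<Gamma>[OF that] m0[of k] by (simp add: w_def)
    define C where "C = (1/4) powr (A + 1/2) / (80 * exp 1 * sqrt (2 * exp 1)) * c1"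
    have C0: "C > 0" using c1 by (simp add: C_def)
    have lowU: "\<exists>h. norm h \<le> 1 \<and> C * E (n + N) powr \<theta> \<le> U n h" for n
    proof -
      define k where "k = n + N"
      have k: "k \<ge> N" by (simp add: k_def)
      have E0: "E k > 0" using E[OF k] by linarith
      obtain h where h: "norm h \<le> 1"
        "(1/4) powr (A + 1/2) / (80 * exp 1 * sqrt (2 * exp 1)) * E k powr (A / 2 + 1/4 - \<gamma>) * sqrt (\<Gamma> k) \<le> radial_functional A \<gamma> k h"
        using radial_functional_lower[OF A0 less_imp_le[OF \<gamma>] bounds[OF k]]
        unfolding E_def by blast
      have "E k powr (- lam) \<le> (real k + 1) powr (- lam)"
        using lam A0 by (intro powr_mono2') (auto simp: E_def laguerre_freq_def)
      then have e: "E k powr (- lam) \<le> 1 / (real k + 1) powr lam"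
        by (simp add: powr_minus divide_inverse)
      have "c1 \<le> \<Gamma> k / (radial_mass \<alpha> k * sqrt (E k))"
        using low[OF k] m0[of k] E0 by (simp add: pos_le_divide_eq mult.assoc)
      then have "c1 * E k powr (- lam) \<le> \<Gamma> k / (radial_mass \<alpha> k * sqrt (E k)) * (1 / (real k + 1) powr lam)"
        using e \<Gamma>[OF k] m0[of k] E0 by (intro mult_mono) auto
      also have "\<dots> = sqrt (\<Gamma> k) * w k"
      proof -
        have "sqrt (\<Gamma> k) * sqrt (\<Gamma> k / E k) = \<Gamma> k / sqrt (E k)"
          using \<Gamma>[OF k] by (simp add: real_sqrt_divide)
        then show ?thesis unfolding w_def by (simp add: field_simps)
      qed
      finally have 1: "c1 * E k powr (- lam) \<le> sqrt (\<Gamma> k) * w k" .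
      define a where "a = (1/4) powr (A + 1/2) / (80 * exp 1 * sqrt (2 * exp (1::real))) * E k powr (A / 2 + 1/4 - \<gamma>)"
      have a0: "a \<ge> 0" by (simp add: a_def)
      have "E k powr \<theta> = E k powr (A / 2 + 1/4 - \<gamma>) * E k powr (- lam)"
        by (simp add: \<theta>_def powr_add[symmetric])
      then have "C * E k powr \<theta> = a * (c1 * E k powr (- lam))"
        by (simp add: C_def a_def)
      also have "\<dots> \<le> a * (sqrt (\<Gamma> k) * w k)" using 1 a0 by (rule mult_left_mono)
      also have "\<dots> = (a * sqrt (\<Gamma> k)) * w k" by simp
      also have "\<dots> \<le> radial_functional A \<gamma> k h * w k"
        using h(2) w0[OF k] unfolding a_def by (intro mult_right_mono) auto
      finally show ?thesis using h(1) unfolding U_def k_def by blast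
    qed
    have "\<exists>h. \<forall>K. \<exists>n. \<bar>U n h\<bar> > K"
    proof (rule unbounded_functionals_at_point)
      show "bounded_linear (U n)" for n
        unfolding U_def
        by (rule bounded_linear_compose[OF bounded_linear_mult_left bounded_linear_radial_functional])
           (use A1 \<gamma> in auto)
      fix K :: real
      have "filterlim (\<lambda>n. C * E (n + N) powr \<theta>) at_top sequentially"
        unfolding E_def laguerre_freq_def using C0 \<theta> by real_asymp
      then obtain n where "C * E (n + N) powr \<theta> > K"
        unfolding filterlim_at_top_dense using eventually_happens by fastforce
      moreover obtain h where "norm h \<le> 1" "C * E (n + N) powr \<theta> \<le> U n h" using lowU by blast
      ultimately show "\<exists>n h. norm h \<le> 1 \<and> \<bar>U n h\<bar> > K" by (intro exI[of _ n] exI[of _ h]) auto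
    qed
    then obtain h where "\<And>K. \<exists>n. \<bar>U n h\<bar> > K" by blast
    then have "\<forall>j::nat. \<exists>n. \<bar>U n h\<bar> > real j" by blast
    \<comment> \<open>The indices \<nu> j may repeat or jump; a point in infinitely many of the sets
      \<open>S j\<close> below still meets values of \<open>\<bar>U (\<nu> j) h\<bar>\<close> beyond
      every bound.\<close>
    from choice[OF this] obtain \<nu> where \<nu>: "\<And>j::nat. \<bar>U (\<nu> j) h\<bar> > real j" by blast
    define S where "S = (\<lambda>j. large_set \<alpha> \<delta> (\<Gamma> (\<nu> j + N)) (\<nu> j + N))"
    define F where "F = (\<Inter>k. \<Union>j\<in>{k..}. S j)"
    have F: "ennreal c \<le> emeasure lborel F"
      unfolding F_def
    proof (rule emeasure_limsup_ge)
      show "S n \<in> sets lborel" "ennreal c \<le> emeasure lborel (S n)" for n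
        unfolding S_def by (rule Sm Sc; simp)+
      show "S n \<subseteq> cball 0 4" for n by (auto simp: S_def large_set_def)
      show "emeasure lborel (cball (0 :: real ^ 'n) 4) < \<infinity>" by (rule emeasure_lborel_cball_finite)
    qed simp
    define f where "f = (\<lambda>x. complex_of_real (test_fun \<alpha> \<gamma> h x))"
    define D where "D = {x \<in> pos_orthant. (SUP R\<in>{0<..}. ennreal (norm (bochner_riesz \<alpha> lam R f x))) = \<infinity>}"
    have FD: "F \<subseteq> D"
    proof
      fix x assume x: "x \<in> F"
      then have xp: "x \<in> pos_orthant" by (auto simp: F_def S_def large_set_def)
      have "(SUP R\<in>{0<..}. ennreal (norm (bochner_riesz \<alpha> lam R f x))) = \<infinity>"
      proof (rule ccontr)
        assume "(SUP R\<in>{0<..}. ennreal (norm (bochner_riesz \<alpha> lam R f x))) \<noteq> \<infinity>"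
        then obtain B where B: "\<And>n. norm (spectral_proj \<alpha> n f x) \<le> B * (real n + 1) powr lam"
          using spectral_proj_growth[OF \<alpha>1 lam(1)] by blast
        \<comment> \<open>From \<open>j0\<close> on, sqrt \<delta> times the index is at least B,
          while x still lies in some later \<open>S j\<close>.\<close>
        obtain j0 :: nat where j0: "B / sqrt \<delta> \<le> real j0" using real_arch_simple by blast
        obtain j where j: "j \<ge> j0" "x \<in> S j" using x by (auto simp: F_def)
        define k where "k = \<nu> j + N"
        have k: "k \<ge> N" by (simp add: k_def)
        have "\<delta> * (\<Gamma> k / E k) \<le> (radial_eigenfun \<alpha> k x)\<^sup>2" using j(2) by (simp add: S_def k_def large_set_def E_def A_def)
        then have "sqrt (\<delta> * (\<Gamma> k / E k)) \<le> \<bar>radial_eigenfun \<alpha> k x\<bar>"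
          using real_sqrt_le_mono by fastforce
        then have \<Phi>: "sqrt \<delta> * sqrt (\<Gamma> k / E k) \<le> \<bar>radial_eigenfun \<alpha> k x\<bar>" by (simp only: real_sqrt_mult)
        define T where "T = \<bar>radial_functional A \<gamma> k h\<bar>"
        have U: "\<bar>U (\<nu> j) h\<bar> = T * w k"
          using w0[OF k] by (simp add: U_def T_def k_def abs_mult)
        have pw: "(real k + 1) powr lam > 0" by simp
        have "B * (real k + 1) powr lam \<le> (sqrt \<delta> * real j) * (real k + 1) powr lam"
          using j0 j(1) \<delta> by (intro mult_right_mono) (auto simp: pos_divide_le_eq mult.commute intro: order_trans)
        also have "\<dots> < (sqrt \<delta> * (T * w k)) * (real k + 1) powr lam"
          using \<nu>[of j] \<delta> pw unfolding U by (intro mult_strict_right_mono mult_strict_left_mono) auto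
        also have "\<dots> = T / radial_mass \<alpha> k * (sqrt \<delta> * sqrt (\<Gamma> k / E k))"
          using pw unfolding w_def by simp
        also have "\<dots> \<le> T / radial_mass \<alpha> k * \<bar>radial_eigenfun \<alpha> k x\<bar>"
          using \<Phi> m0[of k] by (intro mult_left_mono) (auto simp: T_def)
        also have "\<dots> = norm (spectral_proj \<alpha> k f x)"
          unfolding f_def spectral_proj_test_fun[OF \<alpha>1 \<gamma> xp] A_def[symmetric] T_def
          using m0[of k] by (simp only: norm_of_real abs_mult abs_divide)
        finally show False using B[of k] by simp
      qed
      with xp show "x \<in> D" by (simp add: D_def)
    qed
    have Dm: "D \<in> sets lborel"
      unfolding D_def using divergence_set_measurable[OF \<alpha>1, of lam f] by simp
    have "ennreal c \<le> emeasure lborel D"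
      using F emeasure_mono[OF FD Dm] by (rule order_trans)
    also have "\<dots> = emeasure lebesgue D" using Dm by simp
    finally have "ennreal c \<le> emeasure lebesgue D" .
    moreover have "in_Lp (lebesgue_on pos_orthant) p f"
      unfolding f_def \<gamma>_def d_def
      by (rule test_fun_in_Lp[OF assms(2) p0]) (use \<beta> in \<open>simp add: d_def ip_def\<close>)
    ultimately show "\<exists>f :: real ^ 'n \<Rightarrow> complex. in_Lp (lebesgue_on pos_orthant) p f \<and>
          emeasure lebesgue {x \<in> pos_orthant. (SUP R\<in>{0<..}. ennreal (norm (bochner_riesz \<alpha> lam R f x))) = \<infinity>} \<ge> ennreal c"
      unfolding D_def by blast
  qed
qed

end
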